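(* Let $B=(b_{ij})$ be a generic symmetric $n\times n$ matrix ($b_{ij}=b_{ji}$) and let $\nu$ be a type of rank $n$ which is upper-triangular. Let $\Upsilon_\nu$ be the symmetric matrix of generic one-forms supported on $\nu$. If $n$ is odd then $$\operatorname{tr}\bigl((B\Upsilon_\nu)^{2n-1}\bigr)=(2n-1)\det(B)\,\Sigma(B,\nu\setminus\mathrm{diag}_n)\,\omega_\nu .$$ If $n$ is even then $\operatorname{tr}\bigl((B\Upsilon_\nu)^{2n-1}\bigr)$ vanishes.
   Context: A type of rank $n$ is a subset $\nu\subset\{(i,j):1\le i,j\le n\}$ with $|\nu|=2n-1$. Put $\mathrm{diag}_n=\{(1,1),\dots,(n,n)\}$. A type is upper-triangular if $\mathrm{diag}_n\subset\nu\subset\{(i,j):1\le i\le j\le n\}$. Work in the exterior algebra over $\mathbb{Q}[b_{ij}]/(b_{ij}-b_{ji})$ on degree-one generators $\omega_{ij}$, $1\le i\le j\le n$. For $\nu$ upper-triangular, $\Upsilon_\nu$ is the symmetric $n\times n$ matrix with entries $\omega_{ij}$ in positions $(i,j)$ and $(j,i)$ for each $(i,j)\in\nu$, and all other entries zero. The form $\omega_\nu$: choose an ordering $\nu=((i_1,j_1),\dots,(i_{2n-1},j_{2n-1}))$ and set $\eta_\nu=\omega_{i_1j_1}\wedge\dots\wedge\omega_{i_{2n-1}j_{2n-1}}$. Let $M_\nu$ be the $(2n-1)\times2n$ matrix whose $k$-th row has $-1$ in column $i_k$, $1$ in column $n+j_k$, zeros elsewhere. For any $1\le k\le2n$, with $M_\nu^{\emptyset,k}$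 denoting $M_\nu$ with column $k$ deleted, $\omega_\nu=(-1)^{\binom n2+k-1}\det(M_\nu^{\emptyset,k})\,\eta_\nu$; this is independent of the ordering and of $k$. For a set $\mathcal{E}=\{(s_1,t_1),\dots,(s_m,t_m)\}$ of $m$ pairs ($m$ even) of elements of $\{1,\dots,n\}$, and $I=\{i_1<\dots<i_k\}\subset\{1,\dots,m\}$, let $\mathcal{E}_I=(s_{i_1},t_{i_1},\dots,s_{i_k},t_{i_k})$. Let $B_{U,V}=(b_{uv})_{u\in U,v\in V}$ for lists $U,V$ (repetitions allowed). Then $$\Sigma(B,\mathcal{E})=\sum_{k=1}^{m/2}(-2)^kk!\sum_{\{\{I_1,J_1\},\dots,\{I_k,J_k\}\}\in\mathcal{D}_m^k}\det B_{\mathcal{E}_{I_1},\mathcal{E}_{J_1}}\cdots\det B_{\mathcal{E}_{I_k},\mathcal{E}_{J_k}},$$ and $\Sigma(B,\emptyset)=1$; it does not depend on the ordering of $\mathcal{E}$. Here $\mathcal{D}_m^k$ is the set of unordered $k$-tuples of unordered pairs $\{I_l,J_l\}$ of non-empty sets with $|I_l|=|J_l|$ such that $\{1,\dots,m\}$ is the disjoint union of all the $I_l$ and $J_l$. *)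

theory Defs
  imports
    Jordan_Normal_Form.Determinant
    "HOL-Library.Poly_Mapping"
    "HOL-Library.Uprod"
    "HOL-Library.Disjoint_Sets"
begin

text \<open>
  The exterior algebra over a commutative ring \<open>'r\<close> on degree-one generators indexed by a
  linearly ordered type \<open>'g\<close>. An element is given by its coefficients with respect to the basis of
  wedge monomials \<open>x\<^sub>1 \<and> \<dots> \<and> x\<^sub>d\<close> with \<open>x\<^sub>1 < \<dots> < x\<^sub>d\<close>, and such a monomial
  is represented by the finite set \<open>{x\<^sub>1, \<dots>, x\<^sub>d}\<close>. The wedge product is written \<open>*\<close>.
\<close>

typedef (overloaded) ('g, 'r :: zero) extalg =
  "{f :: 'g set \<Rightarrow> 'r. finite {A. f A \<noteq> 0} \<and> (\<forall>A. infinite A \<longrightarrow> f A = 0)}"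
  morphisms ext_coeff Abs_extalg
  by (rule exI[of _ "\<lambda>_. 0"]) auto

setup_lifting type_definition_extalg

lemma extalg_eqI: "(\<And>A. finite A \<Longrightarrow> ext_coeff x A = ext_coeff y A) \<Longrightarrow> x = y"
  by transfer (metis ext)

lemma ext_coeff_infinite: "infinite A \<Longrightarrow> ext_coeff x A = 0"
  by transfer auto

lemma finite_ext_coeff: "finite {A. ext_coeff x A \<noteq> 0}"
  by transfer auto

text \<open>
  The sign with which the wedge of the monomials of the disjoint sets \<open>A\<close> and \<open>B\<close>, in this order,
  equals the monomial of \<open>A \<union> B\<close>.
\<close>

definition ext_inv :: "'g :: linorder set \<Rightarrow> 'g set \<Rightarrow> nat" where
  "ext_inv A B = card {(a, b). a \<in> A \<and> b \<in> B \<and> b < a}"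

definition ext_sign :: "'g :: linorder set \<Rightarrow> 'g set \<Rightarrow> 'r :: ring_1" where
  "ext_sign A B = (- 1) ^ ext_inv A B"

lemma ext_inv_finite:
  assumes "finite A" "finite B"
  shows "finite {(a, b). a \<in> A \<and> b \<in> B \<and> P a b}"
  by (rule finite_subset[of _ "A \<times> B"]) (use assms in auto)

lemma ext_inv_union_left:
  assumes "finite A" "finite A'" "finite B" "A \<inter> A' = {}"
  shows "ext_inv (A \<union> A') B = ext_inv A B + ext_inv A' B"
proof -
  have "{(a, b). a \<in> A \<union> A' \<and> b \<in> B \<and> b < a} =
      {(a, b). a \<in> A \<and> b \<in> B \<and> b < a} \<union> {(a, b). a \<in> A' \<and> b \<in> B \<and> b < a}"
    by auto
  also have "card \<dots> = ext_inv A B + ext_inv A' B"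
    unfolding ext_inv_def using assms
    by (intro card_Un_disjoint ext_inv_finite) auto
  finally show ?thesis unfolding ext_inv_def .
qed

lemma ext_inv_union_right:
  assumes "finite A" "finite B" "finite B'" "B \<inter> B' = {}"
  shows "ext_inv A (B \<union> B') = ext_inv A B + ext_inv A B'"
proof -
  have "{(a, b). a \<in> A \<and> b \<in> B \<union> B' \<and> b < a} =
      {(a, b). a \<in> A \<and> b \<in> B \<and> b < a} \<union> {(a, b). a \<in> A \<and> b \<in> B' \<and> b < a}"
    by auto
  also have "card \<dots> = ext_inv A B + ext_inv A B'"
    unfolding ext_inv_def using assms
    by (intro card_Un_disjoint ext_inv_finite) auto
  finally show ?thesis unfolding ext_inv_def .
qed

lemma ext_sign_empty [simp]: "ext_sign {} B = 1" "ext_sign A {} = 1"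
  by (simp_all add: ext_sign_def ext_inv_def)

lemma ext_sign_cocycle:
  assumes "finite A" "finite B" "finite C" "A \<inter> B = {}" "A \<inter> C = {}" "B \<inter> C = {}"
  shows "ext_sign (A \<union> B) C * ext_sign A B = ext_sign A (B \<union> C) * (ext_sign B C :: 'r :: comm_ring_1)"
  using assms
  by (simp add: ext_sign_def ext_inv_union_left ext_inv_union_right power_add mult_ac)

instantiation extalg :: (type, ab_group_add) ab_group_add
begin

lift_definition zero_extalg :: "('a, 'b) extalg" is "\<lambda>_. 0" by simp

lift_definition plus_extalg :: "('a, 'b) extalg \<Rightarrow> ('a, 'b) extalg \<Rightarrow> ('a, 'b) extalg"
  is "\<lambda>f g A. f A + g A"
proof safe
  fix f g :: "'a set \<Rightarrow> 'b"
  assume "finite {A. f A \<noteq> 0}" "finite {A. g A \<noteq> 0}"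
  then show "finite {A. f A + g A \<noteq> 0}"
    by (rule finite_subset[rotated, OF finite_UnI]) auto
qed auto

lift_definition minus_extalg :: "('a, 'b) extalg \<Rightarrow> ('a, 'b) extalg \<Rightarrow> ('a, 'b) extalg"
  is "\<lambda>f g A. f A - g A"
proof safe
  fix f g :: "'a set \<Rightarrow> 'b"
  assume "finite {A. f A \<noteq> 0}" "finite {A. g A \<noteq> 0}"
  then show "finite {A. f A - g A \<noteq> 0}"
    by (rule finite_subset[rotated, OF finite_UnI]) auto
qed auto

lift_definition uminus_extalg :: "('a, 'b) extalg \<Rightarrow> ('a, 'b) extalg"
  is "\<lambda>f A. - f A" by simp

instance
  by (standard; transfer; simp add: fun_eq_iff algebra_simps)

end

text \<open>The coefficient ring, placed in degree zero, and the generators, in degree one.\<close>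

lift_definition ext_const :: "'r :: zero \<Rightarrow> ('g, 'r) extalg"
  is "\<lambda>c A. if A = {} then c else 0"
  by (auto intro: finite_subset[of _ "{{}}"])

lift_definition ext_gen :: "'g \<Rightarrow> ('g, 'r :: zero_neq_one) extalg"
  is "\<lambda>x A. if A = {x} then 1 else 0"
  by (auto intro: finite_subset)

lift_definition ext_monom :: "'g set \<Rightarrow> ('g, 'r :: zero_neq_one) extalg"
  is "\<lambda>S A. if A = S \<and> finite S then 1 else 0"
  by (auto intro: finite_subset)

instantiation extalg :: (linorder, comm_ring_1) ring_1
begin

lift_definition one_extalg :: "('a, 'b) extalg" is "\<lambda>A. if A = {} then 1 else 0"
  by auto

lift_definition times_extalg :: "('a, 'b) extalg \<Rightarrow> ('a, 'b) extalg \<Rightarrow> ('a, 'b) extalg"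
  is "\<lambda>f g C. \<Sum>A\<in>Pow C. ext_sign A (C - A) * f A * g (C - A)"
proof safe
  fix f g :: "'a set \<Rightarrow> 'b"
  assume fin: "finite {A. f A \<noteq> 0}" "finite {A. g A \<noteq> 0}"
  show "finite {C. (\<Sum>A\<in>Pow C. ext_sign A (C - A) * f A * g (C - A)) \<noteq> 0}"
  proof (rule finite_subset)
    show "finite ((\<lambda>(A, B). A \<union> B) ` ({A. f A \<noteq> 0} \<times> {A. g A \<noteq> 0}))"
      using fin by auto
    show "{C. (\<Sum>A\<in>Pow C. ext_sign A (C - A) * f A * g (C - A)) \<noteq> 0}
        \<subseteq> (\<lambda>(A, B). A \<union> B) ` ({A. f A \<noteq> 0} \<times> {A. g A \<noteq> 0})"
    proof
      fix C assume "C \<in> {C. (\<Sum>A\<in>Pow C. ext_sign A (C - A) * f A * g (C - A)) \<noteq> 0}"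
      then obtain A where A: "A \<in> Pow C" "ext_sign A (C - A) * f A * g (C - A) \<noteq> 0"
        by (auto elim: sum.not_neutral_contains_not_neutral)
      then have "f A \<noteq> 0" "g (C - A) \<noteq> 0" "A \<union> (C - A) = C" by auto
      then show "C \<in> (\<lambda>(A, B). A \<union> B) ` ({A. f A \<noteq> 0} \<times> {A. g A \<noteq> 0})"
        by (intro image_eqI[of _ _ "(A, C - A)"]) auto
    qed
  qed
qed (simp add: finite_Pow_iff)

instance
proof
  fix x y z :: "('a, 'b) extalg"
  show "x * y * z = x * (y * z)"
  proof (rule extalg_eqI)
    fix C :: "'a set" assume C: "finite C"
    define t where "t = (\<lambda>A B. ext_sign (A \<union> B) (C - A - B) * ext_sign A B
      * ext_coeff x A * ext_coeff y B * ext_coeff z (C - A - B))"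
    have fin: "finite D" if "D \<subseteq> C" for D using that C finite_subset by auto
    have "ext_coeff (x * y * z) C = (\<Sum>D\<in>Pow C. \<Sum>A\<in>Pow D. t A (D - A))"
      unfolding times_extalg.rep_eq sum_distrib_left sum_distrib_right t_def
    proof (intro sum.cong refl)
      fix D A assume "D \<in> Pow C" "A \<in> Pow D"
      then have "A \<union> (D - A) = D" "C - A - (D - A) = C - D" by auto
      then show "ext_sign D (C - D) * (ext_sign A (D - A) * ext_coeff x A * ext_coeff y (D - A))
          * ext_coeff z (C - D) =
        ext_sign (A \<union> (D - A)) (C - A - (D - A)) * ext_sign A (D - A) * ext_coeff x A
          * ext_coeff y (D - A) * ext_coeff z (C - A - (D - A))"
        by (simp add: mult_ac)
    qed
    also have "\<dots> = (\<Sum>(D, A)\<in>Sigma (Pow C) Pow. t A (D - A))"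
      using C fin by (subst sum.Sigma) auto
    also have "\<dots> = (\<Sum>(A, B)\<in>Sigma (Pow C) (\<lambda>A. Pow (C - A)). t A B)"
      by (rule sum.reindex_bij_witness[where
            i = "\<lambda>(A, B). (A \<union> B, A)" and j = "\<lambda>(D, A). (A, D - A)"]) auto
    also have "\<dots> = (\<Sum>A\<in>Pow C. \<Sum>B\<in>Pow (C - A). t A B)"
      using C by (subst sum.Sigma) auto
    also have "\<dots> = ext_coeff (x * (y * z)) C"
      unfolding times_extalg.rep_eq sum_distrib_left
    proof (intro sum.cong refl)
      fix A B assume AB: "A \<in> Pow C" "B \<in> Pow (C - A)"
      then have "C - A = B \<union> (C - A - B)" by auto
      moreover have "ext_sign (A \<union> B) (C - A - B) * ext_sign A B
          = ext_sign A (B \<union> (C - A - B)) * (ext_sign B (C - A - B) :: 'b)"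
        using AB by (intro ext_sign_cocycle) (auto intro: fin)
      ultimately have "ext_sign (A \<union> B) (C - A - B) * ext_sign A B
          = ext_sign A (C - A) * (ext_sign B (C - A - B) :: 'b)"
        by simp
      then show "t A B = ext_sign A (C - A) * ext_coeff x A *
          (ext_sign B (C - A - B) * ext_coeff y B * ext_coeff z (C - A - B))"
        unfolding t_def by (simp add: mult_ac)
    qed
    finally show "ext_coeff (x * y * z) C = ext_coeff (x * (y * z)) C" .
  qed
  show "1 * x = x"
  proof (rule extalg_eqI)
    fix C :: "'a set" assume C: "finite C"
    have "ext_coeff (1 * x) C = (\<Sum>A\<in>Pow C. if A = {} then ext_coeff x C else 0)"
      unfolding times_extalg.rep_eq one_extalg.rep_eq by (intro sum.cong) auto
    then show "ext_coeff (1 * x) C = ext_coeff x C" using C by simp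
  qed
  show "x * 1 = x"
  proof (rule extalg_eqI)
    fix C :: "'a set" assume C: "finite C"
    have "ext_coeff (x * 1) C = (\<Sum>A\<in>Pow C. if A = C then ext_coeff x C else 0)"
      unfolding times_extalg.rep_eq one_extalg.rep_eq by (intro sum.cong) auto
    then show "ext_coeff (x * 1) C = ext_coeff x C" using C by simp
  qed
  show "(x + y) * z = x * z + y * z"
    by (rule extalg_eqI)
      (simp add: times_extalg.rep_eq plus_extalg.rep_eq algebra_simps sum.distrib)
  show "x * (y + z) = x * y + x * z"
    by (rule extalg_eqI)
      (simp add: times_extalg.rep_eq plus_extalg.rep_eq algebra_simps sum.distrib)
  show "(0 :: ('a, 'b) extalg) \<noteq> 1"
  proof
    assume "(0 :: ('a, 'b) extalg) = 1"
    then have "ext_coeff (0 :: ('a, 'b) extalg) {} = ext_coeff (1 :: ('a, 'b) extalg) {}" by simp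
    then show False by (simp add: zero_extalg.rep_eq one_extalg.rep_eq)
  qed
qed

end

lemma ext_coeff_const_times [simp]: "ext_coeff (ext_const c * x) C = c * ext_coeff x C"
proof (cases "finite C")
  case True
  have "ext_coeff (ext_const c * x) C = (\<Sum>A\<in>Pow C. if A = {} then c * ext_coeff x C else 0)"
    unfolding times_extalg.rep_eq ext_const.rep_eq by (intro sum.cong) auto
  then show ?thesis using True by simp
qed (simp add: ext_coeff_infinite)

lemma ext_coeff_times_const [simp]: "ext_coeff (x * ext_const c) C = ext_coeff x C * c"
proof (cases "finite C")
  case True
  have "ext_coeff (x * ext_const c) C = (\<Sum>A\<in>Pow C. if A = C then ext_coeff x C * c else 0)"
    unfolding times_extalg.rep_eq ext_const.rep_eq by (intro sum.cong) auto
  then show ?thesis using True by simp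
qed (simp add: ext_coeff_infinite)

lemma ext_const_commute: "ext_const c * x = x * ext_const c"
  by (rule extalg_eqI) (simp add: mult.commute)

lemma ext_const_add: "ext_const (c + d) = ext_const c + (ext_const d :: ('g, 'r :: ab_group_add) extalg)"
  by (rule extalg_eqI) (simp add: ext_const.rep_eq plus_extalg.rep_eq)

lemma ext_const_mult:
  "ext_const (c * d) = ext_const c * (ext_const d :: ('g :: linorder, 'r :: comm_ring_1) extalg)"
  by (rule extalg_eqI) (simp add: ext_const.rep_eq)

lemma ext_const_one: "ext_const 1 = (1 :: ('g :: linorder, 'r :: comm_ring_1) extalg)"
  by (rule extalg_eqI) (simp add: ext_const.rep_eq one_extalg.rep_eq)

lemma ext_const_inj: "ext_const c = ext_const d \<longleftrightarrow> c = d"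
  by transfer (metis (full_types))

text \<open>The defining relations: degree-one generators square to zero and anticommute.\<close>

lemma ext_gen_times_monom:
  assumes "finite S" "x \<notin> S"
  shows "ext_gen x * ext_monom S
      = ext_const (ext_sign {x} S) * (ext_monom (insert x S) :: ('g :: linorder, 'r :: comm_ring_1) extalg)"
proof (rule extalg_eqI)
  fix C :: "'g set" assume C: "finite C"
  have "ext_coeff (ext_gen x * ext_monom S :: ('g, 'r) extalg) C
      = (\<Sum>A\<in>Pow C. if A = {x} then (if C = insert x S then ext_sign {x} S else 0) else 0)"
    unfolding times_extalg.rep_eq ext_gen.rep_eq ext_monom.rep_eq
    using assms by (intro sum.cong) auto
  also have "\<dots> = ext_coeff (ext_const (ext_sign {x} S) * ext_monom (insert x S) :: ('g, 'r) extalg) C"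
    using C assms by (auto simp: ext_monom.rep_eq)
  finally show "ext_coeff (ext_gen x * ext_monom S :: ('g, 'r) extalg) C
      = ext_coeff (ext_const (ext_sign {x} S) * ext_monom (insert x S) :: ('g, 'r) extalg) C" .
qed

lemma ext_gen_square: "ext_gen x * ext_gen x = (0 :: ('g :: linorder, 'r :: comm_ring_1) extalg)"
  by (rule extalg_eqI)
    (auto simp: times_extalg.rep_eq ext_gen.rep_eq zero_extalg.rep_eq intro!: sum.neutral)

lemma ext_gen_eq_monom: "ext_gen x = ext_monom {x}"
  by transfer auto

lemma ext_gen_anticommute:
  "ext_gen x * ext_gen y = - (ext_gen y * ext_gen x :: ('g :: linorder, 'r :: comm_ring_1) extalg)"
proof (cases "x = y")
  case True
  then show ?thesis by (simp add: ext_gen_square)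
next
  case False
  have s: "ext_inv {u} {v} = (if v < u then 1 else 0)" for u v :: 'g
  proof -
    have "{(a, b). a \<in> {u} \<and> b \<in> {v} \<and> b < a} = (if v < u then {(u, v)} else {})" by auto
    then show ?thesis by (simp add: ext_inv_def)
  qed
  have "ext_gen x * ext_gen y = ext_gen x * (ext_monom {y} :: ('g, 'r) extalg)"
    "ext_gen y * ext_gen x = ext_gen y * (ext_monom {x} :: ('g, 'r) extalg)"
    by (simp_all add: ext_gen_eq_monom)
  then show ?thesis
    using False
    by (intro extalg_eqI)
      (auto simp: ext_gen_times_monom uminus_extalg.rep_eq ext_sign_def s insert_commute)
qed

text \<open>
  Increasing products of generators are the basis elements, so that the algebra is free as a module
  on them.
\<close>

lemma prod_list_ext_gen:
  assumes "sorted_wrt (<) xs"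
  shows "prod_list (map ext_gen xs) = (ext_monom (set xs) :: ('g :: linorder, 'r :: comm_ring_1) extalg)"
  using assms
proof (induction xs)
  case Nil
  show ?case by (rule extalg_eqI) (simp add: one_extalg.rep_eq ext_monom.rep_eq)
next
  case (Cons x xs)
  have "{(a, b). a \<in> {x} \<and> b \<in> set xs \<and> b < a} = {}" using Cons.prems by auto
  then have "ext_inv {x} (set xs) = 0" unfolding ext_inv_def by (simp only: card.empty)
  moreover have "x \<notin> set xs" using Cons.prems by auto
  ultimately show ?case using Cons
    by (simp add: ext_gen_times_monom ext_sign_def ext_const_one)
qed

text \<open>
  Rows, columns and the indices \<open>i\<close>, \<open>j\<close> are counted from 0, so they range over \<open>{0..<n}\<close>.

  Taking the variables \<open>b\<^sub>i\<^sub>j\<close> to be indexed by unordered pairs makes the polynomial ring below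
  the quotient of \<open>\<rat>[b\<^sub>i\<^sub>j]\<close> by \<open>b\<^sub>i\<^sub>j - b\<^sub>j\<^sub>i\<close>. Neither the variables nor the generators
  \<open>\<omega>\<^sub>i\<^sub>j\<close> are restricted to \<open>i \<le> j < n\<close>; the algebra they define contains the one on the
  restricted variables and generators as a subring, and everything below lies in that subring.
\<close>

type_synonym sym_poly = "(nat uprod \<Rightarrow>\<^sub>0 nat) \<Rightarrow>\<^sub>0 rat"

datatype position = Pos nat nat

instantiation position :: linorder
begin

fun less_eq_position :: "position \<Rightarrow> position \<Rightarrow> bool" where
  "less_eq_position (Pos i j) (Pos k l) \<longleftrightarrow> i < k \<or> i = k \<and> j \<le> l"

definition less_position :: "position \<Rightarrow> position \<Rightarrow> bool" where
  "less_position p q \<longleftrightarrow> p \<le> q \<and> \<not> q \<le> p"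

instance
proof
  fix p q r :: position
  show "p < q \<longleftrightarrow> p \<le> q \<and> \<not> q \<le> p" by (simp add: less_position_def)
  show "p \<le> p" by (cases p) simp
  show "p \<le> q \<Longrightarrow> q \<le> r \<Longrightarrow> p \<le> r" by (cases p; cases q; cases r) auto
  show "p \<le> q \<Longrightarrow> q \<le> p \<Longrightarrow> p = q" by (cases p; cases q) auto
  show "p \<le> q \<or> q \<le> p" by (cases p; cases q) auto
qed

end

type_synonym sym_forms = "(position, sym_poly) extalg"

definition bvar :: "nat \<Rightarrow> nat \<Rightarrow> sym_poly" where
  "bvar i j = Poly_Mapping.single (Poly_Mapping.single (Upair i j) 1) 1"

lemma bvar_commute: "bvar i j = bvar j i"
  proof -
  have "Upair i j = Upair j i" by simp
  then show ?thesis by (simp only: bvar_def)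
qed

definition generic_sym :: "nat \<Rightarrow> sym_poly mat" where
  "generic_sym n = mat n n (\<lambda>(i, j). bvar i j)"

definition omega :: "nat \<Rightarrow> nat \<Rightarrow> sym_forms" where
  "omega i j = ext_gen (Pos i j)"

definition mat_trace :: "'a :: comm_monoid_add mat \<Rightarrow> 'a" where
  "mat_trace A = (\<Sum>i<dim_row A. A $$ (i, i))"

definition diag_pos :: "nat \<Rightarrow> (nat \<times> nat) set" where
  "diag_pos n = {(i, i) | i. i < n}"

text \<open>The cardinality is \<open>2n - 1\<close>, stated without truncated subtraction; this forces \<open>n \<ge> 1\<close>.\<close>

definition type_of_rank :: "nat \<Rightarrow> (nat \<times> nat) set \<Rightarrow> bool" where
  "type_of_rank n \<nu> \<longleftrightarrow> \<nu> \<subseteq> {0..<n} \<times> {0..<n} \<and> card \<nu> + 1 = 2 * n"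

definition upper_triangular_type :: "nat \<Rightarrow> (nat \<times> nat) set \<Rightarrow> bool" where
  "upper_triangular_type n \<nu> \<longleftrightarrow> type_of_rank n \<nu> \<and>
     diag_pos n \<subseteq> \<nu> \<and> \<nu> \<subseteq> {(i, j). i \<le> j \<and> j < n}"

definition Upsilon :: "nat \<Rightarrow> (nat \<times> nat) set \<Rightarrow> sym_forms mat" where
  "Upsilon n \<nu> = mat n n (\<lambda>(i, j).
     if (i, j) \<in> \<nu> then omega i j else if (j, i) \<in> \<nu> then omega j i else 0)"

text \<open>
  Below, \<open>vs\<close> is an ordering of the type, that is, a list of its elements without repetition.
  Since \<open>k\<close> is counted from 0, the exponent \<open>k - 1\<close> for a column \<open>k\<close> counted from 1
  becomes \<open>k\<close>.
\<close>

definition type_mat :: "nat \<Rightarrow> (nat \<times> nat) list \<Rightarrow> int mat" where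
  "type_mat n vs = mat (length vs) (2 * n) (\<lambda>(r, c).
     if c = fst (vs ! r) then - 1 else if c = n + snd (vs ! r) then 1 else 0)"

definition delete_col :: "'a mat \<Rightarrow> nat \<Rightarrow> 'a mat" where
  "delete_col A k = mat (dim_row A) (dim_col A - 1) (\<lambda>(r, c). A $$ (r, if c < k then c else Suc c))"

definition eta_form :: "(nat \<times> nat) list \<Rightarrow> sym_forms" where
  "eta_form vs = prod_list (map (\<lambda>(i, j). omega i j) vs)"

definition omega_form :: "nat \<Rightarrow> (nat \<times> nat) list \<Rightarrow> nat \<Rightarrow> sym_forms" where
  "omega_form n vs k =
     of_int ((- 1) ^ ((n choose 2) + k) * det (delete_col (type_mat n vs) k)) * eta_form vs"

text \<open>\<open>sub_list es I\<close> lists the entries of the pairs at the indices in \<open>I\<close>, in increasing order of index.\<close>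

definition sub_list :: "('a \<times> 'a) list \<Rightarrow> nat set \<Rightarrow> 'a list" where
  "sub_list es I = concat (map (\<lambda>i. [fst (es ! i), snd (es ! i)]) (sorted_list_of_set I))"

definition sub_mat :: "'a mat \<Rightarrow> nat list \<Rightarrow> nat list \<Rightarrow> 'a mat" where
  "sub_mat B us vs = mat (length us) (length vs) (\<lambda>(r, c). B $$ (us ! r, vs ! c))"

text \<open>
  The set \<open>D\<^sub>m\<^sup>k\<close>, with \<open>{0..<m}\<close> for \<open>{1, \<dots>, m}\<close>. As the blocks \<open>I\<^sub>l\<close>, \<open>J\<^sub>l\<close> are
  non-empty and disjoint, an unordered tuple of \<open>k\<close> pairs is a set of \<open>k\<close> two-element sets. That
  \<open>P\<close> itself is \<open>disjoint\<close> prevents a block from being shared by two pairs.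
\<close>

definition pairings :: "nat \<Rightarrow> nat \<Rightarrow> nat set set set set" where
  "pairings m k = {P. card P = k \<and> disjoint P \<and> partition_on {0..<m} (\<Union>P) \<and>
     (\<forall>p\<in>P. \<exists>I J. p = {I, J} \<and> I \<noteq> J \<and> card I = card J)}"

text \<open>
  The minor attached to the unordered pair \<open>{I, J}\<close>. For symmetric \<open>B\<close> it does not depend on the
  order of \<open>I\<close> and \<open>J\<close>, as shown next, so that the description is proper.
\<close>

definition pair_minor :: "'a :: comm_ring_1 mat \<Rightarrow> (nat \<times> nat) list \<Rightarrow> nat set set \<Rightarrow> 'a" where
  "pair_minor B es p =
     (THE d. \<exists>I J. p = {I, J} \<and> d = det (sub_mat B (sub_list es I) (sub_list es J)))"

lemma det_sub_mat_commute:
  assumes sym: "\<And>i j. i < n \<Longrightarrow> j < n \<Longrightarrow> B $$ (i, j) = B $$ (j, i)"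
    and "set us \<subseteq> {..<n}" "set vs \<subseteq> {..<n}"
  shows "det (sub_mat B us vs) = det (sub_mat B vs us :: 'a :: comm_ring_1 mat)"
proof (cases "length us = length vs")
  case True
  have "sub_mat B vs us = transpose_mat (sub_mat B us vs)"
    using assms(2,3) unfolding sub_mat_def
    by (intro eq_matI) (auto intro!: sym dest!: subsetD[OF _ nth_mem])
  moreover have "sub_mat B us vs \<in> carrier_mat (length us) (length us)"
    using True by (simp add: sub_mat_def)
  ultimately show ?thesis by (simp add: det_transpose)
next
  case False
  then show ?thesis by (simp add: det_def sub_mat_def)
qed

lemma set_sub_list:
  assumes "I \<subseteq> {0..<length es}" "set es \<subseteq> {..<n} \<times> {..<n}"
  shows "set (sub_list es I) \<subseteq> {..<n}"
proof -
  have "finite I" using assms(1) finite_subset by blast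
  moreover have "es ! i \<in> {..<n} \<times> {..<n}" if "i \<in> I" for i
  proof -
    have "i < length es" using that assms(1) by auto
    then show ?thesis using assms(2) nth_mem by blast
  qed
  ultimately show ?thesis by (auto simp: sub_list_def mem_Times_iff)
qed

lemma pair_minor_eq:
  assumes "\<And>i j. i < n \<Longrightarrow> j < n \<Longrightarrow> B $$ (i, j) = B $$ (j, i)"
    and "set es \<subseteq> {..<n} \<times> {..<n}" "I \<subseteq> {0..<length es}" "J \<subseteq> {0..<length es}"
  shows "pair_minor B es {I, J} = det (sub_mat B (sub_list es I) (sub_list es J))"
  unfolding pair_minor_def
proof (rule the_equality)
  fix d
  assume "\<exists>I' J'. {I, J} = {I', J'} \<and> d = det (sub_mat B (sub_list es I') (sub_list es J'))"
  then show "d = det (sub_mat B (sub_list es I) (sub_list es J))"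
    using det_sub_mat_commute[OF assms(1) set_sub_list[OF assms(3,2)] set_sub_list[OF assms(4,2)]]
    by (auto simp: doubleton_eq_iff)
qed auto

definition Sigma_poly :: "'a :: comm_ring_1 mat \<Rightarrow> (nat \<times> nat) list \<Rightarrow> 'a" where
  "Sigma_poly B es = (if es = [] then 1 else
     (\<Sum>k = 1..length es div 2. of_int ((- 2) ^ k * fact k) *
        (\<Sum>P\<in>pairings (length es) k. \<Prod>p\<in>P. pair_minor B es p)))"

end

theory Submission
  imports
    Defs
    "HOL-Computational_Algebra.Formal_Power_Series"
    "HOL-Combinatorics.Permutations"
begin

text \<open>
  Write \<open>X\<close> for \<open>\<Upsilon>\<^sub>\<nu>\<close>, count the vertices from \<open>0\<close> to \<open>m = n - 1\<close>, and read the \<open>m\<close> off-diagonal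
  positions in \<open>\<nu>\<close> as edges. There are four steps.

  First, the power is reduced to a minor. The entries of \<open>B X\<close> are odd, so that the entries of
  \<open>(B X)\<^sup>2\<close> are even and lie in a commutative ring, where determinants are available. A trace of a
  product of two odd matrices changes sign if they are exchanged, hence all powers of \<open>(B X)\<^sup>2\<close> have
  trace zero. As in Rosset's proof of the Amitsur-Levitzki theorem, this makes the characteristic
  polynomial that of a nilpotent matrix, and the power \<open>n - 1\<close> is an adjugate up to sign
  (\<open>adj_mat_eq_power\<close>). There are only \<open>2 n - 1\<close> generators, so each of them occurs once in the trace of
  the power \<open>2 n - 1\<close>, and by cyclicity the trace is \<open>2 n - 1\<close> times the part that begins with \<open>\<omega>\<^sub>0\<^sub>0\<close>. Up
  to the sign \<open>(- 1) ^ (n - 1)\<close>, this part is \<open>\<omega>\<^sub>0\<^sub>0 det B\<close> times the determinant of \<open>X B X\<close> without row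
  and column \<open>0\<close> (\<open>trace_odd_power\<close>).

  Secondly, this determinant is expanded. The entry of \<open>X B X\<close> at \<open>(r, r')\<close> is the pairing under \<open>B\<close> of
  the rows \<open>r\<close> and \<open>r'\<close> of \<open>X\<close>. Since one-forms anticommute, the expansion of the determinant turns into
  permanents of \<open>B\<close>. Every row is used twice, once with its diagonal form and once with the form of an
  edge at \<open>r\<close>; the two orders of these factors are the two orientations of that edge. The result is the
  signed sum \<open>orient_per\<close> of permanents over all orientations of the edges, times the product of the
  wedges of \<open>\<omega>\<^sub>r\<^sub>r\<close> with the incidence form of the vertex \<open>r\<close>, over all \<open>r > 0\<close> (\<open>det_edge_forms\<close>).

  Thirdly, if \<open>n\<close> is odd, the form in this formula is \<open>\<omega>\<^sub>\<nu>\<close>. The determinant in the definition of \<open>\<omega>\<^sub>\<nu>\<close>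
  times \<open>\<eta>\<^sub>\<nu>\<close> is a product of row sums and column sums of the forms in \<open>\<nu>\<close>, and elimination turns it into
  the same product of diagonal and incidence forms (\<open>omega_form_upper_triangular\<close>).

  Finally, \<open>orient_per\<close> is \<open>\<Sigma>\<close> (\<open>orient_per_eq_Sigma_poly\<close>). By Muir's identity, the sums of permanents
  over orientations are convolution inverse to the analogous sums of determinants. The latter are sums
  of minors of the ends of one half of the edges against those of the other half
  (\<open>orient_det_eq_sum_minors\<close>), and \<open>\<Sigma>\<close> satisfies the recursion of the inverse of these sums. If \<open>m\<close> is
  odd, reversing all edges shows that \<open>orient_per\<close> is its own negative, and the trace vanishes.
\<close>

section \<open>The even part of the exterior algebra\<close>

definition even_form :: "('g, 'r :: zero) extalg \<Rightarrow> bool" where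
  "even_form x \<longleftrightarrow> (\<forall>A. ext_coeff x A \<noteq> 0 \<longrightarrow> even (card A))"

definition odd_form :: "('g, 'r :: zero) extalg \<Rightarrow> bool" where
  "odd_form x \<longleftrightarrow> (\<forall>A. ext_coeff x A \<noteq> 0 \<longrightarrow> odd (card A))"

text \<open>Every pair in \<open>A \<times> B\<close> is an inversion in exactly one of the two orders.\<close>

lemma ext_inv_swap:
  assumes "finite A" "finite B" "A \<inter> B = {}"
  shows "ext_inv A B + ext_inv B A = card A * card B"
proof -
  have "ext_inv B A = card {(a, b). a \<in> A \<and> b \<in> B \<and> a < b}"
    unfolding ext_inv_def
    by (rule bij_betw_same_card[of prod.swap]) (auto simp: bij_betw_def inj_on_def)
  then have "ext_inv A B + ext_inv B A
      = card ({(a, b). a \<in> A \<and> b \<in> B \<and> b < a} \<union> {(a, b). a \<in> A \<and> b \<in> B \<and> a < b})"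
    unfolding ext_inv_def using assms
    by (subst card_Un_disjoint) (auto intro: ext_inv_finite)
  also have "{(a, b). a \<in> A \<and> b \<in> B \<and> b < a} \<union> {(a, b). a \<in> A \<and> b \<in> B \<and> a < b} = A \<times> B"
    using assms(3) by auto
  finally show ?thesis by (simp add: card_cartesian_product)
qed

lemma ext_coeff_times_flip:
  "ext_coeff (y * x) C = (\<Sum>A\<in>Pow C. ext_sign (C - A) A * ext_coeff x A * ext_coeff y (C - A))"
  for x y :: "('g :: linorder, 'r :: comm_ring_1) extalg"
  unfolding times_extalg.rep_eq
  by (rule sum.reindex_bij_witness[of _ "\<lambda>A. C - A" "\<lambda>A. C - A"])
    (auto simp: double_diff mult_ac)

lemma ext_sign_swap:
  assumes "finite A" "finite B" "A \<inter> B = {}"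
  shows "ext_sign B A = (- 1) ^ (card A * card B) * (ext_sign A B :: 'r :: comm_ring_1)"
proof -
  have "(- 1 :: 'r) ^ (card A * card B) = ext_sign A B * ext_sign B A"
    unfolding ext_sign_def ext_inv_swap[OF assms, symmetric] by (simp add: power_add)
  moreover have "ext_sign A B * ext_sign A B = (1 :: 'r)"
    by (simp add: ext_sign_def flip: power_mult_distrib)
  ultimately show ?thesis by (metis mult.assoc mult.commute mult_1)
qed

lemma even_form_central:
  fixes x y :: "('g :: linorder, 'r :: comm_ring_1) extalg"
  assumes "even_form x"
  shows "x * y = y * x"
proof (rule extalg_eqI)
  fix C :: "'g set" assume C: "finite C"
  show "ext_coeff (x * y) C = ext_coeff (y * x) C"
    unfolding ext_coeff_times_flip[of y x] times_extalg.rep_eq[of x y]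
  proof (rule sum.cong)
    fix A assume A: "A \<in> Pow C"
    then have "finite A" using C finite_subset by auto
    show "ext_sign A (C - A) * ext_coeff x A * ext_coeff y (C - A)
        = ext_sign (C - A) A * ext_coeff x A * ext_coeff y (C - A)"
    proof (cases "ext_coeff x A = 0")
      case False
      then have "even (card A)" using assms by (auto simp: even_form_def)
      then show ?thesis
        using ext_sign_swap[of A "C - A", where 'r = 'r] \<open>finite A\<close> C by simp
    qed simp
  qed simp
qed

lemma odd_form_anticommute:
  fixes x y :: "('g :: linorder, 'r :: comm_ring_1) extalg"
  assumes "odd_form x" "odd_form y"
  shows "x * y = - (y * x)"
proof (rule extalg_eqI)
  fix C :: "'g set" assume C: "finite C"
  show "ext_coeff (x * y) C = ext_coeff (- (y * x)) C"
    unfolding uminus_extalg.rep_eq ext_coeff_times_flip[of y x] times_extalg.rep_eq[of x y]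
      sum_negf[symmetric]
  proof (rule sum.cong)
    fix A assume A: "A \<in> Pow C"
    then have "finite A" using C finite_subset by auto
    show "ext_sign A (C - A) * ext_coeff x A * ext_coeff y (C - A)
        = - (ext_sign (C - A) A * ext_coeff x A * ext_coeff y (C - A))"
    proof (cases "ext_coeff x A = 0 \<or> ext_coeff y (C - A) = 0")
      case False
      then have "odd (card A)" "odd (card (C - A))" using assms by (auto simp: odd_form_def)
      then show ?thesis
        using ext_sign_swap[of A "C - A", where 'r = 'r] \<open>finite A\<close> C by simp
    qed auto
  qed simp
qed

text \<open>
  The support of a product is all that the parity statements below and the multiplicativity of the
  filtration in the next part depend on.
\<close>

lemma ext_coeff_times_nonzero:
  fixes x y :: "('g :: linorder, 'r :: comm_ring_1) extalg"
  assumes "ext_coeff (x * y) C \<noteq> 0"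
  obtains A B where "C = A \<union> B" "A \<inter> B = {}" "finite A" "finite B"
    "ext_coeff x A \<noteq> 0" "ext_coeff y B \<noteq> 0"
proof -
  have C: "finite C" using assms ext_coeff_infinite by blast
  obtain A where A: "A \<in> Pow C" "ext_sign A (C - A) * ext_coeff x A * ext_coeff y (C - A) \<noteq> 0"
    using assms unfolding times_extalg.rep_eq
    by (auto elim: sum.not_neutral_contains_not_neutral)
  show ?thesis
    by (rule that[of A "C - A"]) (use A C finite_subset in auto)
qed

lemma even_form_mult_even:
  "even_form x \<Longrightarrow> even_form y \<Longrightarrow> even_form (x * y)"
  for x y :: "('g :: linorder, 'r :: comm_ring_1) extalg"
  unfolding even_form_def
  by (auto elim!: ext_coeff_times_nonzero simp: card_Un_disjoint)

lemma even_form_mult_odd: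
  "odd_form x \<Longrightarrow> odd_form y \<Longrightarrow> even_form (x * y)"
  for x y :: "('g :: linorder, 'r :: comm_ring_1) extalg"
  unfolding even_form_def odd_form_def
  by (auto elim!: ext_coeff_times_nonzero simp: card_Un_disjoint)

lemma odd_form_mult_left:
  "even_form x \<Longrightarrow> odd_form y \<Longrightarrow> odd_form (x * y)"
  for x y :: "('g :: linorder, 'r :: comm_ring_1) extalg"
  unfolding even_form_def odd_form_def
  by (auto elim!: ext_coeff_times_nonzero simp: card_Un_disjoint)

lemma even_form_add: "even_form x \<Longrightarrow> even_form y \<Longrightarrow> even_form (x + y :: ('g, 'r :: ab_group_add) extalg)"
  unfolding even_form_def plus_extalg.rep_eq by (metis add.right_neutral)

lemma odd_form_add: "odd_form x \<Longrightarrow> odd_form y \<Longrightarrow> odd_form (x + y :: ('g, 'r :: ab_group_add) extalg)"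
  unfolding odd_form_def plus_extalg.rep_eq by (metis add.right_neutral)

lemma even_form_uminus: "even_form x \<Longrightarrow> even_form (- x :: ('g, 'r :: ab_group_add) extalg)"
  unfolding even_form_def uminus_extalg.rep_eq by simp

lemma odd_form_uminus: "odd_form x \<Longrightarrow> odd_form (- x :: ('g, 'r :: ab_group_add) extalg)"
  unfolding odd_form_def uminus_extalg.rep_eq by simp

lemma even_form_0 [simp]: "even_form 0" and odd_form_0 [simp]: "odd_form 0"
  by (simp_all add: even_form_def odd_form_def zero_extalg.rep_eq)

lemma even_form_const [simp]: "even_form (ext_const c)"
  by (auto simp: even_form_def ext_const.rep_eq)

lemma even_form_1 [simp]: "even_form (1 :: ('g :: linorder, 'r :: comm_ring_1) extalg)"
  unfolding ext_const_one[symmetric] by (rule even_form_const)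

lemma odd_form_gen [simp]: "odd_form (ext_gen g)"
  by (auto simp: odd_form_def ext_gen.rep_eq)

lemma odd_form_const_mult: "odd_form x \<Longrightarrow> odd_form (ext_const c * x)"
  for x :: "('g :: linorder, 'r :: comm_ring_1) extalg"
  by (rule odd_form_mult_left) auto

lemma even_form_sum: "(\<And>i. i \<in> I \<Longrightarrow> even_form (f i)) \<Longrightarrow> even_form (\<Sum>i\<in>I. f i)"
  for f :: "_ \<Rightarrow> ('g, 'r :: ab_group_add) extalg"
  by (induction I rule: infinite_finite_induct) (auto intro: even_form_add)

lemma odd_form_sum: "(\<And>i. i \<in> I \<Longrightarrow> odd_form (f i)) \<Longrightarrow> odd_form (\<Sum>i\<in>I. f i)"
  for f :: "_ \<Rightarrow> ('g, 'r :: ab_group_add) extalg"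
  by (induction I rule: infinite_finite_induct) (auto intro: odd_form_add)

lemma odd_form_diff: "odd_form x \<Longrightarrow> odd_form y \<Longrightarrow> odd_form (x - y :: ('g, 'r :: ab_group_add) extalg)"
  using odd_form_add[of x "- y"] odd_form_uminus[of y] by simp

lemma of_nat_mult_extalg_eq_0:
  fixes x :: "('g :: linorder, 'r :: comm_ring_1) extalg"
  assumes "\<And>c :: 'r. of_nat k * c = 0 \<Longrightarrow> c = 0" "of_nat k * x = 0"
  shows "x = 0"
proof (rule extalg_eqI)
  fix A
  have "(of_nat k :: ('g, 'r) extalg) = ext_const (of_nat k)"
  proof (induction k)
    case 0
    show ?case by (rule extalg_eqI) (simp add: ext_const.rep_eq zero_extalg.rep_eq)
  qed (simp add: ext_const_add ext_const_one)
  then have "of_nat k * ext_coeff x A = 0"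
    using assms(2) ext_coeff_const_times[of "of_nat k" x A] by (simp add: zero_extalg.rep_eq)
  then show "ext_coeff x A = ext_coeff 0 A" using assms(1) by (simp add: zero_extalg.rep_eq)
qed

text \<open>
  An odd form anticommutes with itself, so that its square is its own negative.
\<close>

lemma odd_form_square:
  fixes x :: "('g :: linorder, 'r :: comm_ring_1) extalg"
  assumes "\<And>c :: 'r. of_nat 2 * c = 0 \<Longrightarrow> c = 0" "odd_form x"
  shows "x * x = 0"
proof (rule of_nat_mult_extalg_eq_0[OF assms(1)])
  have "x * x + x * x = 0"
    using odd_form_anticommute[OF assms(2,2)] by (metis add.right_inverse)
  then show "of_nat 2 * (x * x) = 0" by (simp add: mult_2)
qed

text \<open>
  The even elements are central, so they form a commutative ring. As a type, this ring can serve as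
  the coefficients of determinants and of formal power series.
\<close>

typedef (overloaded) ('g, 'r) evenalg = "{x :: ('g :: linorder, 'r :: comm_ring_1) extalg. even_form x}"
  morphisms form_of Abs_evenalg
  by (rule exI[of _ 0]) simp

setup_lifting type_definition_evenalg

instantiation evenalg :: (linorder, comm_ring_1) comm_ring_1
begin

lift_definition zero_evenalg :: "('a, 'b) evenalg" is 0 by simp
lift_definition one_evenalg :: "('a, 'b) evenalg" is 1 by simp
lift_definition plus_evenalg :: "('a, 'b) evenalg \<Rightarrow> ('a, 'b) evenalg \<Rightarrow> ('a, 'b) evenalg"
  is "(+)" by (rule even_form_add)
lift_definition uminus_evenalg :: "('a, 'b) evenalg \<Rightarrow> ('a, 'b) evenalg"
  is uminus by (rule even_form_uminus)
lift_definition minus_evenalg :: "('a, 'b) evenalg \<Rightarrow> ('a, 'b) evenalg \<Rightarrow> ('a, 'b) evenalg"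
  is "(-)" by (metis even_form_add even_form_uminus diff_conv_add_uminus)
lift_definition times_evenalg :: "('a, 'b) evenalg \<Rightarrow> ('a, 'b) evenalg \<Rightarrow> ('a, 'b) evenalg"
  is "(*)" by (rule even_form_mult_even)

instance
  by (standard; transfer) (auto simp: algebra_simps even_form_central)

end

lift_definition even_const :: "'r \<Rightarrow> ('g :: linorder, 'r :: comm_ring_1) evenalg" is ext_const
  by simp

text \<open>
  Projecting to the even part makes \<open>wedge\<close> below a total operation; only its values on two odd
  forms matter.
\<close>

lift_definition even_part :: "('g :: linorder, 'r :: comm_ring_1) extalg \<Rightarrow> ('g, 'r) evenalg"
  is "\<lambda>x. if even_form x then x else 0" by simp

definition wedge :: "('g, 'r) extalg \<Rightarrow> ('g, 'r) extalg \<Rightarrow> ('g :: linorder, 'r :: comm_ring_1) evenalg" where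
  "wedge x y = even_part (x * y)"

lemma form_of_eqI: "form_of x = form_of y \<Longrightarrow> x = y"
  by (simp add: form_of_inject)

lemma form_of_wedge: "odd_form x \<Longrightarrow> odd_form y \<Longrightarrow> form_of (wedge x y) = x * y"
  by (simp add: wedge_def even_part.rep_eq even_form_mult_odd)

lemma even_form_form_of [simp]: "even_form (form_of x)"
  using form_of[of x] by simp

lemma form_of_sum: "form_of (\<Sum>i\<in>I. f i) = (\<Sum>i\<in>I. form_of (f i))"
  by (induction I rule: infinite_finite_induct)
    (auto simp: zero_evenalg.rep_eq plus_evenalg.rep_eq)

lemma form_of_prod_list: "form_of (prod_list xs) = prod_list (map form_of xs)"
  by (induction xs) (auto simp: one_evenalg.rep_eq times_evenalg.rep_eq)

lemma of_nat_mult_evenalg_eq_0: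
  fixes x :: "('g :: linorder, 'r :: comm_ring_1) evenalg"
  assumes "\<And>c :: 'r. of_nat k * c = 0 \<Longrightarrow> c = 0" "of_nat k * x = 0"
  shows "x = 0"
proof (rule form_of_eqI)
  have "form_of (of_nat k :: ('g, 'r) evenalg) = of_nat k"
    by (induction k) (auto simp: zero_evenalg.rep_eq one_evenalg.rep_eq plus_evenalg.rep_eq)
  then have "of_nat k * form_of x = form_of (of_nat k * x)"
    by (simp add: times_evenalg.rep_eq)
  then have "of_nat k * form_of x = 0"
    by (simp add: assms(2) zero_evenalg.rep_eq)
  then show "form_of x = form_of 0"
    using of_nat_mult_extalg_eq_0[OF assms(1)] by (simp add: zero_evenalg.rep_eq)
qed

lemma even_const_0 [simp]: "even_const 0 = 0"
  by (rule form_of_eqI, rule extalg_eqI)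
    (simp add: even_const.rep_eq zero_evenalg.rep_eq ext_const.rep_eq zero_extalg.rep_eq)

lemma even_const_1 [simp]: "even_const 1 = 1"
  by (rule form_of_eqI) (simp add: even_const.rep_eq one_evenalg.rep_eq ext_const_one)

lemma even_const_add: "even_const (a + b) = even_const a + even_const b"
  by (rule form_of_eqI) (simp add: even_const.rep_eq plus_evenalg.rep_eq ext_const_add)

lemma even_const_mult: "even_const (a * b) = even_const a * even_const b"
  by (rule form_of_eqI) (simp add: even_const.rep_eq times_evenalg.rep_eq ext_const_mult)

interpretation even_const: comm_ring_hom even_const
  by standard (simp_all add: even_const_add even_const_mult)

lemma even_const_of_int: "even_const (of_int k) = of_int k"
  by (induction k rule: int_induct[where k = 0]) (simp_all add: even_const_add even_const.hom_minus)

lemma wedge_mult_eq_0: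
  assumes "odd_form a" "odd_form b" "odd_form c" "odd_form d" "c * d = 0"
  shows "wedge a c * wedge b d = 0"
proof (rule form_of_eqI)
  have "a * c * (b * d) = a * (c * b) * d" by (simp only: mult.assoc)
  also have "\<dots> = - (a * b * (c * d))"
    by (simp only: odd_form_anticommute[OF assms(3,2)] mult_minus_left mult_minus_right mult.assoc)
  finally show "form_of (wedge a c * wedge b d) = form_of 0"
    using assms by (simp add: times_evenalg.rep_eq form_of_wedge zero_evenalg.rep_eq)
qed

lemma prod_eq_0_if_pair:
  fixes f :: "'i \<Rightarrow> 'a :: comm_ring_1"
  assumes "finite S" "u \<in> S" "v \<in> S" "u \<noteq> v" "f u * f v = 0"
  shows "(\<Prod>i\<in>S. f i) = 0"
proof -
  have "(\<Prod>i\<in>S. f i) = f u * f v * (\<Prod>i\<in>S - {u} - {v}. f i)"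
    using assms(1-4) by (simp add: prod.remove[of S u] prod.remove[of "S - {u}" v] mult.assoc)
  then show ?thesis using assms(5) by simp
qed

lemma wedge_exchange:
  assumes "odd_form a" "odd_form b" "odd_form c" "odd_form d"
  shows "wedge a c * wedge b d = - (wedge a d * wedge b c)"
proof (rule form_of_eqI)
  have "a * c * (b * d) = a * (c * b) * d"
    by (simp only: mult.assoc)
  also have "\<dots> = - (a * ((b * c) * d))"
    by (simp only: odd_form_anticommute[OF assms(3,2)] mult_minus_left mult_minus_right mult.assoc)
  also have "\<dots> = - (a * d * (b * c))"
    by (simp only: even_form_central[OF even_form_mult_odd[OF assms(2,3)], of d]) (simp only: mult.assoc)
  finally show "form_of (wedge a c * wedge b d) = form_of (- (wedge a d * wedge b c))"
    using assms by (simp add: times_evenalg.rep_eq uminus_evenalg.rep_eq form_of_wedge)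
qed

lemma wedge_flip: "odd_form a \<Longrightarrow> odd_form b \<Longrightarrow> wedge b a = - wedge a b"
  by (rule form_of_eqI) (simp add: form_of_wedge uminus_evenalg.rep_eq odd_form_anticommute[of b a])

text \<open>
  Exchanging two second factors changes the sign. This identity turns the signed sums of a
  determinant into permanents, and conversely.
\<close>

lemma prod_wedge_permute:
  assumes "finite S" "p permutes S"
    and "\<And>i. i \<in> S \<Longrightarrow> odd_form (a i)" "\<And>i. i \<in> S \<Longrightarrow> odd_form (c i)"
  shows "(\<Prod>i\<in>S. wedge (a i) (c (p i))) = of_int (sign p) * (\<Prod>i\<in>S. wedge (a i) (c i))"
  using assms(1,2)
proof (induction rule: permutes_rev_induct)
  case id
  then show ?case by simp
next
  case (swap u v p)
  have perm: "p permutes S" and uv: "u \<in> S" "v \<in> S" using swap by auto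
  show ?case
  proof (cases "u = v")
    case True
    then show ?thesis using swap by simp
  next
    case False
    have pS: "p i \<in> S" if "i \<in> S" for i using that perm by (simp add: permutes_in_image)
    have S: "S = insert u (insert v (S - {u, v}))" using uv by auto
    let ?R = "S - {u, v}"
    have "(\<Prod>i\<in>S. wedge (a i) (c ((p \<circ> transpose u v) i)))
        = wedge (a u) (c (p v)) * wedge (a v) (c (p u)) * (\<Prod>i\<in>?R. wedge (a i) (c (p i)))"
      using False assms(1)
      by (subst S) (auto simp: transpose_def mult.assoc intro!: arg_cong2[of _ _ _ _ "(*)"] prod.cong)
    also have "wedge (a u) (c (p v)) * wedge (a v) (c (p u))
        = - (wedge (a u) (c (p u)) * wedge (a v) (c (p v)))"
      using uv pS by (intro wedge_exchange assms(3,4))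
    also have "\<dots> * (\<Prod>i\<in>?R. wedge (a i) (c (p i))) = - (\<Prod>i\<in>S. wedge (a i) (c (p i)))"
      using False assms(1) by (subst (2) S) (simp add: mult.assoc)
    also have "\<dots> = of_int (sign (p \<circ> transpose u v)) * (\<Prod>i\<in>S. wedge (a i) (c i))"
      using swap False assms(1) perm
      by (simp add: sign_compose sign_swap_id permutation_swap_id
          permutation_permutes[THEN iffD2, of p] exI[of _ S])
    finally show ?thesis .
  qed
qed

section \<open>The filtration by the degree in a set of generators\<close>

text \<open>
  The forms all of whose monomials contain at least \<open>d\<close> of the generators in \<open>F\<close>. They are zero as soon
  as \<open>d\<close> exceeds the size of \<open>F\<close>, which is how all arguments on top degrees are made.
\<close>

definition order_ge :: "'g set \<Rightarrow> nat \<Rightarrow> ('g, 'r :: zero) extalg \<Rightarrow> bool" where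
  "order_ge F d x \<longleftrightarrow> (\<forall>A. ext_coeff x A \<noteq> 0 \<longrightarrow> d \<le> card (A \<inter> F))"

lemma order_ge_0 [simp]: "order_ge F 0 x" by (simp add: order_ge_def)

lemma order_ge_zero [simp]: "order_ge F d 0" by (simp add: order_ge_def zero_extalg.rep_eq)

lemma order_ge_mono: "order_ge F d x \<Longrightarrow> e \<le> d \<Longrightarrow> order_ge F e x"
  unfolding order_ge_def by force

lemma order_ge_gen: "g \<in> F \<Longrightarrow> order_ge F 1 (ext_gen g)"
  by (auto simp: order_ge_def ext_gen.rep_eq)

lemma order_ge_add: "order_ge F d x \<Longrightarrow> order_ge F d y \<Longrightarrow> order_ge F d (x + y :: ('g, 'r :: ab_group_add) extalg)"
  unfolding order_ge_def plus_extalg.rep_eq by (metis add.right_neutral)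

lemma order_ge_uminus: "order_ge F d x \<Longrightarrow> order_ge F d (- x :: ('g, 'r :: ab_group_add) extalg)"
  unfolding order_ge_def uminus_extalg.rep_eq by simp

lemma order_ge_diff: "order_ge F d x \<Longrightarrow> order_ge F d y \<Longrightarrow> order_ge F d (x - y :: ('g, 'r :: ab_group_add) extalg)"
  using order_ge_add[of F d x "- y"] order_ge_uminus[of F d y] by simp

lemma order_ge_sum: "(\<And>i. i \<in> I \<Longrightarrow> order_ge F d (f i)) \<Longrightarrow> order_ge F d (\<Sum>i\<in>I. f i)"
  for f :: "_ \<Rightarrow> ('g, 'r :: ab_group_add) extalg"
  by (induction I rule: infinite_finite_induct) (auto intro: order_ge_add)

lemma order_ge_mult:
  fixes x y :: "('g :: linorder, 'r :: comm_ring_1) extalg"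
  assumes "order_ge F d x" "order_ge F e y"
  shows "order_ge F (d + e) (x * y)"
  unfolding order_ge_def
proof safe
  fix C assume "ext_coeff (x * y) C \<noteq> 0"
  then obtain A B where AB: "C = A \<union> B" "A \<inter> B = {}" "finite A" "finite B"
    "ext_coeff x A \<noteq> 0" "ext_coeff y B \<noteq> 0"
    by (rule ext_coeff_times_nonzero)
  have "card (C \<inter> F) = card (A \<inter> F) + card (B \<inter> F)"
    unfolding AB(1) Int_Un_distrib2 using AB by (intro card_Un_disjoint) auto
  then show "d + e \<le> card (C \<inter> F)"
    using assms AB unfolding order_ge_def by (metis add_mono)
qed

lemma order_ge_mult_left: "order_ge F d y \<Longrightarrow> order_ge F d (x * y)"
  for x y :: "('g :: linorder, 'r :: comm_ring_1) extalg"
  using order_ge_mult[of F 0 x d y] by simp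

lemma order_ge_mult_right: "order_ge F d x \<Longrightarrow> order_ge F d (x * y)"
  for x y :: "('g :: linorder, 'r :: comm_ring_1) extalg"
  using order_ge_mult[of F d x 0 y] by simp

lemma order_ge_imp_zero:
  assumes "order_ge F d x" "finite F" "card F < d"
  shows "x = 0"
proof (rule extalg_eqI)
  fix A
  have "card (A \<inter> F) < d" using assms(2,3) card_mono[of F "A \<inter> F"] by auto
  then show "ext_coeff x A = ext_coeff 0 A"
    using assms(1) unfolding order_ge_def zero_extalg.rep_eq by (metis not_le)
qed

section \<open>Matrices whose powers have trace zero\<close>

lemma fps_deriv_prod:
  fixes f :: "'i \<Rightarrow> 'a :: comm_ring_1 fps"
  assumes "finite S"
  shows "fps_deriv (\<Prod>i\<in>S. f i) = (\<Sum>i\<in>S. fps_deriv (f i) * (\<Prod>j\<in>S - {i}. f j))"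
  using assms
proof (induction rule: finite_induct)
  case (insert x S)
  have "(\<Sum>i\<in>S. fps_deriv (f i) * (\<Prod>j\<in>insert x S - {i}. f j))
      = f x * (\<Sum>i\<in>S. fps_deriv (f i) * (\<Prod>j\<in>S - {i}. f j))"
    unfolding sum_distrib_left
  proof (rule sum.cong)
    fix i assume i: "i \<in> S"
    then have "insert x S - {i} = insert x (S - {i})" using insert by auto
    then show "fps_deriv (f i) * (\<Prod>j\<in>insert x S - {i}. f j)
        = f x * (fps_deriv (f i) * (\<Prod>j\<in>S - {i}. f j))"
      using insert by (simp add: mult_ac)
  qed simp
  moreover have "insert x S - {x} = S" using insert by auto
  ultimately show ?case using insert by (simp add: algebra_simps)
qed simp

lemma fps_deriv_sum: "fps_deriv (\<Sum>i\<in>S. f i) = (\<Sum>i\<in>S. fps_deriv (f i))"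
  by (induction S rule: infinite_finite_induct) auto

lemma det_replace_row:
  fixes M :: "'a :: comm_ring_1 mat"
  assumes M: "M \<in> carrier_mat n n" and i: "i < n"
  shows "det (mat n n (\<lambda>(r, c). if r = i then v c else M $$ (r, c))) = (\<Sum>j<n. v j * cofactor M i j)"
proof -
  let ?M = "mat n n (\<lambda>(r, c). if r = i then v c else M $$ (r, c))"
  have "cofactor ?M i j = cofactor M i j" if "j < n" for j
  proof -
    have "mat_delete ?M i j = mat_delete M i j"
      using M that i unfolding mat_delete_def by (intro eq_matI) auto
    then show ?thesis by (simp add: cofactor_def)
  qed
  then show ?thesis
    using laplace_expansion_row[of ?M n i] i by simp
qed

lemma det_replace_col:
  fixes M :: "'a :: comm_ring_1 mat"
  assumes M: "M \<in> carrier_mat n n" and j: "j < n"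
  shows "det (mat n n (\<lambda>(r, c). if c = j then v r else M $$ (r, c))) = (\<Sum>i<n. v i * cofactor M i j)"
proof -
  let ?M = "mat n n (\<lambda>(r, c). if c = j then v r else M $$ (r, c))"
  have "cofactor ?M i j = cofactor M i j" if "i < n" for i
  proof -
    have "mat_delete ?M i j = mat_delete M i j"
      using M that j unfolding mat_delete_def by (intro eq_matI) auto
    then show ?thesis by (simp add: cofactor_def)
  qed
  then show ?thesis
    using laplace_expansion_column[of ?M n j] j by simp
qed

text \<open>
  Jacobi's formula, as a sum over the rows that are differentiated.
\<close>

lemma fps_deriv_det:
  fixes M :: "'a :: comm_ring_1 fps mat"
  assumes M: "M \<in> carrier_mat n n"
  shows "fps_deriv (det M) = (\<Sum>i<n. \<Sum>j<n. fps_deriv (M $$ (i, j)) * cofactor M i j)"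
proof -
  let ?P = "{p. p permutes {0..<n}}"
  let ?M = "\<lambda>i. mat n n (\<lambda>(r, c). if r = i then fps_deriv (M $$ (i, c)) else M $$ (r, c))"
  have "fps_deriv (det M)
      = (\<Sum>p\<in>?P. signof p * (\<Sum>i<n. fps_deriv (M $$ (i, p i)) * (\<Prod>r\<in>{0..<n} - {i}. M $$ (r, p r))))"
    unfolding det_def'[OF M] fps_deriv_sum
    by (intro sum.cong refl) (simp add: fps_deriv_prod lessThan_atLeast0)
  also have "\<dots> = (\<Sum>i<n. \<Sum>p\<in>?P. signof p *
      (fps_deriv (M $$ (i, p i)) * (\<Prod>r\<in>{0..<n} - {i}. M $$ (r, p r))))"
    unfolding sum_distrib_left by (rule sum.swap)
  also have "\<dots> = (\<Sum>i<n. det (?M i))"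
  proof (intro sum.cong refl)
    fix i assume i: "i \<in> {..<n}"
    have "det (?M i) = (\<Sum>p\<in>?P. signof p * (\<Prod>r = 0..<n. ?M i $$ (r, p r)))"
      by (rule det_def') simp
    also have "\<dots> = (\<Sum>p\<in>?P. signof p *
      (fps_deriv (M $$ (i, p i)) * (\<Prod>r\<in>{0..<n} - {i}. M $$ (r, p r))))"
    proof (intro sum.cong refl arg_cong2[of _ _ _ _ "(*)"])
      fix p assume p: "p \<in> ?P"
      then have lt: "p r < n" if "r < n" for r using that permutes_in_image[of p "{0..<n}" r] by simp
      have "(\<Prod>r = 0..<n. ?M i $$ (r, p r))
          = ?M i $$ (i, p i) * (\<Prod>r\<in>{0..<n} - {i}. ?M i $$ (r, p r))"
        using i by (intro prod.remove) auto
      then show "(\<Prod>r = 0..<n. ?M i $$ (r, p r))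
          = fps_deriv (M $$ (i, p i)) * (\<Prod>r\<in>{0..<n} - {i}. M $$ (r, p r))"
        using i lt by (auto intro!: arg_cong2[of _ _ _ _ "(*)"] prod.cong)
    qed
    finally show "(\<Sum>p\<in>?P. signof p *
      (fps_deriv (M $$ (i, p i)) * (\<Prod>r\<in>{0..<n} - {i}. M $$ (r, p r)))) = det (?M i)" ..
  qed
  also have "\<dots> = (\<Sum>i<n. \<Sum>j<n. fps_deriv (M $$ (i, j)) * cofactor M i j)"
    using det_replace_row[OF M] by (intro sum.cong) auto
  finally show ?thesis .
qed

lemma fps_nth_prod_linear:
  fixes c d :: "'i \<Rightarrow> 'a :: comm_ring_1"
  assumes "finite S"
  shows "card S < k \<Longrightarrow> fps_nth (\<Prod>i\<in>S. fps_const (c i) + fps_X * fps_const (d i)) k = 0"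
    and "fps_nth (\<Prod>i\<in>S. fps_const (c i) + fps_X * fps_const (d i)) (card S) = (\<Prod>i\<in>S. d i)"
  using assms
proof (induction arbitrary: k rule: finite_induct)
  case (insert x S)
  {
    case 1
    then show ?case using insert
      by (simp add: distrib_right mult.assoc fps_X_mult_nth)
  next
    case 2
    then show ?case using insert
      by (simp add: distrib_right mult.assoc fps_X_mult_nth)
  }
qed auto

text \<open>
  The derivative of \<open>det (1 - X A)\<close> is \<open>- tr (A adj (1 - X A))\<close>. Coefficient by coefficient, this and
  \<open>adj (1 - X A) (1 - X A) = det (1 - X A)\<close> show that the determinant is \<open>1\<close> and that the adjugate is the
  geometric series of \<open>A\<close>. Its coefficient of \<open>X ^ (n - 1)\<close> is also the adjugate of \<open>- A\<close>, because the
  cofactors have degree at most \<open>n - 1\<close> in \<open>X\<close>.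
\<close>

lemma adj_mat_eq_power:
  fixes A :: "'a :: comm_ring_1 mat"
  assumes A: "A \<in> carrier_mat n n" and n: "n > 0"
    and torsion: "\<And>k (x :: 'a). k > 0 \<Longrightarrow> of_nat k * x = 0 \<Longrightarrow> x = 0"
    and trace: "\<And>k. k > 0 \<Longrightarrow> mat_trace (A ^\<^sub>m k) = 0"
    and ij: "i < n" "j < n"
  shows "(A ^\<^sub>m (n - 1)) $$ (i, j) = (- 1) ^ (n - 1) * cofactor A j i"
proof -
  define M where "M = mat n n (\<lambda>(i, j). fps_const (if i = j then 1 else 0) + fps_X * fps_const (- A $$ (i, j)))"
  have M: "M \<in> carrier_mat n n" by (simp add: M_def)
  define N where "N = adj_mat M"
  have N: "N \<in> carrier_mat n n" and NM: "N * M = det M \<cdot>\<^sub>m 1\<^sub>m n"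
    unfolding N_def using adj_mat[OF M] by auto
  define f where "f = det M"
  have Nij: "N $$ (i, j) = cofactor M j i" if "i < n" "j < n" for i j
    using that M unfolding N_def adj_mat_def by simp
  define C where "C = (\<lambda>k. mat n n (\<lambda>(i, j). fps_nth (N $$ (i, j)) k))"
  have C: "C k \<in> carrier_mat n n" for k by (simp add: C_def)
  have rec: "C k $$ (i, j) = (if k = 0 then 0 else (C (k - 1) * A) $$ (i, j))
      + (if i = j then fps_nth f k else 0)" if ij: "i < n" "j < n" for i j k
  proof -
    have "(N * M) $$ (i, j) = (\<Sum>l<n. N $$ (i, l) * M $$ (l, j))"
      using ij N M by (auto simp: scalar_prod_def lessThan_atLeast0)
    also have "\<dots> = (\<Sum>l<n. (if l = j then N $$ (i, l) else 0) - fps_X * (fps_const (A $$ (l, j)) * N $$ (i, l)))"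
      using ij by (intro sum.cong) (auto simp: M_def algebra_simps simp flip: fps_const_neg)
    also have "\<dots> = N $$ (i, j) - fps_X * (\<Sum>l<n. fps_const (A $$ (l, j)) * N $$ (i, l))"
      using ij by (simp add: sum_subtractf sum_distrib_left)
    finally have "fps_nth ((N * M) $$ (i, j)) k
        = fps_nth (N $$ (i, j)) k - (if k = 0 then 0 else \<Sum>l<n. A $$ (l, j) * fps_nth (N $$ (i, l)) (k - 1))"
      by (simp add: fps_X_mult_nth fps_sum_nth)
    moreover have "fps_nth ((N * M) $$ (i, j)) k = (if i = j then fps_nth f k else 0)"
      unfolding NM f_def using ij by simp
    moreover have "(C (k - 1) * A) $$ (i, j) = (\<Sum>l<n. A $$ (l, j) * fps_nth (N $$ (i, l)) (k - 1))"
      using ij A by (auto simp: C_def scalar_prod_def lessThan_atLeast0 mult.commute intro!: sum.cong)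
    ultimately show ?thesis using ij by (simp add: C_def)
  qed
  have f0: "fps_nth f 0 = 1"
  proof -
    interpret h: comm_ring_hom "\<lambda>g :: 'a fps. fps_nth g 0" by standard auto
    have "map_mat (\<lambda>g. fps_nth g 0) M = 1\<^sub>m n" by (intro eq_matI) (auto simp: M_def)
    then show ?thesis unfolding f_def h.hom_det[symmetric] by simp
  qed
  have f': "fps_deriv f = - (\<Sum>i<n. \<Sum>j<n. fps_const (A $$ (i, j)) * N $$ (j, i))"
    unfolding f_def fps_deriv_det[OF M] sum_negf[symmetric]
    by (intro sum.cong refl) (simp add: Nij M_def flip: fps_const_neg)
  \<comment> \<open>The coefficients of the determinant beyond the constant one vanish along the way.\<close>
  have pow: "C k = A ^\<^sub>m k" for k
  proof (induction k)
    case 0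
    show ?case
    proof (rule eq_matI)
      show "C 0 $$ (i, j) = (A ^\<^sub>m 0) $$ (i, j)" if "i < dim_row (A ^\<^sub>m 0)" "j < dim_col (A ^\<^sub>m 0)" for i j
        using rec[of i j 0] that A f0 by simp
    qed (use C A in auto)
  next
    case (Suc k)
    have "of_nat (k + 1) * fps_nth f (k + 1) = fps_nth (fps_deriv f) k" by simp
    also have "\<dots> = - (\<Sum>i<n. \<Sum>j<n. A $$ (i, j) * C k $$ (j, i))"
      unfolding f' by (simp add: fps_sum_nth C_def)
    also have "(\<Sum>i<n. \<Sum>j<n. A $$ (i, j) * C k $$ (j, i)) = (\<Sum>j<n. \<Sum>i<n. C k $$ (j, i) * A $$ (i, j))"
      by (subst sum.swap) (simp add: mult.commute)
    also have "\<dots> = mat_trace (C k * A)"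
      using C[of k] A by (auto simp: mat_trace_def scalar_prod_def lessThan_atLeast0)
    also have "C k * A = A ^\<^sub>m Suc k" using Suc by simp
    also have "mat_trace (A ^\<^sub>m Suc k) = 0" by (rule trace) simp
    finally have "fps_nth f (Suc k) = 0" using torsion[of "k + 1"] by simp
    show ?case
    proof (rule eq_matI)
      show "C (Suc k) $$ (i, j) = (A ^\<^sub>m Suc k) $$ (i, j)"
        if "i < dim_row (A ^\<^sub>m Suc k)" "j < dim_col (A ^\<^sub>m Suc k)" for i j
        using rec[of i j "Suc k"] that A Suc \<open>fps_nth f (Suc k) = 0\<close> by simp
    qed (use C A in auto)
  qed
  have "(A ^\<^sub>m (n - 1)) $$ (i, j) = fps_nth (cofactor M j i) (n - 1)"
    using ij Nij by (simp add: C_def flip: pow)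
  also have "\<dots> = (- 1) ^ (j + i) * fps_nth (det (mat_delete M j i)) (n - 1)"
  proof -
    have "(- 1 :: 'a fps) ^ (j + i) = fps_const ((- 1) ^ (j + i))" by (simp flip: fps_const_power fps_const_neg)
    then show ?thesis unfolding cofactor_def by simp
  qed
  also have "fps_nth (det (mat_delete M j i)) (n - 1) = det (- mat_delete A j i)"
  proof -
    have dA: "- mat_delete A j i \<in> carrier_mat (n - 1) (n - 1)" using A by (simp add: mat_delete_def)
    have dM: "mat_delete M j i \<in> carrier_mat (n - 1) (n - 1)" using M by (simp add: mat_delete_def)
    show ?thesis
      unfolding det_def'[OF dA] det_def'[OF dM] fps_sum_nth
    proof (intro sum.cong refl)
      fix p assume p: "p \<in> {p. p permutes {0..<n - 1}}"
      then have lt: "p r < n - 1" if "r < n - 1" for r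
        using that permutes_in_image[of p "{0..<n - 1}" r] by simp
      define u where "u = (\<lambda>i r :: nat. if r < i then r else Suc r)"
      have un: "u i r < n" if "r < n - 1" for i r using that by (auto simp: u_def)
      have eq1: "mat_delete M j i $$ (r, p r)
          = fps_const (if u j r = u i (p r) then 1 else 0) + fps_X * fps_const (- A $$ (u j r, u i (p r)))"
        if "r < n - 1" for r
      proof -
        have "mat_delete M j i $$ (r, p r) = M $$ (u j r, u i (p r))"
          using that lt[OF that] M by (simp add: mat_delete_def u_def)
        then show ?thesis
          using un[OF that, of j] un[OF lt[OF that], of i] by (simp add: M_def)
      qed
      have eq2: "(- mat_delete A j i) $$ (r, p r) = - A $$ (u j r, u i (p r))" if "r < n - 1" for r
        using that lt[OF that] A by (simp add: mat_delete_def u_def)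
      have s: "fps_nth (signof p * g) k = signof p * fps_nth g k" for g :: "'a fps" and k
        by (cases "sign p = 1") (auto simp: sign_def)
      show "fps_nth (signof p * (\<Prod>r = 0..<n - 1. mat_delete M j i $$ (r, p r))) (n - 1)
          = signof p * (\<Prod>r = 0..<n - 1. (- mat_delete A j i) $$ (r, p r))"
        using fps_nth_prod_linear(2)[of "{0..<n - 1}" "\<lambda>r. if u j r = u i (p r) then 1 else 0"
            "\<lambda>r. - A $$ (u j r, u i (p r))"]
        unfolding s by (simp add: eq1 eq2 cong: prod.cong_simp)
    qed
  qed
  also have "- mat_delete A j i = (- 1) \<cdot>\<^sub>m mat_delete A j i" by (intro eq_matI) auto
  also have "det \<dots> = (- 1) ^ (n - 1) * det (mat_delete A j i)"
    using A by (simp add: mat_delete_def)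
  finally show ?thesis by (simp add: cofactor_def mult_ac)
qed

section \<open>Determinants, permanents and invariant subsets\<close>

text \<open>
  Determinants and permanents over an arbitrary index set, so that they can be restricted to subsets
  and multiplied over complementary subsets without renumbering.
\<close>

definition per_on :: "'e set \<Rightarrow> ('e \<Rightarrow> 'e \<Rightarrow> 'a :: comm_ring_1) \<Rightarrow> 'a" where
  "per_on S c = (\<Sum>p | p permutes S. \<Prod>e\<in>S. c e (p e))"

definition det_on :: "'e set \<Rightarrow> ('e \<Rightarrow> 'e \<Rightarrow> 'a :: comm_ring_1) \<Rightarrow> 'a" where
  "det_on S c = (\<Sum>p | p permutes S. of_int (sign p) * (\<Prod>e\<in>S. c e (p e)))"

lemma per_on_cong: "(\<And>e f. e \<in> S \<Longrightarrow> f \<in> S \<Longrightarrow> c e f = d e f) \<Longrightarrow> per_on S c = per_on S d"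
  unfolding per_on_def by (intro sum.cong prod.cong refl) (auto simp: permutes_in_image)

lemma det_on_cong: "(\<And>e f. e \<in> S \<Longrightarrow> f \<in> S \<Longrightarrow> c e f = d e f) \<Longrightarrow> det_on S c = det_on S d"
  unfolding det_on_def
  by (intro sum.cong prod.cong refl arg_cong2[of _ _ _ _ "(*)"]) (auto simp: permutes_in_image)

lemma per_on_transpose:
  assumes "finite S"
  shows "per_on S (\<lambda>e f. c f e) = per_on S c"
proof -
  have "per_on S c = (\<Sum>p | p permutes S. \<Prod>e\<in>S. c e (inv_into UNIV p e))"
    unfolding per_on_def
    by (rule sum.reindex_bij_witness[of _ "inv_into UNIV" "inv_into UNIV"])
      (auto simp: permutes_inv permutes_inv_inv)
  also have "\<dots> = per_on S (\<lambda>e f. c f e)"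
    unfolding per_on_def
  proof (rule sum.cong)
    fix p assume "p \<in> {p. p permutes S}"
    then have p: "p permutes S" by simp
    show "(\<Prod>e\<in>S. c e (inv_into UNIV p e)) = (\<Prod>e\<in>S. c (p e) e)"
      by (rule prod.reindex_bij_witness[of _ p "inv_into UNIV p"])
        (use p in \<open>auto simp: permutes_in_image permutes_inverses permutes_inv\<close>)
  qed simp
  finally show ?thesis by simp
qed

definition perm_restrict :: "'e set \<Rightarrow> ('e \<Rightarrow> 'e) \<Rightarrow> 'e \<Rightarrow> 'e" where
  "perm_restrict T p = (\<lambda>x. if x \<in> T then p x else x)"

lemma perm_restrict_permutes:
  assumes "p permutes S" "p ` T = T"
  shows "perm_restrict T p permutes T"
proof (rule bij_imp_permutes)
  have "inj_on p T" using permutes_inj[OF assms(1)] by (rule inj_on_subset) simp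
  then have "bij_betw p T T" using assms(2) by (simp add: bij_betw_def)
  then show "bij_betw (perm_restrict T p) T T"
    by (rule bij_betw_cong[THEN iffD1, rotated]) (simp add: perm_restrict_def)
qed (simp add: perm_restrict_def)

lemma perm_restrict_permutes_inj:
  assumes "finite S" "f \<in> PiE S (\<lambda>_. S)" "inj_on f S"
  shows "perm_restrict S f permutes S"
proof (rule bij_imp_permutes)
  have "f ` S = S" using assms by (intro endo_inj_surj) auto
  then have "bij_betw f S S" using assms(3) by (simp add: bij_betw_def)
  then show "bij_betw (perm_restrict S f) S S"
    by (rule bij_betw_cong[THEN iffD1, rotated]) (simp add: perm_restrict_def)
qed (simp add: perm_restrict_def)

text \<open>
  A permutation of \<open>T\<close> and one of \<open>S - T\<close> are the same as a permutation of \<open>S\<close> that preserves \<open>T\<close>.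
\<close>

lemma det_on_times_per_on:
  fixes c :: "'e \<Rightarrow> 'e \<Rightarrow> 'a :: comm_ring_1"
  assumes S: "finite S" and T: "T \<subseteq> S"
  shows "det_on T c * per_on (S - T) c
    = (\<Sum>p | p permutes S \<and> p ` T = T. of_int (sign (perm_restrict T p)) * (\<Prod>e\<in>S. c e (p e)))"
proof -
  have "det_on T c * per_on (S - T) c = (\<Sum>(q, r)\<in>{q. q permutes T} \<times> {r. r permutes S - T}.
      of_int (sign q) * (\<Prod>e\<in>T. c e (q e)) * (\<Prod>e\<in>S - T. c e (r e)))"
    unfolding det_on_def per_on_def by (simp add: sum_product sum.cartesian_product)
  also have "\<dots> = (\<Sum>p | p permutes S \<and> p ` T = T.
      of_int (sign (perm_restrict T p)) * (\<Prod>e\<in>S. c e (p e)))"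
  proof (rule sum.reindex_bij_witness[where
        i = "\<lambda>p. (perm_restrict T p, perm_restrict (S - T) p)" and j = "\<lambda>(q, r). q \<circ> r"])
    fix p assume "p \<in> {p. p permutes S \<and> p ` T = T}"
    then have p: "p permutes S" "p ` T = T" by auto
    have "p ` (S - T) = S - T"
      using p permutes_image[OF p(1)] permutes_inj[OF p(1)] by (simp add: image_set_diff)
    then have im: "p x \<in> S - T" if "x \<in> S - T" for x using that by blast
    show "(case (perm_restrict T p, perm_restrict (S - T) p) of (q, r) \<Rightarrow> q \<circ> r) = p"
      using im p T by (auto simp: perm_restrict_def fun_eq_iff permutes_not_in)
    show "(perm_restrict T p, perm_restrict (S - T) p) \<in> {q. q permutes T} \<times> {r. r permutes S - T}"
      using perm_restrict_permutes[OF p] perm_restrict_permutes[OF p(1) \<open>p ` (S - T) = S - T\<close>] by simp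
  next
    fix x assume "x \<in> {q. q permutes T} \<times> {r. r permutes S - T}"
    then obtain q r where x: "x = (q, r)" and q: "q permutes T" and r: "r permutes S - T" by auto
    have rT: "r y = y" if "y \<in> T" for y using that permutes_not_in[OF r] by simp
    have rS: "r y \<in> S - T" if "y \<in> S - T" for y using that permutes_in_image[OF r] by blast
    have qS: "q y = y" if "y \<notin> T" for y using that permutes_not_in[OF q] by simp
    have qr: "(q \<circ> r) y = (if y \<in> T then q y else r y)" for y
    proof -
      have "r y \<notin> T" if "y \<notin> T"
        using that rS[of y] permutes_not_in[OF r, of y] by (cases "y \<in> S - T") auto
      then show ?thesis using rT[of y] qS[of "r y"] by simp
    qed
    have e1: "perm_restrict T (q \<circ> r) = q"
      unfolding perm_restrict_def qr using qS by auto
    have e2: "perm_restrict (S - T) (q \<circ> r) = r"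
      unfolding perm_restrict_def qr using permutes_not_in[OF r] by (auto simp: fun_eq_iff)
    show "(perm_restrict T (case x of (q, r) \<Rightarrow> q \<circ> r), perm_restrict (S - T) (case x of (q, r) \<Rightarrow> q \<circ> r)) = x"
      using e1 e2 x by simp
    have "(q \<circ> r) permutes S"
      using permutes_compose[OF permutes_subset[OF r] permutes_subset[OF q T]] by auto
    moreover have "(q \<circ> r) ` T = T"
      using qr permutes_image[OF q] by (simp cong: image_cong)
    ultimately show "(case x of (q, r) \<Rightarrow> q \<circ> r) \<in> {p. p permutes S \<and> p ` T = T}"
      using x by simp
    have "(\<Prod>e\<in>S. c e ((q \<circ> r) e)) = (\<Prod>e\<in>S - T. c e ((q \<circ> r) e)) * (\<Prod>e\<in>T. c e ((q \<circ> r) e))"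
      by (rule prod.subset_diff[OF T S])
    also have "\<dots> = (\<Prod>e\<in>S - T. c e (r e)) * (\<Prod>e\<in>T. c e (q e))"
      unfolding qr by (intro arg_cong2[of _ _ _ _ "(*)"] prod.cong) auto
    finally show "of_int (sign (perm_restrict T (case x of (q, r) \<Rightarrow> q \<circ> r)))
          * (\<Prod>e\<in>S. c e ((case x of (q, r) \<Rightarrow> q \<circ> r) e))
        = (case x of (q, r) \<Rightarrow> of_int (sign q) * (\<Prod>e\<in>T. c e (q e)) * (\<Prod>e\<in>S - T. c e (r e)))"
      using e1 x by (simp add: mult_ac)
  qed
  finally show ?thesis .
qed

text \<open>
  An invariant set is a union of cycles of \<open>p\<close>, and a cycle of length \<open>l\<close> contributes \<open>(- 1) ^ l\<close> from the
  cardinality and \<open>(- 1) ^ (l - 1)\<close> from the sign; so adding a given cycle to \<open>T\<close> negates the summand.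
  The induction avoids cycles: it takes one point out of its cycle, which preserves the summands,
  until the point is fixed, and then adds it to \<open>T\<close> or removes it.
\<close>

lemma sum_sign_invariant_subsets:
  assumes "finite S" "S \<noteq> {}" "p permutes S"
  shows "(\<Sum>T | T \<subseteq> S \<and> p ` T = T. (- 1) ^ card T * sign (perm_restrict T p)) = (0 :: int)"
  using assms
proof (induction "card S" arbitrary: S p rule: less_induct)
  case less
  obtain s where s: "s \<in> S" using less.prems by auto
  let ?g = "\<lambda>p T. (- 1) ^ card T * sign (perm_restrict T p) :: int"
  have inj: "inj p" using less.prems(3) by (rule permutes_inj)
  show ?case
  proof (cases "p s = s")
    case True
    let ?A = "{T. T \<subseteq> S - {s} \<and> p ` T = T}"
    have finA: "finite ?A" using less.prems(1) by (intro finite_subset[of ?A "Pow S"]) auto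
    have eq: "{T. T \<subseteq> S \<and> p ` T = T} = ?A \<union> insert s ` ?A"
    proof (intro subset_antisym subsetI)
      fix T assume T: "T \<in> {T. T \<subseteq> S \<and> p ` T = T}"
      show "T \<in> ?A \<union> insert s ` ?A"
      proof (cases "s \<in> T")
        case True
        have "p ` (T - {s}) = T - {s}"
          using T \<open>p s = s\<close> inj by (simp add: image_set_diff)
        then have "T - {s} \<in> ?A" using T by auto
        moreover have "T = insert s (T - {s})" using True by auto
        ultimately show ?thesis by (intro UnI2 image_eqI[of _ _ "T - {s}"])
      qed (use T in auto)
    next
      fix T assume "T \<in> ?A \<union> insert s ` ?A"
      then obtain T' where T': "T' \<in> ?A" "T = T' \<or> T = insert s T'" by blast
      have "p ` insert s T' = insert s T'" using T' True by simp
      then show "T \<in> {T. T \<subseteq> S \<and> p ` T = T}" using s T' by blast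
    qed
    have "(\<Sum>T | T \<subseteq> S \<and> p ` T = T. ?g p T) = (\<Sum>T\<in>?A. ?g p T) + (\<Sum>T\<in>insert s ` ?A. ?g p T)"
      unfolding eq using finA by (intro sum.union_disjoint) auto
    also have "(\<Sum>T\<in>insert s ` ?A. ?g p T) = (\<Sum>T\<in>?A. ?g p (insert s T))"
      by (subst sum.reindex) (auto simp: inj_on_def)
    also have "\<dots> = (\<Sum>T\<in>?A. - ?g p T)"
    proof (intro sum.cong refl)
      fix T assume T: "T \<in> ?A"
      then have "s \<notin> T" "finite T" using less.prems(1) by (auto intro: finite_subset)
      moreover have "perm_restrict (insert s T) p = perm_restrict T p"
        using True by (auto simp: perm_restrict_def)
      ultimately show "?g p (insert s T) = - ?g p T" using T by simp
    qed
    finally show ?thesis by (simp add: sum_negf)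
  next
    case False
    define t where "t = p s"
    have st: "s \<noteq> t" "t \<in> S"
      using False s permutes_in_image[OF less.prems(3), of s] by (auto simp: t_def)
    \<comment> \<open>The permutation that bypasses \<open>s\<close>: it fixes \<open>s\<close> and sends the preimage of \<open>s\<close> to \<open>t\<close>.\<close>
    define q where "q = transpose s t \<circ> p"
    have pq: "p = transpose s t \<circ> q" by (simp add: q_def fun_eq_iff)
    have "q permutes S"
      unfolding q_def using less.prems(3) s st by (intro permutes_compose permutes_swap_id)
    moreover have qs: "q s = s" by (simp add: q_def t_def)
    ultimately have q: "q permutes S - {s}" by (auto intro: permutes_superset[of q S])
    have "(\<Sum>T | T \<subseteq> S \<and> p ` T = T. ?g p T) = (\<Sum>T | T \<subseteq> S - {s} \<and> q ` T = T. ?g q T)"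
    proof (rule sum.reindex_bij_witness[where
          i = "\<lambda>T. if t \<in> T then insert s T else T" and j = "\<lambda>T. T - {s}"])
      fix T assume "T \<in> {T. T \<subseteq> S \<and> p ` T = T}"
      then have T: "T \<subseteq> S" "p ` T = T" by auto
      have fin: "finite T" using less.prems(1) T(1) by (rule finite_subset[rotated])
      have ts: "t \<in> T \<longleftrightarrow> s \<in> T"
        using T(2) inj_image_mem_iff[OF inj, of s T] by (simp add: t_def)
      then show "(if t \<in> T - {s} then insert s (T - {s}) else T - {s}) = T"
        using st by auto
      have "q ` (T - {s}) = T - {s}"
      proof (cases "s \<in> T")
        case True
        have "p ` (T - {s}) = T - {t}"
          using T(2) inj by (simp add: image_set_diff t_def)
        then have "q ` (T - {s}) = transpose s t ` (T - {t})"
          unfolding q_def image_comp[symmetric] by simp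
        also have "\<dots> = T - {s}"
          using True ts st by (auto simp: transpose_def image_iff)
        finally show ?thesis .
      next
        case False
        have "q x = p x" if "x \<in> T" for x
        proof -
          have "p x \<in> T" using that T by auto
          then show ?thesis using False ts by (auto simp: q_def transpose_def)
        qed
        then show ?thesis using False T(2) by (simp cong: image_cong)
      qed
      then show "T - {s} \<in> {T. T \<subseteq> S - {s} \<and> q ` T = T}" using T by auto
      show "?g q (T - {s}) = ?g p T"
      proof (cases "s \<in> T")
        case True
        have "perm_restrict T p = transpose s t \<circ> perm_restrict (T - {s}) q"
          using True ts by (auto simp: perm_restrict_def q_def fun_eq_iff t_def transpose_def)
        moreover have "perm_restrict (T - {s}) q permutes T - {s}"
          using q \<open>q ` (T - {s}) = T - {s}\<close> by (rule perm_restrict_permutes)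
        then have "permutation (perm_restrict (T - {s}) q)"
          using fin by (auto simp: permutation_permutes)
        ultimately have "sign (perm_restrict T p) = - sign (perm_restrict (T - {s}) q)"
          using st by (simp add: sign_compose sign_swap_id permutation_swap_id)
        moreover have "card T = Suc (card (T - {s}))"
          by (rule card.remove[OF fin True])
        ultimately show ?thesis by simp
      next
        case False
        have "perm_restrict (T - {s}) q = perm_restrict T p"
        proof -
          have "q x = p x" if "x \<in> T" for x
          proof -
            have "p x \<in> T" using that T by auto
            then show ?thesis using False ts by (auto simp: q_def transpose_def)
          qed
          then show ?thesis using False by (auto simp: perm_restrict_def)
        qed
        then show ?thesis using False by simp
      qed
    next
      fix T assume "T \<in> {T. T \<subseteq> S - {s} \<and> q ` T = T}"
      then have T: "T \<subseteq> S - {s}" "q ` T = T" by auto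
      have "p ` (if t \<in> T then insert s T else T) = (if t \<in> T then insert s T else T)"
      proof (cases "t \<in> T")
        case True
        have "p ` T = transpose s t ` T" using T(2) by (metis image_comp pq)
        also have "\<dots> = insert s (T - {t})" using True T st by (auto simp: transpose_def image_iff)
        finally show ?thesis using True by (auto simp: t_def)
      next
        case False
        have "p ` T = transpose s t ` T" using T(2) by (metis image_comp pq)
        also have "\<dots> = T" using False T by (auto simp: transpose_def image_iff)
        finally show ?thesis using False by simp
      qed
      then show "(if t \<in> T then insert s T else T) \<in> {T. T \<subseteq> S \<and> p ` T = T}"
        using T s by auto
      show "(if t \<in> T then insert s T else T) - {s} = T" using T by auto
    qed
    also have "\<dots> = 0"
    proof (rule less.hyps)
      show "card (S - {s}) < card S" using less.prems(1) s by (rule card_Diff1_less)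
    qed (use less.prems st q in auto)
    finally show ?thesis .
  qed
qed

text \<open>
  Muir's identity: the alternating generating function of principal minors is inverse to that of the
  principal permanents. The product of a minor and the complementary permanent is a sum over
  permutations that preserve \<open>T\<close>; for a fixed permutation the sets \<open>T\<close> cancel.
\<close>

lemma muir_identity:
  fixes c :: "'e \<Rightarrow> 'e \<Rightarrow> 'a :: comm_ring_1"
  assumes S: "finite S" "S \<noteq> {}"
  shows "(\<Sum>T\<in>Pow S. (- 1) ^ card T * (det_on T c * per_on (S - T) c)) = 0"
proof -
  let ?w = "\<lambda>T p. of_int ((- 1) ^ card T * sign (perm_restrict T p)) * (\<Prod>e\<in>S. c e (p e))"
  have "(\<Sum>T\<in>Pow S. (- 1) ^ card T * (det_on T c * per_on (S - T) c))
      = (\<Sum>T\<in>Pow S. \<Sum>p | p permutes S \<and> p ` T = T. ?w T p)"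
    using S by (intro sum.cong) (auto simp: det_on_times_per_on sum_distrib_left mult.assoc)
  also have "\<dots> = (\<Sum>p | p permutes S. \<Sum>T | T \<in> Pow S \<and> p ` T = T. ?w T p)"
    using sum.swap_restrict[of "Pow S" "{p. p permutes S}" "\<lambda>T p. ?w T p" "\<lambda>T p. p ` T = T"]
      S finite_permutations[OF S(1)] by simp
  also have "\<dots> = (\<Sum>p | p permutes S.
      of_int (\<Sum>T | T \<subseteq> S \<and> p ` T = T. (- 1) ^ card T * sign (perm_restrict T p)) * (\<Prod>e\<in>S. c e (p e)))"
    by (simp only: sum_distrib_right of_int_sum Pow_iff)
  also have "\<dots> = 0"
    using sum_sign_invariant_subsets[OF S] by simp
  finally show ?thesis .
qed

section \<open>Signed sums over orientations\<close>

text \<open>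
  An edge \<open>e\<close> leads from \<open>s e\<close> to \<open>t e\<close>, and \<open>O'\<close> is the set of the edges that are reversed. Thus
  \<open>flipped s t O'\<close> is the start and \<open>flipped t s O'\<close> the end after reversal.
\<close>

definition flipped :: "('e \<Rightarrow> 'v) \<Rightarrow> ('e \<Rightarrow> 'v) \<Rightarrow> 'e set \<Rightarrow> 'e \<Rightarrow> 'v" where
  "flipped s t O' e = (if e \<in> O' then t e else s e)"

definition orient_per :: "('v \<Rightarrow> 'v \<Rightarrow> 'a :: comm_ring_1) \<Rightarrow> ('e \<Rightarrow> 'v) \<Rightarrow> ('e \<Rightarrow> 'v) \<Rightarrow> 'e set \<Rightarrow> 'a" where
  "orient_per b s t S = (\<Sum>O'\<in>Pow S. (- 1) ^ card O' *
     per_on S (\<lambda>e f. b (flipped s t O' e) (flipped t s O' f)))"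

definition orient_det :: "('v \<Rightarrow> 'v \<Rightarrow> 'a :: comm_ring_1) \<Rightarrow> ('e \<Rightarrow> 'v) \<Rightarrow> ('e \<Rightarrow> 'v) \<Rightarrow> 'e set \<Rightarrow> 'a" where
  "orient_det b s t S = (\<Sum>O'\<in>Pow S. (- 1) ^ card O' *
     det_on S (\<lambda>e f. b (flipped s t O' e) (flipped t s O' f)))"

lemma orient_per_empty [simp]: "orient_per b s t {} = 1"
  by (simp add: orient_per_def per_on_def)

lemma orient_det_empty [simp]: "orient_det b s t {} = 1"
  by (simp add: orient_det_def det_on_def)

text \<open>
  Muir's identity for each orientation. The two factors only see the edges in \<open>T\<close> and those outside
  of \<open>T\<close>, so their orientations are independent and make up an orientation of \<open>S\<close>.
\<close>

lemma orient_det_per_convolution: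
  assumes S: "finite S" "S \<noteq> {}"
  shows "(\<Sum>T\<in>Pow S. (- 1) ^ card T * orient_det b s t T * orient_per b s t (S - T)) = 0"
proof -
  let ?c = "\<lambda>O' e f. b (flipped s t O' e) (flipped t s O' f)"
  have "(- 1) ^ card T * orient_det b s t T * orient_per b s t (S - T)
      = (\<Sum>O'\<in>Pow S. (- 1) ^ card O' * ((- 1) ^ card T * (det_on T (?c O') * per_on (S - T) (?c O'))))"
    if T: "T \<in> Pow S" for T
  proof -
    have "orient_det b s t T * orient_per b s t (S - T) = (\<Sum>(O1, O2)\<in>Pow T \<times> Pow (S - T).
        (- 1) ^ card O1 * det_on T (?c O1) * ((- 1) ^ card O2 * per_on (S - T) (?c O2)))"
      unfolding orient_det_def orient_per_def by (simp add: sum_product sum.cartesian_product)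
    also have "\<dots> = (\<Sum>O'\<in>Pow S. (- 1) ^ card O' * (det_on T (?c O') * per_on (S - T) (?c O')))"
    proof (rule sum.reindex_bij_witness[where
          i = "\<lambda>O'. (O' \<inter> T, O' - T)" and j = "\<lambda>(O1, O2). O1 \<union> O2"])
      fix x assume "x \<in> Pow T \<times> Pow (S - T)"
      then obtain O1 O2 where x: "x = (O1, O2)" "O1 \<subseteq> T" "O2 \<subseteq> S - T" by auto
      have "O1 \<subseteq> S" "O2 \<subseteq> S" using x T by auto
      then have fin: "finite O1" "finite O2" using S(1) by (auto intro: finite_subset)
      have "card (O1 \<union> O2) = card O1 + card O2"
        using x fin by (intro card_Un_disjoint) auto
      moreover have "det_on T (?c (O1 \<union> O2)) = det_on T (?c O1)"
        using x by (intro det_on_cong) (auto simp: flipped_def)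
      moreover have "per_on (S - T) (?c (O1 \<union> O2)) = per_on (S - T) (?c O2)"
        using x by (intro per_on_cong) (auto simp: flipped_def)
      ultimately show "(- 1) ^ card (case x of (O1, O2) \<Rightarrow> O1 \<union> O2) *
          (det_on T (?c (case x of (O1, O2) \<Rightarrow> O1 \<union> O2)) * per_on (S - T) (?c (case x of (O1, O2) \<Rightarrow> O1 \<union> O2)))
        = (case x of (O1, O2) \<Rightarrow>
            (- 1) ^ card O1 * det_on T (?c O1) * ((- 1) ^ card O2 * per_on (S - T) (?c O2)))"
        unfolding x by (simp add: power_add mult_ac)
      show "(case x of (O1, O2) \<Rightarrow> O1 \<union> O2) \<in> Pow S" using x T by auto
      show "((case x of (O1, O2) \<Rightarrow> O1 \<union> O2) \<inter> T, (case x of (O1, O2) \<Rightarrow> O1 \<union> O2) - T) = x"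
        using x by auto
    next
      fix O' assume "O' \<in> Pow S"
      then show "(O' \<inter> T, O' - T) \<in> Pow T \<times> Pow (S - T)"
        "(case (O' \<inter> T, O' - T) of (O1, O2) \<Rightarrow> O1 \<union> O2) = O'"
        by blast (simp add: Int_Diff_Un)
    qed
    finally have eq: "orient_det b s t T * orient_per b s t (S - T) =
      (\<Sum>O'\<in>Pow S. (- 1) ^ card O' * (det_on T (?c O') * per_on (S - T) (?c O')))" .
    show ?thesis
      unfolding mult.assoc eq sum_distrib_left by (intro sum.cong refl) (simp only: mult_ac)
  qed
  then have "(\<Sum>T\<in>Pow S. (- 1) ^ card T * orient_det b s t T * orient_per b s t (S - T))
      = (\<Sum>O'\<in>Pow S. (- 1) ^ card O' *
          (\<Sum>T\<in>Pow S. (- 1) ^ card T * (det_on T (?c O') * per_on (S - T) (?c O'))))"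
    by (simp add: sum_distrib_left) (rule sum.swap)
  then show ?thesis by (simp add: muir_identity[OF S])
qed

text \<open>
  Reversing all edges transposes the matrix, which does not change the permanent. In particular the
  sum is its own negative if the number of edges is odd.
\<close>

lemma orient_per_reverse:
  fixes b :: "'v \<Rightarrow> 'v \<Rightarrow> 'a :: comm_ring_1"
  assumes S: "finite S" and sym: "\<And>u v. b u v = b v u"
  shows "orient_per b s t S = (- 1) ^ card S * orient_per b s t S"
proof -
  have "orient_per b s t S = (\<Sum>O'\<in>Pow S. (- 1) ^ card (S - O') *
      per_on S (\<lambda>e f. b (flipped s t (S - O') e) (flipped t s (S - O') f)))"
    unfolding orient_per_def
    by (rule sum.reindex_bij_witness[of _ "\<lambda>O'. S - O'" "\<lambda>O'. S - O'"]) (auto simp: double_diff)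
  also have "\<dots> = (\<Sum>O'\<in>Pow S. (- 1) ^ card S * ((- 1) ^ card O' *
      per_on S (\<lambda>e f. b (flipped s t O' e) (flipped t s O' f))))"
  proof (rule sum.cong)
    fix O' assume O': "O' \<in> Pow S"
    then have "finite O'" "card O' \<le> card S" using S by (auto intro: finite_subset card_mono)
    then have "card S = card (S - O') + card O'" using O' by (simp add: card_Diff_subset)
    then have "(- 1 :: 'a) ^ card (S - O') = (- 1) ^ card S * (- 1) ^ card O'"
      by (simp add: power_add mult.assoc)
    moreover have "per_on S (\<lambda>e f. b (flipped s t (S - O') e) (flipped t s (S - O') f))
        = per_on S (\<lambda>e f. b (flipped s t O' f) (flipped t s O' e))"
      by (rule per_on_cong, subst sym) (simp add: flipped_def)
    moreover have "\<dots> = per_on S (\<lambda>e f. b (flipped s t O' e) (flipped t s O' f))"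
      by (rule per_on_transpose[OF S])
    ultimately show "(- 1) ^ card (S - O') * per_on S (\<lambda>e f. b (flipped s t (S - O') e) (flipped t s (S - O') f))
      = (- 1) ^ card S * ((- 1) ^ card O' * per_on S (\<lambda>e f. b (flipped s t O' e) (flipped t s O' f)))"
      by (simp only: mult.assoc)
  qed simp
  finally show ?thesis by (simp add: orient_per_def sum_distrib_left)
qed

section \<open>The recursion for the sum over pairings\<close>

text \<open>
  The set of pairings of an arbitrary finite set, which the recursion needs for the complement of a pair.
\<close>

definition pairings_on :: "'e set \<Rightarrow> nat \<Rightarrow> 'e set set set set" where
  "pairings_on S k = {P. card P = k \<and> disjoint P \<and> partition_on S (\<Union>P) \<and>
     (\<forall>p\<in>P. \<exists>I J. p = {I, J} \<and> I \<noteq> J \<and> card I = card J)}"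

definition block_pairs :: "'e set \<Rightarrow> 'e set set set" where
  "block_pairs S = {p. \<exists>I J. p = {I, J} \<and> I \<noteq> {} \<and> J \<noteq> {} \<and> I \<inter> J = {} \<and> card I = card J \<and> I \<union> J \<subseteq> S}"

definition pairing_sum :: "('e set set \<Rightarrow> 'a :: comm_ring_1) \<Rightarrow> 'e set \<Rightarrow> nat \<Rightarrow> 'a" where
  "pairing_sum w S k = (\<Sum>P\<in>pairings_on S k. \<Prod>p\<in>P. w p)"

definition Sigma_on :: "('e set set \<Rightarrow> 'a :: comm_ring_1) \<Rightarrow> 'e set \<Rightarrow> 'a" where
  "Sigma_on w S = (\<Sum>k\<le>card S. of_int ((- 2) ^ k * fact k) * pairing_sum w S k)"

lemma pairings_onD:
  assumes "P \<in> pairings_on S k" "finite S"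
  shows "finite P" "finite (\<Union>P)" "2 * k \<le> card S"
proof -
  have part: "partition_on S (\<Union>P)" using assms by (simp add: pairings_on_def)
  then have sub: "\<Union>P \<subseteq> Pow S" by (auto simp: partition_on_def)
  then show fin: "finite (\<Union>P)" using assms(2) by (auto intro: finite_subset)
  then show finP: "finite P" by (rule finite_UnionD)
  have "card p = 2" if "p \<in> P" for p
  proof -
    have "\<forall>p\<in>P. \<exists>I J. p = {I, J} \<and> I \<noteq> J \<and> card I = card J"
      using assms(1) by (simp add: pairings_on_def)
    from bspec[OF this that] show ?thesis by (elim exE conjE) simp
  qed
  then have "card (\<Union>P) = (\<Sum>p\<in>P. 2)"
    using assms(1) fin finP
    by (subst card_Union_disjoint) (auto simp: pairings_on_def disjoint_def pairwise_def disjnt_def intro: finite_subset)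
  then have k: "card (\<Union>P) = 2 * k" using assms(1) by (simp add: pairings_on_def)
  have "card S = (\<Sum>I\<in>\<Union>P. card I)"
    using part card_Union_disjoint[of "\<Union>P"] assms(2) sub
    by (auto simp: partition_on_def disjoint_def pairwise_def disjnt_def intro: finite_subset)
  also have "\<dots> \<ge> (\<Sum>I\<in>\<Union>P. 1)"
  proof (rule sum_mono)
    fix I assume I: "I \<in> \<Union>P"
    then have "finite I" using sub assms(2) by (auto intro: finite_subset)
    moreover have "I \<noteq> {}" using I part by (auto simp: partition_on_def)
    ultimately show "1 \<le> card I" by (simp add: Suc_le_eq card_gt_0_iff)
  qed
  finally show "2 * k \<le> card S" using k by simp
qed

lemma finite_pairings_on:
  assumes "finite S"
  shows "finite (pairings_on S k)"
proof (rule finite_subset)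
  show "pairings_on S k \<subseteq> Pow (Pow (Pow S))"
  proof
    fix P assume "P \<in> pairings_on S k"
    then have "\<Union>P \<subseteq> Pow S" by (auto simp: pairings_on_def partition_on_def)
    then show "P \<in> Pow (Pow (Pow S))" by auto
  qed
qed (use assms in simp)

lemma finite_block_pairs: "finite S \<Longrightarrow> finite (block_pairs S)"
  by (rule finite_subset[of _ "Pow (Pow S)"]) (auto simp: block_pairs_def)

lemma pairing_sum_eq_0:
  assumes "finite S" "card S < 2 * k"
  shows "pairing_sum w S k = 0"
proof -
  have "pairings_on S k = {}" using pairings_onD(3)[of _ S k] assms by fastforce
  then show ?thesis by (simp add: pairing_sum_def)
qed

lemma pairing_sum_0:
  assumes "finite S"
  shows "pairing_sum w S 0 = (if S = {} then 1 else 0)"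
proof -
  have "pairings_on S 0 = (if S = {} then {{}} else {})"
  proof -
    have "P = {}" if "P \<in> pairings_on S 0" for P
      using that pairings_onD(1)[OF that assms] by (simp add: pairings_on_def)
    moreover have "{} \<in> pairings_on S 0 \<longleftrightarrow> S = {}"
      by (auto simp: pairings_on_def partition_on_def)
    ultimately show ?thesis by (cases "S = {}") auto
  qed
  then show ?thesis by (simp add: pairing_sum_def)
qed

lemma insert_pairing:
  assumes S: "finite S" and p: "p \<in> block_pairs S" and P: "P \<in> pairings_on (S - \<Union>p) k"
  shows "p \<notin> P" and "insert p P \<in> pairings_on S (Suc k)"
proof -
  obtain I J where p_eq: "p = {I, J}" and IJ: "I \<noteq> {}" "J \<noteq> {}" "I \<inter> J = {}" "card I = card J" "I \<union> J \<subseteq> S"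
    using p by (auto simp: block_pairs_def)
  have finP: "finite P" using pairings_onD(1)[OF P] S by simp
  have part: "partition_on (S - (I \<union> J)) (\<Union>P)" and dP: "disjoint P" and cP: "card P = k"
    and pairs: "\<forall>q\<in>P. \<exists>I J. q = {I, J} \<and> I \<noteq> J \<and> card I = card J"
    using P p_eq by (auto simp: pairings_on_def)
  have disj: "X \<inter> (I \<union> J) = {}" if "X \<in> \<Union>P" for X
    using that part by (auto simp: partition_on_def)
  have notin: "I \<notin> \<Union>P" "J \<notin> \<Union>P" using disj IJ by blast+
  then show "p \<notin> P" using p_eq by auto
  have "disjoint (insert p P)"
    using dP notin unfolding p_eq disjoint_def by auto
  moreover have "partition_on S (\<Union>(insert p P))"
  proof -
    have U: "\<Union>(\<Union>P) = S - (I \<union> J)" and dU: "disjoint (\<Union>P)" and "{} \<notin> \<Union>P"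
      using part by (auto simp: partition_on_def)
    have "disjoint ({I, J} \<union> \<Union>P)"
    proof (rule disjoint_union)
      show "disjoint {I, J}" using IJ by (auto simp: disjoint_def)
      show "\<Union>{I, J} \<inter> \<Union>(\<Union>P) = {}" unfolding U by auto
    qed (rule dU)
    moreover have "\<Union>({I, J} \<union> \<Union>P) = S" using U IJ by auto
    ultimately show ?thesis
      using IJ \<open>{} \<notin> \<Union>P\<close> by (simp add: p_eq partition_on_def)
  qed
  moreover have "I \<noteq> J" using IJ by auto
  ultimately show "insert p P \<in> pairings_on S (Suc k)"
    using finP cP pairs \<open>p \<notin> P\<close> IJ p_eq by (auto simp: pairings_on_def)
qed

lemma remove_pair:
  assumes S: "finite S" and P: "P \<in> pairings_on S (Suc k)" and p: "p \<in> P"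
  shows "p \<in> block_pairs S" and "P - {p} \<in> pairings_on (S - \<Union>p) k"
proof -
  have finP: "finite P" using pairings_onD(1)[OF P] S by simp
  have part: "partition_on S (\<Union>P)" and dP: "disjoint P" and cP: "card P = Suc k"
    and pairs: "\<forall>q\<in>P. \<exists>I J. q = {I, J} \<and> I \<noteq> J \<and> card I = card J"
    using P by (auto simp: pairings_on_def)
  obtain I J where p_eq: "p = {I, J}" and IJ: "I \<noteq> J" "card I = card J" using bspec[OF pairs p] by (elim exE conjE) (rule that)
  have IJ': "I \<in> \<Union>P" "J \<in> \<Union>P" using p p_eq by auto
  have dU: "X \<inter> Y = {}" if "X \<in> \<Union>P" "Y \<in> \<Union>P" "X \<noteq> Y" for X Y
    using partition_onD2[OF part] that unfolding disjoint_def by meson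
  have "I \<noteq> {}" "J \<noteq> {}" using partition_onD3[OF part] IJ' by metis+
  moreover have "I \<union> J \<subseteq> S" using partition_onD1[OF part] IJ' by blast
  ultimately have blocks: "I \<noteq> {}" "J \<noteq> {}" "I \<inter> J = {}" "I \<union> J \<subseteq> S"
    using dU[OF IJ' IJ(1)] by auto
  then show "p \<in> block_pairs S" using p_eq IJ by (auto simp: block_pairs_def)
  have Un: "\<Union>(P - {p}) = \<Union>P - {I, J}"
  proof -
    have "q \<inter> p = {}" if "q \<in> P - {p}" for q
      using dP that p by (auto simp: disjoint_def)
    then have "\<Union>(P - {p}) \<inter> p = {}" by blast
    moreover have "\<Union>P = \<Union>(P - {p}) \<union> p" using p by blast
    ultimately have "\<Union>(P - {p}) = \<Union>P - p" by blast
    then show ?thesis by (simp only: p_eq)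
  qed
  have "partition_on (S - \<Union>p) (\<Union>(P - {p}))"
  proof (rule partition_onI)
    show "\<Union>(\<Union>(P - {p})) = S - \<Union>p"
    proof
      show "\<Union>(\<Union>(P - {p})) \<subseteq> S - \<Union>p"
      proof
        fix x assume "x \<in> \<Union>(\<Union>(P - {p}))"
        then obtain X where X: "x \<in> X" "X \<in> \<Union>P" "X \<noteq> I" "X \<noteq> J" unfolding Un by blast
        have "x \<in> S" using X partition_onD1[OF part] by blast
        moreover have "x \<notin> I" "x \<notin> J" using dU[OF X(2) IJ'(1)] dU[OF X(2) IJ'(2)] X by blast+
        ultimately show "x \<in> S - \<Union>p" by (simp add: p_eq)
      qed
      show "S - \<Union>p \<subseteq> \<Union>(\<Union>(P - {p}))"
        unfolding Un p_eq using part by (auto simp: partition_on_def)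
    qed
    show "{} \<notin> \<Union>(P - {p})" using part by (auto simp: partition_on_def)
    show "disjnt X Y" if "X \<in> \<Union>(P - {p})" "Y \<in> \<Union>(P - {p})" "X \<noteq> Y" for X Y
      using that dU[of X Y] by (auto simp: disjnt_def)
  qed
  moreover have "disjoint (P - {p})" using dP by (auto simp: disjoint_def)
  ultimately show "P - {p} \<in> pairings_on (S - \<Union>p) k"
    using finP cP pairs p by (auto simp: pairings_on_def)
qed

text \<open>
  Both sides count pairings with one marked pair \<open>p\<close>; on the right, \<open>p\<close> has been removed.
\<close>

lemma pairing_sum_Suc:
  assumes S: "finite S"
  shows "of_nat (Suc k) * pairing_sum w S (Suc k)
    = (\<Sum>p\<in>block_pairs S. w p * pairing_sum w (S - \<Union>p) k)"
proof -
  have "of_nat (Suc k) * pairing_sum w S (Suc k)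
      = (\<Sum>P\<in>pairings_on S (Suc k). \<Sum>p\<in>P. \<Prod>p\<in>P. w p)"
    unfolding pairing_sum_def sum_distrib_left
    by (intro sum.cong) (auto simp: pairings_on_def)
  also have "\<dots> = (\<Sum>(P, p)\<in>Sigma (pairings_on S (Suc k)) (\<lambda>P. P). \<Prod>p\<in>P. w p)"
    using pairings_onD(1)[OF _ S] finite_pairings_on[OF S] by (intro sum.Sigma) auto
  also have "\<dots> = (\<Sum>(p, P)\<in>Sigma (block_pairs S) (\<lambda>p. pairings_on (S - \<Union>p) k). w p * (\<Prod>p\<in>P. w p))"
  proof (rule sum.reindex_bij_witness[where
        i = "\<lambda>(p, P). (insert p P, p)" and j = "\<lambda>(P, p). (p, P - {p})"])
    fix x assume "x \<in> Sigma (pairings_on S (Suc k)) (\<lambda>P. P)"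
    then obtain P p where x: "x = (P, p)" "P \<in> pairings_on S (Suc k)" "p \<in> P" by auto
    show "(case case x of (P, p) \<Rightarrow> (p, P - {p}) of (p, P) \<Rightarrow> (insert p P, p)) = x"
      using x by (auto simp: insert_absorb)
    show "(case x of (P, p) \<Rightarrow> (p, P - {p})) \<in> Sigma (block_pairs S) (\<lambda>p. pairings_on (S - \<Union>p) k)"
      using x remove_pair[OF S x(2,3)] by simp
    show "(case case x of (P, p) \<Rightarrow> (p, P - {p}) of (p, P) \<Rightarrow> w p * (\<Prod>p\<in>P. w p))
        = (case x of (P, p) \<Rightarrow> \<Prod>p\<in>P. w p)"
      using x prod.remove[OF pairings_onD(1)[OF x(2) S] x(3), of w] by simp
  next
    fix x assume "x \<in> Sigma (block_pairs S) (\<lambda>p. pairings_on (S - \<Union>p) k)"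
    then obtain P p where x: "x = (p, P)" "p \<in> block_pairs S" "P \<in> pairings_on (S - \<Union>p) k" by auto
    show "(case case x of (p, P) \<Rightarrow> (insert p P, p) of (P, p) \<Rightarrow> (p, P - {p})) = x"
      using x insert_pairing(1)[OF S x(2,3)] by simp
    show "(case x of (p, P) \<Rightarrow> (insert p P, p)) \<in> Sigma (pairings_on S (Suc k)) (\<lambda>P. P)"
      using x insert_pairing(2)[OF S x(2,3)] by simp
  qed
  also have "\<dots> = (\<Sum>p\<in>block_pairs S. w p * pairing_sum w (S - \<Union>p) k)"
    using finite_block_pairs[OF S] finite_pairings_on S
    by (subst sum.Sigma[symmetric]) (auto simp: pairing_sum_def sum_distrib_left)
  finally show ?thesis .
qed

definition halves :: "'e set \<Rightarrow> 'e set set" where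
  "halves T = {I. I \<subseteq> T \<and> card I = card (T - I)}"

text \<open>
  An ordered pair of blocks is a set \<open>T\<close> with one half \<open>I\<close>, and each unordered pair comes from two
  ordered ones.
\<close>

lemma sum_halves_eq_sum_block_pairs:
  fixes w :: "'e set set \<Rightarrow> 'a :: comm_ring_1" and h :: "'e set \<Rightarrow> 'a"
  assumes S: "finite S"
  shows "(\<Sum>T\<in>Pow S - {{}}. (\<Sum>I\<in>halves T. w {I, T - I}) * h T)
    = (\<Sum>p\<in>block_pairs S. 2 * w p * h (\<Union>p))"
proof -
  let ?X = "Sigma (Pow S - {{}}) halves"
  let ?g = "\<lambda>(T, I). {I, T - I}"
  have fin: "finite T" if "T \<in> Pow S" for T using that S by (auto intro: finite_subset)
  have finh: "finite (halves T)" if "T \<in> Pow S" for T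
    using fin[OF that] by (auto simp: halves_def)
  have finX: "finite ?X" using S finh by (intro finite_SigmaI) auto
  have g: "?g x \<in> block_pairs S" if xX: "x \<in> ?X" for x
  proof -
    obtain T I where "x = (T, I)" "T \<in> Pow S - {{}}" "I \<in> halves T" using xX by blast
    then have x: "x = (T, I)" "T \<subseteq> S" "T \<noteq> {}" "I \<subseteq> T" "card I = card (T - I)"
      by (auto simp: halves_def)
    have "finite T" using x fin by auto
    then have fi: "finite I" "finite (T - I)" using x by (auto intro: finite_subset)
    have "card I + card (T - I) = card T"
      using x fi by (metis card_Diff_subset card_mono le_add_diff_inverse \<open>finite T\<close>)
    moreover have "card T > 0" using x \<open>finite T\<close> by (simp add: card_gt_0_iff)
    ultimately have "card I > 0" "card (T - I) > 0" using x(5) by linarith+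
    then have "I \<noteq> {}" "T - I \<noteq> {}" by (metis card.empty less_irrefl)+
    moreover have "I \<inter> (T - I) = {}" "I \<union> (T - I) \<subseteq> S" using x by auto
    ultimately show ?thesis
      unfolding block_pairs_def x(1) prod.case using x(5) by (intro CollectI exI[of _ I] exI[of _ "T - I"] conjI refl)
  qed
  have "(\<Sum>T\<in>Pow S - {{}}. (\<Sum>I\<in>halves T. w {I, T - I}) * h T)
      = (\<Sum>(T, I)\<in>?X. w {I, T - I} * h T)"
    using S finh by (subst sum.Sigma[symmetric]) (auto simp: sum_distrib_right)
  also have "\<dots> = (\<Sum>p\<in>block_pairs S. \<Sum>x\<in>{x \<in> ?X. ?g x = p}. case x of (T, I) \<Rightarrow> w {I, T - I} * h T)"
    using g by (intro sum.group[symmetric] finX finite_block_pairs S) blast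
  also have "\<dots> = (\<Sum>p\<in>block_pairs S. 2 * w p * h (\<Union>p))"
  proof (rule sum.cong)
    fix p assume "p \<in> block_pairs S"
    then obtain I J where p: "p = {I, J}" "I \<noteq> {}" "J \<noteq> {}" "I \<inter> J = {}" "card I = card J" "I \<union> J \<subseteq> S"
      by (auto simp: block_pairs_def)
    have "I \<noteq> J" using p by auto
    have d: "I \<union> J - I = J" "I \<union> J - J = I" using p(4) by auto
    have "{x \<in> ?X. ?g x = p} = {(I \<union> J, I), (I \<union> J, J)}"
    proof (intro subset_antisym subsetI)
      fix x assume x: "x \<in> {x \<in> ?X. ?g x = p}"
      then obtain T K where K: "x = (T, K)" "K \<subseteq> T" "{K, T - K} = {I, J}"
        using p by (auto simp: halves_def)
      then have "T = I \<union> J" by (auto simp: doubleton_eq_iff)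
      moreover have "K = I \<or> K = J" using K by (auto simp: doubleton_eq_iff)
      ultimately show "x \<in> {(I \<union> J, I), (I \<union> J, J)}" using K by auto
    next
      fix x assume "x \<in> {(I \<union> J, I), (I \<union> J, J)}"
      then show "x \<in> {x \<in> ?X. ?g x = p}"
        using p d by (auto simp: halves_def insert_commute)
    qed
    then have "(\<Sum>x\<in>{x \<in> ?X. ?g x = p}. case x of (T, I) \<Rightarrow> w {I, T - I} * h T)
        = w {I, J} * h (I \<union> J) + w {J, I} * h (I \<union> J)"
      using \<open>I \<noteq> J\<close> d by simp
    then show "(\<Sum>x\<in>{x \<in> ?X. ?g x = p}. case x of (T, I) \<Rightarrow> w {I, T - I} * h T) = 2 * w p * h (\<Union>p)"
      using p(1) by (simp add: insert_commute algebra_simps)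
  qed simp
  finally show ?thesis .
qed

lemma Sigma_on_extend:
  assumes "finite S" "card S \<le> K"
  shows "Sigma_on w S = (\<Sum>k\<le>K. of_int ((- 2) ^ k * fact k) * pairing_sum w S k)"
  unfolding Sigma_on_def
proof (rule sum.mono_neutral_left)
  show "\<forall>k\<in>{..K} - {..card S}. of_int ((- 2) ^ k * fact k) * pairing_sum w S k = 0"
    using assms(1) by (simp add: pairing_sum_eq_0)
qed (use assms in auto)

lemma Sigma_on_empty [simp]: "Sigma_on w {} = 1"
  by (simp add: Sigma_on_def pairing_sum_0)

text \<open>
  The factor \<open>k!\<close> turns sets of \<open>k\<close> pairs into sequences, and the power of \<open>2\<close> orders the blocks of
  each pair. Splitting off the first pair of the sequence gives the recursion.
\<close>

lemma Sigma_on_recursion: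
  assumes S: "finite S" "S \<noteq> {}"
  shows "Sigma_on w S = - (\<Sum>T\<in>Pow S - {{}}. (\<Sum>I\<in>halves T. w {I, T - I}) * Sigma_on w (S - T))"
proof -
  obtain K where K: "card S = Suc K" using S by (metis card_gt_0_iff gr0_implies_Suc)
  have step: "of_int ((- 2) ^ Suc k * fact (Suc k)) * pairing_sum w S (Suc k)
      = - (\<Sum>p\<in>block_pairs S. 2 * w p * (of_int ((- 2) ^ k * fact k) * pairing_sum w (S - \<Union>p) k))" for k
  proof -
    have "of_int ((- 2) ^ Suc k * fact (Suc k)) * pairing_sum w S (Suc k)
        = - 2 * of_int ((- 2) ^ k * fact k) * (of_nat (Suc k) * pairing_sum w S (Suc k))"
      by (simp add: algebra_simps)
    also have "\<dots> = - (\<Sum>p\<in>block_pairs S. 2 * w p * (of_int ((- 2) ^ k * fact k) * pairing_sum w (S - \<Union>p) k))"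
      unfolding pairing_sum_Suc[OF S(1)] by (simp add: sum_distrib_left sum_negf mult_ac)
    finally show ?thesis .
  qed
  have le: "card (S - \<Union>p) \<le> K" if pS: "p \<in> block_pairs S" for p
  proof -
    obtain I J where "p = {I, J}" "I \<noteq> {}" "I \<union> J \<subseteq> S"
      using pS unfolding block_pairs_def by (elim CollectE exE conjE) (rule that)
    then have "S - \<Union>p \<subset> S" by auto
    from psubset_card_mono[OF S(1) this] show ?thesis using K by simp
  qed
  have "Sigma_on w S = (\<Sum>k\<le>K. of_int ((- 2) ^ Suc k * fact (Suc k)) * pairing_sum w S (Suc k))"
    unfolding Sigma_on_def K by (subst sum.atMost_Suc_shift) (simp add: pairing_sum_0 S)
  also have "\<dots> = - (\<Sum>p\<in>block_pairs S. 2 * w p *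
      (\<Sum>k\<le>K. of_int ((- 2) ^ k * fact k) * pairing_sum w (S - \<Union>p) k))"
    unfolding step sum_negf sum_distrib_left by (subst sum.swap) simp
  also have "\<dots> = - (\<Sum>p\<in>block_pairs S. 2 * w p * Sigma_on w (S - \<Union>p))"
    using le S by (intro arg_cong[of _ _ uminus] sum.cong refl) (simp add: Sigma_on_extend[of _ K])
  also have "\<dots> = - (\<Sum>T\<in>Pow S - {{}}. (\<Sum>I\<in>halves T. w {I, T - I}) * Sigma_on w (S - T))"
    using sum_halves_eq_sum_block_pairs[OF S(1), of w "\<lambda>T. Sigma_on w (S - T)"] by simp
  finally show ?thesis .
qed

text \<open>
  A convolution inverse of the sums over halves satisfies the recursion above, and the recursion
  determines all values from the one at the empty set.
\<close>

lemma Sigma_on_unique: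
  assumes "finite S" "q {} = 1"
    and "\<And>S. finite S \<Longrightarrow> S \<noteq> {} \<Longrightarrow> (\<Sum>T\<in>Pow S. g T * q (S - T)) = 0"
    and "g {} = 1"
    and "\<And>T. T \<subseteq> S \<Longrightarrow> g T = (\<Sum>I\<in>halves T. w {I, T - I})"
  shows "q S = Sigma_on w S"
  using assms(1,5)
proof (induction "card S" arbitrary: S rule: less_induct)
  case less
  show ?case
  proof (cases "S = {}")
    case True
    then show ?thesis using assms(2) by simp
  next
    case False
    have "0 = (\<Sum>T\<in>Pow S. g T * q (S - T))" using assms(3) less.prems(1) False by simp
    also have "\<dots> = g {} * q (S - {}) + (\<Sum>T\<in>Pow S - {{}}. g T * q (S - T))"
      using less.prems(1) by (intro sum.remove) auto
    finally have "q S = - (\<Sum>T\<in>Pow S - {{}}. g T * q (S - T))"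
      using assms(4) by (simp add: eq_neg_iff_add_eq_0)
    also have "\<dots> = Sigma_on w S"
      unfolding Sigma_on_recursion[OF less.prems(1) False]
    proof (intro arg_cong[of _ _ uminus] sum.cong refl)
      fix T assume T: "T \<in> Pow S - {{}}"
      then have "card (S - T) < card S"
        using less.prems(1) by (intro psubset_card_mono) auto
      then have "q (S - T) = Sigma_on w (S - T)"
        using less.prems by (intro less.hyps) auto
      then show "g T * q (S - T) = (\<Sum>I\<in>halves T. w {I, T - I}) * Sigma_on w (S - T)"
        using less.prems(2) T by simp
    qed
    finally show ?thesis .
  qed
qed

lemma Sigma_poly_eq_Sigma_on:
  "Sigma_poly B es = Sigma_on (pair_minor B es) {0..<length es}"
proof (cases "es = []")
  case False
  have eq: "pairings m k = pairings_on {0..<m} k" for m k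
    by (simp add: pairings_def pairings_on_def)
  have zero: "pairing_sum (pair_minor B es) {0..<length es} k = 0"
    if "k \<in> {..length es} - {1..length es div 2}" for k
  proof (cases "k = 0")
    case True
    then show ?thesis using False by (simp add: pairing_sum_0)
  next
    case False
    then have "length es < 2 * k" using that by auto
    then show ?thesis by (simp add: pairing_sum_eq_0)
  qed
  have "Sigma_on (pair_minor B es) {0..<length es}
      = (\<Sum>k = 1..length es div 2. of_int ((- 2) ^ k * fact k) * pairing_sum (pair_minor B es) {0..<length es} k)"
    unfolding Sigma_on_def
    by (rule sum.mono_neutral_right) (use zero in auto)
  then show ?thesis using False by (simp add: Sigma_poly_def pairing_sum_def eq)
qed (simp add: Sigma_poly_def)

section \<open>Products of square-zero elements with sum zero\<close>

lemma fps_const_sum: "fps_const (\<Sum>i\<in>S. f i) = (\<Sum>i\<in>S. fps_const (f i))"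
  by (rule fps_ext) (simp add: fps_sum_nth)

text \<open>
  For square-zero elements, \<open>1 + X y\<close> is the exponential of \<open>X y\<close>, so that the product is the
  exponential of zero. The proof without exponentials shows that the derivative is zero.
\<close>

lemma prod_one_plus_square_zero:
  fixes y :: "'h \<Rightarrow> 'a :: comm_ring_1"
  assumes torsion: "\<And>k (x :: 'a). k > 0 \<Longrightarrow> of_nat k * x = 0 \<Longrightarrow> x = 0"
    and H: "finite H" and sq: "\<And>h. h \<in> H \<Longrightarrow> y h * y h = 0" and sum: "(\<Sum>h\<in>H. y h) = 0"
  shows "(\<Prod>h\<in>H. 1 + fps_X * fps_const (y h)) = 1"
proof -
  let ?f = "\<lambda>h. 1 + fps_X * fps_const (y h)"
  let ?P = "\<Prod>h\<in>H. ?f h"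
  have "fps_deriv ?P = (\<Sum>h\<in>H. fps_const (y h) * (\<Prod>j\<in>H - {h}. ?f j))"
    by (simp add: fps_deriv_prod[OF H])
  also have "\<dots> = (\<Sum>h\<in>H. fps_const (y h) * ?P)"
  proof (rule sum.cong)
    fix h assume h: "h \<in> H"
    have "fps_const (y h) * ?f h = fps_const (y h) + fps_X * fps_const (y h * y h)"
      by (simp add: algebra_simps flip: fps_const_mult)
    also have "\<dots> = fps_const (y h)" using sq[OF h] by simp
    finally have "fps_const (y h) * ?f h = fps_const (y h)" .
    moreover have "?P = ?f h * (\<Prod>j\<in>H - {h}. ?f j)" by (rule prod.remove[OF H h])
    ultimately show "fps_const (y h) * (\<Prod>j\<in>H - {h}. ?f j) = fps_const (y h) * ?P"
      by (simp only: mult.assoc[symmetric])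
  qed simp
  also have "\<dots> = fps_const (\<Sum>h\<in>H. y h) * ?P"
    by (simp only: sum_distrib_right[symmetric] fps_const_sum)
  also have "\<dots> = 0" by (simp add: sum)
  finally have d: "fps_deriv ?P = 0" .
  have "fps_nth ?P k = (if k = 0 then 1 else 0)" for k
  proof (cases k)
    case 0
    have "fps_nth (\<Prod>h\<in>H. ?f h) 0 = 1" using H by (induction rule: finite_induct) auto
    then show ?thesis using 0 by simp
  next
    case (Suc j)
    have "of_nat (j + 1) * fps_nth ?P (j + 1) = fps_nth (fps_deriv ?P) j" by simp
    then have "of_nat (j + 1) * fps_nth ?P (j + 1) = 0" unfolding d by simp
    then show ?thesis using torsion[of "j + 1"] Suc by simp
  qed
  then show ?thesis by (intro fps_ext) simp
qed

lemma one_plus_factor: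
  fixes p q x :: "'a :: comm_ring_1"
  assumes "p * p = 0" "q * q = 0"
  shows "1 + x * (p + q) = (1 + x * p) * (1 + x * q) * (1 - x ^ 2 * (p * q))"
proof -
  have "(1 + x * p) * (1 + x * q) * (1 - x ^ 2 * (p * q))
      = 1 + x * (p + q) - x ^ 3 * ((p * p) * q + p * (q * q)) - x ^ 4 * ((p * p) * (q * q))"
    by (simp add: algebra_simps power2_eq_square power3_eq_cube power4_eq_xxxx)
  then show ?thesis unfolding assms by simp
qed

text \<open>
  Compare the coefficients of \<open>X ^ card T\<close> in
  \<open>\<Prod>(1 + X (p + q)) = \<Prod>(1 + X p) (1 + X q) (1 - X\<^sup>2 p q) = \<Prod>(1 - X\<^sup>2 p q)\<close>,
  where the last step is the lemma on square-zero elements.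
\<close>

lemma prod_sums_eq_sum_prods:
  fixes p q :: "'e \<Rightarrow> 'a :: comm_ring_1"
  assumes torsion: "\<And>k (x :: 'a). k > 0 \<Longrightarrow> of_nat k * x = 0 \<Longrightarrow> x = 0"
    and T: "finite T" and sq: "\<And>e. e \<in> T \<Longrightarrow> p e * p e = 0" "\<And>e. e \<in> T \<Longrightarrow> q e * q e = 0"
    and sum: "(\<Sum>e\<in>T. p e + q e) = 0"
  shows "(\<Prod>e\<in>T. p e + q e) = (\<Sum>D\<in>halves T. (- 1) ^ card D * (\<Prod>e\<in>D. p e * q e))"
proof -
  let ?X = "fps_X :: 'a fps"
  have "(\<Prod>h\<in>T <+> T. 1 + ?X * fps_const (case_sum p q h)) = 1"
    by (rule prod_one_plus_square_zero[OF torsion])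
      (use T sq sum in \<open>auto simp: sum.Plus sum.distrib\<close>)
  then have one: "(\<Prod>e\<in>T. (1 + ?X * fps_const (p e)) * (1 + ?X * fps_const (q e))) = 1"
    using T by (simp add: prod.Plus prod.distrib)
  have fac: "1 + ?X * fps_const (p e + q e)
      = (1 + ?X * fps_const (p e)) * (1 + ?X * fps_const (q e)) * (1 + ?X ^ 2 * fps_const (- (p e * q e)))"
    if "e \<in> T" for e
  proof -
    let ?p = "fps_const (p e)" and ?q = "fps_const (q e)"
    have pp: "?p * ?p = 0" and qq: "?q * ?q = 0" using sq that by (auto simp: fps_const_mult)
    from one_plus_factor[OF pp qq, of ?X] show ?thesis
      by (simp flip: fps_const_mult fps_const_neg)
  qed
  have "(\<Prod>e\<in>T. p e + q e) = fps_nth (\<Prod>e\<in>T. 1 + ?X * fps_const (p e + q e)) (card T)"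
    using fps_nth_prod_linear(2)[OF T, of "\<lambda>_. 1" "\<lambda>e. p e + q e"] by simp
  also have "(\<Prod>e\<in>T. 1 + ?X * fps_const (p e + q e)) = (\<Prod>e\<in>T. 1 + ?X ^ 2 * fps_const (- (p e * q e)))"
    using fac one by (simp add: prod.distrib)
  also have "\<dots> = (\<Prod>e\<in>T. ?X ^ 2 * fps_const (- (p e * q e)) + 1)"
    by (simp add: add.commute)
  also have "\<dots> = (\<Sum>D\<in>Pow T. ?X ^ (2 * card D) * fps_const ((- 1) ^ card D * (\<Prod>e\<in>D. p e * q e)))"
  proof (subst prod_add[OF T], intro sum.cong refl)
    fix D assume "D \<in> Pow T"
    then have "finite D" using T by (auto intro: finite_subset)
    then have "(\<Prod>e\<in>D. fps_const (- (p e * q e))) = fps_const ((- 1) ^ card D * (\<Prod>e\<in>D. p e * q e))"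
      by (induction rule: finite_induct) (auto simp: mult_ac simp del: fps_const_neg)
    then show "(\<Prod>e\<in>D. ?X ^ 2 * fps_const (- (p e * q e))) * (\<Prod>e\<in>T - D. 1)
        = ?X ^ (2 * card D) * fps_const ((- 1) ^ card D * (\<Prod>e\<in>D. p e * q e))"
      by (simp add: prod.distrib power_mult del: fps_const_neg)
  qed
  also have "fps_nth \<dots> (card T)
      = (\<Sum>D\<in>Pow T. if 2 * card D = card T then (- 1) ^ card D * (\<Prod>e\<in>D. p e * q e) else 0)"
    unfolding fps_sum_nth by (intro sum.cong refl) (auto simp: fps_X_power_mult_nth)
  also have "\<dots> = (\<Sum>D\<in>halves T. (- 1) ^ card D * (\<Prod>e\<in>D. p e * q e))"
  proof -
    have "halves T = {D \<in> Pow T. 2 * card D = card T}"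
    proof -
      have "D \<in> halves T \<longleftrightarrow> D \<in> {D \<in> Pow T. 2 * card D = card T}" for D
      proof (cases "D \<subseteq> T")
        case True
        then have "finite D" "card D \<le> card T" using T by (auto intro: finite_subset card_mono)
        then show ?thesis using True by (auto simp: halves_def card_Diff_subset)
      qed (simp add: halves_def)
      then show ?thesis by blast
    qed
    then show ?thesis using T by (simp only:) (rule sum.inter_filter[symmetric], simp)
  qed
  finally show ?thesis .
qed

section \<open>Determinants from products of one-forms\<close>

text \<open>
  The usual step in expanding a product of linear combinations of forms: maps that are not injective
  repeat a form and contribute nothing.
\<close>

lemma sum_PiE_permutes:
  fixes F :: "('e \<Rightarrow> 'e) \<Rightarrow> 'a :: comm_monoid_add"
  assumes S: "finite S"
    and zero: "\<And>f. f \<in> PiE S (\<lambda>_. S) \<Longrightarrow> \<not> inj_on f S \<Longrightarrow> F f = 0"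
  shows "(\<Sum>f\<in>PiE S (\<lambda>_. S). F f) = (\<Sum>p | p permutes S. F (restrict p S))"
proof -
  have "(\<Sum>f\<in>PiE S (\<lambda>_. S). F f) = (\<Sum>f | f \<in> PiE S (\<lambda>_. S) \<and> inj_on f S. F f)"
    using S zero by (intro sum.mono_neutral_right) (auto intro: finite_PiE)
  also have "\<dots> = (\<Sum>p | p permutes S. F (restrict p S))"
  proof (rule sum.reindex_bij_witness[where
        i = "\<lambda>p. restrict p S" and j = "perm_restrict S"])
    fix f assume "f \<in> {f. f \<in> PiE S (\<lambda>_. S) \<and> inj_on f S}"
    then have f: "f \<in> PiE S (\<lambda>_. S)" "inj_on f S" by auto
    show *: "restrict (perm_restrict S f) S = f"
      using f by (auto simp: perm_restrict_def restrict_def PiE_def extensional_def)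
    show "perm_restrict S f \<in> {p. p permutes S}"
      using perm_restrict_permutes_inj[OF S f] by simp
    show "F (restrict (perm_restrict S f) S) = F f" by (simp add: *)
  next
    fix p assume "p \<in> {p. p permutes S}"
    then have p: "p permutes S" by simp
    show "perm_restrict S (restrict p S) = p"
      using permutes_not_in[OF p] by (auto simp: perm_restrict_def fun_eq_iff)
    show "restrict p S \<in> {f. f \<in> PiE S (\<lambda>_. S) \<and> inj_on f S}"
      using p permutes_inj_on[OF p] by (auto simp: permutes_in_image)
  qed
  finally show ?thesis .
qed

lemma prod_sum_wedge_eq_det:
  fixes a c :: "'i \<Rightarrow> ('g :: linorder, 'r :: comm_ring_1) extalg"
  assumes S: "finite S"
    and odd: "\<And>i. i \<in> S \<Longrightarrow> odd_form (a i)" "\<And>i. i \<in> S \<Longrightarrow> odd_form (c i)"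
    and sq: "\<And>i. i \<in> S \<Longrightarrow> c i * c i = 0"
  shows "(\<Prod>i\<in>S. \<Sum>j\<in>S. even_const (\<beta> i j) * wedge (a i) (c j))
    = even_const (det_on S \<beta>) * (\<Prod>i\<in>S. wedge (a i) (c i))"
proof -
  have "(\<Prod>i\<in>S. \<Sum>j\<in>S. even_const (\<beta> i j) * wedge (a i) (c j))
      = (\<Sum>f\<in>PiE S (\<lambda>_. S). \<Prod>i\<in>S. even_const (\<beta> i (f i)) * wedge (a i) (c (f i)))"
    using S by (intro prod_sum_PiE) auto
  also have "\<dots> = (\<Sum>p | p permutes S.
      \<Prod>i\<in>S. even_const (\<beta> i (restrict p S i)) * wedge (a i) (c (restrict p S i)))"
  proof (rule sum_PiE_permutes[OF S])
    fix f assume f: "f \<in> PiE S (\<lambda>_. S)" "\<not> inj_on f S"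
    then obtain u v where uv: "u \<in> S" "v \<in> S" "u \<noteq> v" "f u = f v" by (auto simp: inj_on_def)
    have fu: "f u \<in> S" using f uv by auto
    have "wedge (a u) (c (f u)) * wedge (a v) (c (f v)) = 0"
      using uv fu odd sq by (simp add: wedge_mult_eq_0)
    then have "(\<Prod>i\<in>S. wedge (a i) (c (f i))) = 0" by (rule prod_eq_0_if_pair[OF S uv(1-3)])
    then show "(\<Prod>i\<in>S. even_const (\<beta> i (f i)) * wedge (a i) (c (f i))) = 0"
      by (simp add: prod.distrib)
  qed
  also have "\<dots> = (\<Sum>p | p permutes S. even_const (of_int (sign p) * (\<Prod>i\<in>S. \<beta> i (p i))) * (\<Prod>i\<in>S. wedge (a i) (c i)))"
  proof (rule sum.cong)
    fix p assume "p \<in> {p. p permutes S}"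
    then show "(\<Prod>i\<in>S. even_const (\<beta> i (restrict p S i)) * wedge (a i) (c (restrict p S i)))
        = even_const (of_int (sign p) * (\<Prod>i\<in>S. \<beta> i (p i))) * (\<Prod>i\<in>S. wedge (a i) (c i))"
      using prod_wedge_permute[OF S, of p a c] odd
      by (simp add: prod.distrib even_const_mult even_const.hom_prod even_const_of_int mult_ac)
  qed simp
  also have "\<dots> = even_const (det_on S \<beta>) * (\<Prod>i\<in>S. wedge (a i) (c i))"
    by (simp add: det_on_def even_const.hom_sum sum_distrib_right)
  finally show ?thesis .
qed

text \<open>
  A term that contains some \<open>w i\<close> has order larger than \<open>card S\<close>, hence larger than the number of
  generators in \<open>F\<close>.
\<close>

lemma prod_perturb:
  fixes u w :: "'i \<Rightarrow> ('g :: linorder, 'r :: comm_ring_1) evenalg"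
  assumes S: "finite S"
    and u: "\<And>i. i \<in> S \<Longrightarrow> order_ge F 1 (form_of (u i))"
    and w: "\<And>i. i \<in> S \<Longrightarrow> order_ge F 2 (form_of (w i))"
    and F: "finite F" "card F \<le> card S"
  shows "(\<Prod>i\<in>S. u i + w i) = (\<Prod>i\<in>S. u i)"
proof -
  have "order_ge F (card S) (form_of (\<Prod>i\<in>S. u i)) \<and>
      order_ge F (card S + 1) (form_of ((\<Prod>i\<in>S. u i + w i) - (\<Prod>i\<in>S. u i)))"
    using S u w
  proof (induction rule: finite_induct)
    case empty
    show ?case by (simp add: zero_evenalg.rep_eq)
  next
    case (insert x S)
    let ?P = "\<Prod>i\<in>S. u i" and ?Q = "\<Prod>i\<in>S. u i + w i"
    have IH: "order_ge F (card S) (form_of ?P)" "order_ge F (card S + 1) (form_of (?Q - ?P))"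
      using insert by auto
    have ux: "order_ge F 1 (form_of (u x))" and wx: "order_ge F 2 (form_of (w x))"
      using insert.prems by auto
    have "order_ge F (card S) (form_of ?Q)"
      using order_ge_add[OF IH(1) order_ge_mono[OF IH(2)], of] by (simp add: plus_evenalg.rep_eq[symmetric])
    then have "order_ge F (2 + card S) (form_of (w x) * form_of ?Q)"
      by (rule order_ge_mult[OF wx])
    moreover have "order_ge F (1 + (card S + 1)) (form_of (u x) * form_of (?Q - ?P))"
      by (rule order_ge_mult[OF ux IH(2)])
    ultimately have "order_ge F (card S + 2) (form_of (u x * (?Q - ?P) + w x * ?Q))"
      by (simp add: plus_evenalg.rep_eq times_evenalg.rep_eq order_ge_add)
    moreover have "(\<Prod>i\<in>insert x S. u i + w i) - (\<Prod>i\<in>insert x S. u i) = u x * (?Q - ?P) + w x * ?Q"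
      using insert by (simp add: algebra_simps)
    moreover have "order_ge F (1 + card S) (form_of (u x * ?P))"
      unfolding times_evenalg.rep_eq by (rule order_ge_mult[OF ux IH(1)])
    ultimately show ?case using insert by simp
  qed
  then have "form_of ((\<Prod>i\<in>S. u i + w i) - (\<Prod>i\<in>S. u i)) = 0"
    using order_ge_imp_zero[OF _ F(1)] F(2) by fastforce
  then have "(\<Prod>i\<in>S. u i + w i) - (\<Prod>i\<in>S. u i) = 0"
    by (intro form_of_eqI) (simp add: zero_evenalg.rep_eq)
  then show ?thesis by simp
qed

lemma order_ge_wedge:
  assumes "odd_form a" "odd_form c" "order_ge F d a" "order_ge F e c"
  shows "order_ge F (d + e) (form_of (wedge a c))"
  using assms by (simp add: form_of_wedge order_ge_mult)

lemma order_ge_wedge_gen: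
  assumes "g \<in> F"
  shows "odd_form c \<Longrightarrow> order_ge F 1 (form_of (wedge (ext_gen g) c))"
    and "h \<in> F \<Longrightarrow> order_ge F 2 (form_of (wedge (ext_gen g) (ext_gen h)))"
  using order_ge_wedge[of "ext_gen g" c F 1 0] order_ge_wedge[of "ext_gen g" "ext_gen h" F 1 1]
    order_ge_gen[OF assms] order_ge_gen[of h F]
  by (simp_all add: numeral_2_eq_2)

lemma order_ge_even_const_mult:
  "order_ge F d (form_of x) \<Longrightarrow> order_ge F d (form_of (even_const c * x))"
  by (simp add: times_evenalg.rep_eq order_ge_mult_left)

text \<open>
  The wedge of a generator \<open>h\<close> with its image under a bilinear form \<open>\<beta>\<close> on the generators in \<open>H\<close>. These
  elements square to zero, they add up to zero if \<open>\<beta>\<close> is symmetric, and the product of half of them is a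
  minor of \<open>\<beta>\<close> times all generators, up to sign. They allow linear relations between minors of
  different shapes to be derived in a commutative ring.
\<close>

definition contraction :: "('g \<Rightarrow> 'g \<Rightarrow> 'r) \<Rightarrow> 'g set \<Rightarrow> 'g \<Rightarrow> ('g :: linorder, 'r :: comm_ring_1) evenalg" where
  "contraction \<beta> H h = (\<Sum>h'\<in>H. even_const (\<beta> h h') * wedge (ext_gen h) (ext_gen h'))"

lemma order_ge_contraction:
  "h \<in> F \<Longrightarrow> order_ge F 1 (form_of (contraction \<beta> H h))"
  unfolding contraction_def form_of_sum
  by (intro order_ge_sum order_ge_even_const_mult order_ge_wedge_gen(1)) simp_all

lemma contraction_square: "contraction \<beta> H h * contraction \<beta> H h = 0"
proof (rule form_of_eqI)
  have "order_ge {h} (1 + 1) (form_of (contraction \<beta> H h) * form_of (contraction \<beta> H h))"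
    by (intro order_ge_mult order_ge_contraction) simp_all
  then show "form_of (contraction \<beta> H h * contraction \<beta> H h) = form_of 0"
    unfolding times_evenalg.rep_eq zero_evenalg.rep_eq by (rule order_ge_imp_zero) simp_all
qed

lemma sum_contraction:
  fixes \<beta> :: "'g :: linorder \<Rightarrow> 'g \<Rightarrow> 'r :: comm_ring_1"
  assumes torsion: "\<And>x :: 'r. of_nat 2 * x = 0 \<Longrightarrow> x = 0"
    and sym: "\<And>h h'. \<beta> h h' = \<beta> h' h"
  shows "(\<Sum>h\<in>H. contraction \<beta> H h) = 0"
proof (rule of_nat_mult_evenalg_eq_0[OF torsion])
  let ?s = "\<Sum>h\<in>H. contraction \<beta> H h"
  have "?s = (\<Sum>h'\<in>H. \<Sum>h\<in>H. even_const (\<beta> h h') * wedge (ext_gen h) (ext_gen h'))"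
    unfolding contraction_def by (rule sum.swap)
  also have "\<dots> = (\<Sum>h'\<in>H. \<Sum>h\<in>H. - (even_const (\<beta> h' h) * wedge (ext_gen h') (ext_gen h)))"
  proof (intro sum.cong refl)
    fix h h'
    show "even_const (\<beta> h h') * wedge (ext_gen h) (ext_gen h')
        = - (even_const (\<beta> h' h) * wedge (ext_gen h') (ext_gen h))"
      by (subst wedge_flip[of "ext_gen h'" "ext_gen h"]) (auto simp: sym[of h h'])
  qed
  also have "\<dots> = - ?s" by (simp add: contraction_def sum_negf)
  finally have "?s + ?s = 0" by (rule eq_neg_iff_add_eq_0[THEN iffD1])
  then show "of_nat 2 * ?s = 0" unfolding of_nat_numeral mult_2 .
qed

text \<open>
  The generators in \<open>R\<close> are already used up by the first factors, so only images outside of \<open>R\<close>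
  contribute.
\<close>

lemma prod_contraction:
  assumes H: "finite H" and S: "finite S" and R: "R \<subseteq> H"
    and \<kappa>: "bij_betw \<kappa> S R" and \<mu>: "bij_betw \<mu> S (H - R)"
  shows "(\<Prod>h\<in>R. contraction \<beta> H h)
    = even_const (det_on S (\<lambda>i j. \<beta> (\<kappa> i) (\<mu> j))) * (\<Prod>i\<in>S. wedge (ext_gen (\<kappa> i)) (ext_gen (\<mu> i)))"
proof -
  let ?t = "\<lambda>h h'. even_const (\<beta> h h') * wedge (ext_gen h) (ext_gen h')"
  have finR: "finite R" using H R by (rule finite_subset[rotated])
  have \<kappa>R: "\<kappa> i \<in> R" if "i \<in> S" for i using \<kappa> that by (auto simp: bij_betw_def)
  have "(\<Prod>h\<in>R. contraction \<beta> H h) = (\<Prod>i\<in>S. contraction \<beta> H (\<kappa> i))"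
    using \<kappa> by (rule prod.reindex_bij_betw[symmetric])
  also have "\<dots> = (\<Prod>i\<in>S. (\<Sum>h'\<in>H - R. ?t (\<kappa> i) h') + (\<Sum>h'\<in>R. ?t (\<kappa> i) h'))"
    unfolding contraction_def by (intro prod.cong refl sum.subset_diff[OF R H])
  also have "\<dots> = (\<Prod>i\<in>S. \<Sum>h'\<in>H - R. ?t (\<kappa> i) h')"
  proof (rule prod_perturb[OF S _ _ finR])
    fix i assume i: "i \<in> S"
    show "order_ge R 1 (form_of (\<Sum>h'\<in>H - R. ?t (\<kappa> i) h'))"
      unfolding form_of_sum
      using \<kappa>R[OF i] by (intro order_ge_sum order_ge_even_const_mult order_ge_wedge_gen(1)) simp_all
    show "order_ge R 2 (form_of (\<Sum>h'\<in>R. ?t (\<kappa> i) h'))"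
      unfolding form_of_sum
      using \<kappa>R[OF i] by (intro order_ge_sum order_ge_even_const_mult order_ge_wedge_gen(2)) simp_all
  next
    show "card R \<le> card S" using bij_betw_same_card[OF \<kappa>] by simp
  qed
  also have "\<dots> = (\<Prod>i\<in>S. \<Sum>j\<in>S. ?t (\<kappa> i) (\<mu> j))"
    using \<mu> by (intro prod.cong refl sum.reindex_bij_betw[symmetric])
  also have "\<dots> = even_const (det_on S (\<lambda>i j. \<beta> (\<kappa> i) (\<mu> j))) * (\<Prod>i\<in>S. wedge (ext_gen (\<kappa> i)) (ext_gen (\<mu> i)))"
    by (rule prod_sum_wedge_eq_det[OF S]) (simp_all add: ext_gen_square)
  finally show ?thesis .
qed

section \<open>Orientation sums as sums of minors\<close>

text \<open>
  The half-edges at \<open>I\<close> are numbered edge by edge in increasing order, the one at \<open>s e\<close> before the one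
  at \<open>t e\<close>; this is the order in which the minors list the ends. As generators, the
  half-edges of \<open>e\<close> are \<open>Pos e 0\<close> and \<open>Pos e 1\<close>.
\<close>

definition half_end :: "(nat \<Rightarrow> 'v) \<Rightarrow> (nat \<Rightarrow> 'v) \<Rightarrow> nat set \<Rightarrow> nat \<Rightarrow> 'v" where
  "half_end s t I i = (if even i then s else t) (sorted_list_of_set I ! (i div 2))"

definition half_edges :: "nat set \<Rightarrow> position set" where
  "half_edges I = (\<lambda>(e, i). Pos e i) ` (I \<times> {0, 1})"

lemma bij_betw_half_edges:
  assumes "finite I"
  shows "bij_betw (\<lambda>i. Pos (sorted_list_of_set I ! (i div 2)) (i mod 2)) {0..<2 * card I} (half_edges I)"
proof (rule bij_betw_imageI)
  let ?L = "sorted_list_of_set I"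
  let ?f = "\<lambda>i. Pos (?L ! (i div 2)) (i mod 2)"
  have len: "length ?L = card I" using assms by simp
  show "inj_on ?f {0..<2 * card I}"
  proof (rule inj_onI)
    fix i j assume ij: "i \<in> {0..<2 * card I}" "j \<in> {0..<2 * card I}" "?f i = ?f j"
    then have "?L ! (i div 2) = ?L ! (j div 2)" "i mod 2 = j mod 2" by auto
    moreover have "i div 2 < length ?L" "j div 2 < length ?L" using ij len by auto
    ultimately have "i div 2 = j div 2" by (simp add: nth_eq_iff_index_eq)
    then show "i = j" using \<open>i mod 2 = j mod 2\<close> by (metis div_mult_mod_eq)
  qed
  show "?f ` {0..<2 * card I} = half_edges I"
  proof (intro subset_antisym subsetI)
    fix x assume "x \<in> ?f ` {0..<2 * card I}"
    then obtain i where i: "i < 2 * card I" "x = ?f i" by auto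
    then have "?L ! (i div 2) \<in> set ?L" using len by (intro nth_mem) auto
    then have "?L ! (i div 2) \<in> I" using assms by simp
    moreover have "i mod 2 = 0 \<or> i mod 2 = 1" by auto
    ultimately show "x \<in> half_edges I" unfolding half_edges_def i(2)
      by (intro image_eqI[of _ _ "(?L ! (i div 2), i mod 2)"]) auto
  next
    fix x assume "x \<in> half_edges I"
    then obtain e j where x: "x = Pos e j" "e \<in> I" "j \<in> {0, 1}" by (auto simp: half_edges_def)
    then obtain l where l: "l < card I" "?L ! l = e"
      using assms len by (metis in_set_conv_nth set_sorted_list_of_set)
    have "(2 * l + j) div 2 = l" "(2 * l + j) mod 2 = j" using x(3) by auto
    then have "x = ?f (2 * l + j)" using x l by simp
    moreover have "2 * l + j < 2 * card I" using x(3) l by auto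
    ultimately show "x \<in> ?f ` {0..<2 * card I}" by (intro image_eqI[of _ _ "2 * l + j"]) simp_all
  qed
qed

lemma prod_double: "(\<Prod>i = 0..<2 * k. f i) = (\<Prod>l = 0..<k. f (2 * l) * f (2 * l + 1))"
  for f :: "nat \<Rightarrow> 'a :: comm_monoid_mult"
  by (induction k) (simp_all add: mult.assoc)

lemma wedge_pair:
  assumes "odd_form a" "odd_form b" "odd_form c" "odd_form d"
  shows "wedge a c * wedge b d = - (wedge a b * wedge c d)"
proof -
  have "wedge a c * wedge b d = - (wedge a c * wedge d b)"
    using wedge_flip[OF assms(2,4)] by simp
  also have "\<dots> = wedge a b * wedge d c" using wedge_exchange[OF assms(1,4,3,2)] by simp
  also have "\<dots> = - (wedge a b * wedge c d)" using wedge_flip[OF assms(3,4)] by simp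
  finally show ?thesis .
qed

text \<open>
  Take one contraction \<open>y\<close> for each half-edge. The product over all edges of the sum of the two
  contractions of an edge expands into the sum over orientations; the product of both contractions
  of each edge in one half of \<open>T\<close> is the minor of that half against the other. The two are related by
  the identity for square-zero elements with sum zero. The signs agree: \<open>(- 1) ^ card I\<close> occurs once in
  that identity and once in pairing the generators of the two halves.
\<close>

lemma orient_det_eq_sum_minors:
  fixes b :: "'v \<Rightarrow> 'v \<Rightarrow> 'r :: comm_ring_1" and T :: "nat set"
  assumes torsion: "\<And>k (x :: 'r). k > 0 \<Longrightarrow> of_nat k * x = 0 \<Longrightarrow> x = 0"
    and sym: "\<And>u v. b u v = b v u" and T: "finite T"
  shows "orient_det b s t T = (\<Sum>I\<in>halves T.
    det_on {0..<2 * card I} (\<lambda>i j. b (half_end s t I i) (half_end s t (T - I) j)))"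
proof -
  define v where "v = (\<lambda>g. case g of Pos e i \<Rightarrow> if i = 0 then s e else t e)"
  define H where "H = half_edges T"
  define \<beta> where "\<beta> = (\<lambda>g h. b (v g) (v h))"
  define y :: "position \<Rightarrow> (position, 'r) evenalg" where "y = contraction \<beta> H"
  define z :: "nat \<Rightarrow> (position, 'r) evenalg"
    where "z = (\<lambda>e. wedge (ext_gen (Pos e 0)) (ext_gen (Pos e 1)))"
  \<comment> \<open>The product of all half-edges, which can be cancelled.\<close>
  define Z where "Z = (\<Prod>e\<in>T. z e)"
  define minor where "minor = (\<lambda>I. det_on {0..<2 * card I} (\<lambda>i j. b (half_end s t I i) (half_end s t (T - I) j)))"
  have H: "finite H" using T by (simp add: H_def half_edges_def)
  have orient: "(\<Prod>e\<in>T. y (Pos e (if e \<in> O' then 1 else 0)))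
      = even_const ((- 1) ^ card O' * det_on T (\<lambda>e f. b (flipped s t O' e) (flipped t s O' f))) * Z"
    if O': "O' \<in> Pow T" for O'
  proof -
    \<comment> \<open>The half-edges at the starts and at the ends of the oriented edges.\<close>
    define \<kappa> where "\<kappa> = (\<lambda>e. Pos e (if e \<in> O' then 1 else 0))"
    define \<mu> where "\<mu> = (\<lambda>e. Pos e (if e \<in> O' then 0 else 1))"
    define R where "R = \<kappa> ` T"
    have \<kappa>: "bij_betw \<kappa> T R" by (auto simp: bij_betw_def R_def \<kappa>_def inj_on_def)
    have HR: "H - R = \<mu> ` T"
      by (auto simp: H_def half_edges_def R_def \<kappa>_def \<mu>_def image_iff split: if_splits)
    then have \<mu>: "bij_betw \<mu> T (H - R)" by (auto simp: bij_betw_def \<mu>_def inj_on_def)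
    have RH: "R \<subseteq> H" by (auto simp: H_def half_edges_def R_def \<kappa>_def image_iff)
    have "(\<Prod>e\<in>T. y (\<kappa> e)) = (\<Prod>h\<in>R. y h)" using \<kappa> by (rule prod.reindex_bij_betw)
    also have "\<dots> = even_const (det_on T (\<lambda>e f. \<beta> (\<kappa> e) (\<mu> f))) * (\<Prod>e\<in>T. wedge (ext_gen (\<kappa> e)) (ext_gen (\<mu> e)))"
      unfolding y_def by (rule prod_contraction[OF H T RH \<kappa> \<mu>])
    also have "det_on T (\<lambda>e f. \<beta> (\<kappa> e) (\<mu> f)) = det_on T (\<lambda>e f. b (flipped s t O' e) (flipped t s O' f))"
      by (rule det_on_cong) (simp add: \<beta>_def v_def \<kappa>_def \<mu>_def flipped_def)
    also have "(\<Prod>e\<in>T. wedge (ext_gen (\<kappa> e)) (ext_gen (\<mu> e))) = (\<Prod>e\<in>T. (if e \<in> O' then - 1 else 1) * z e)"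
    proof (intro prod.cong refl)
      fix e
      have "wedge (ext_gen (Pos e 1)) (ext_gen (Pos e 0)) = - z e"
        unfolding z_def by (rule wedge_flip) simp_all
      then show "wedge (ext_gen (\<kappa> e)) (ext_gen (\<mu> e)) = (if e \<in> O' then - 1 else 1) * z e"
        unfolding \<kappa>_def \<mu>_def by (cases "e \<in> O'") (simp_all only: if_True if_False z_def mult_minus1 mult_1)
    qed
    also have "\<dots> = (- 1) ^ card O' * Z"
    proof -
      have "(\<Prod>e\<in>T. if e \<in> O' then - 1 else (1 :: (position, 'r) evenalg)) = (- 1) ^ card O'"
        using T O' by (subst prod.inter_filter[symmetric]) (auto simp: Int_absorb1 Collect_conj_eq)
      then show ?thesis by (simp add: prod.distrib Z_def)
    qed
    finally show ?thesis
      unfolding \<kappa>_def by (simp add: even_const_mult even_const.hom_power even_const.hom_uminus mult_ac)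
  qed
  have "(\<Prod>e\<in>T. y (Pos e 1) + y (Pos e 0)) = (\<Sum>O'\<in>Pow T. \<Prod>e\<in>T. y (Pos e (if e \<in> O' then 1 else 0)))"
    unfolding prod_add[OF T]
  proof (rule sum.cong)
    fix O' assume O': "O' \<in> Pow T"
    have "(\<Prod>e\<in>T. y (Pos e (if e \<in> O' then 1 else 0)))
        = (\<Prod>e\<in>T - O'. y (Pos e (if e \<in> O' then 1 else 0))) * (\<Prod>e\<in>O'. y (Pos e (if e \<in> O' then 1 else 0)))"
      using O' T by (intro prod.subset_diff) auto
    then show "(\<Prod>e\<in>O'. y (Pos e 1)) * (\<Prod>e\<in>T - O'. y (Pos e 0))
        = (\<Prod>e\<in>T. y (Pos e (if e \<in> O' then 1 else 0)))"
      by (simp add: mult.commute cong: prod.cong_simp)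
  qed simp
  also have "\<dots> = even_const (orient_det b s t T) * Z"
    using orient by (simp add: orient_det_def even_const.hom_sum sum_distrib_right)
  finally have lhs: "(\<Prod>e\<in>T. y (Pos e 0) + y (Pos e 1)) = even_const (orient_det b s t T) * Z"
    by (simp add: add.commute)
  have half: "(\<Prod>e\<in>I. y (Pos e 0) * y (Pos e 1)) = even_const ((- 1) ^ card I * minor I) * Z"
    if "I \<in> halves T" for I
  proof -
    define J where "J = T - I"
    have I: "I \<subseteq> T" and cJ: "card J = card I" using that by (auto simp: halves_def J_def)
    have fin: "finite I" "finite J" using T I by (auto simp: J_def intro: finite_subset)
    define k where "k = card I"
    define \<kappa> where "\<kappa> = (\<lambda>i. Pos (sorted_list_of_set I ! (i div 2)) (i mod 2))"
    define \<mu> where "\<mu> = (\<lambda>i. Pos (sorted_list_of_set J ! (i div 2)) (i mod 2))"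
    have \<kappa>: "bij_betw \<kappa> {0..<2 * k} (half_edges I)"
      unfolding \<kappa>_def k_def by (rule bij_betw_half_edges[OF fin(1)])
    have "bij_betw \<mu> {0..<2 * k} (half_edges J)"
      using bij_betw_half_edges[OF fin(2)] by (simp add: \<mu>_def k_def cJ)
    moreover have "half_edges J = H - half_edges I"
      using I by (auto simp: half_edges_def H_def J_def)
    ultimately have \<mu>: "bij_betw \<mu> {0..<2 * k} (H - half_edges I)" by simp
    have RH: "half_edges I \<subseteq> H" using I by (auto simp: half_edges_def H_def)
    have "(\<Prod>e\<in>I. y (Pos e 0) * y (Pos e 1)) = (\<Prod>(e, i)\<in>I \<times> {0, 1}. y (Pos e i))"
      by (simp add: prod.cartesian_product[symmetric])
    also have "\<dots> = (\<Prod>h\<in>half_edges I. y h)"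
      unfolding half_edges_def by (subst prod.reindex) (auto simp: inj_on_def case_prod_unfold)
    also have "\<dots> = even_const (det_on {0..<2 * k} (\<lambda>i j. \<beta> (\<kappa> i) (\<mu> j)))
        * (\<Prod>i = 0..<2 * k. wedge (ext_gen (\<kappa> i)) (ext_gen (\<mu> i)))"
      unfolding y_def by (rule prod_contraction[OF H _ RH \<kappa> \<mu>]) simp
    also have "det_on {0..<2 * k} (\<lambda>i j. \<beta> (\<kappa> i) (\<mu> j)) = minor I"
      unfolding minor_def k_def
      by (rule det_on_cong) (auto simp: \<beta>_def v_def \<kappa>_def \<mu>_def half_end_def J_def)
    also have "(\<Prod>i = 0..<2 * k. wedge (ext_gen (\<kappa> i)) (ext_gen (\<mu> i)))
        = (\<Prod>l = 0..<k. - (z (sorted_list_of_set I ! l) * z (sorted_list_of_set J ! l)))"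
      unfolding prod_double
    proof (intro prod.cong refl)
      fix l :: nat
      have d: "(2 * l + 1) div 2 = l" "(2 * l) div 2 = l" by auto
      show "wedge (ext_gen (\<kappa> (2 * l))) (ext_gen (\<mu> (2 * l))) *
          wedge (ext_gen (\<kappa> (2 * l + 1))) (ext_gen (\<mu> (2 * l + 1)))
        = - (z (sorted_list_of_set I ! l) * z (sorted_list_of_set J ! l))"
        unfolding \<kappa>_def \<mu>_def d z_def by (subst wedge_pair) simp_all
    qed
    also have "\<dots> = (- 1) ^ k * ((\<Prod>l = 0..<k. z (sorted_list_of_set I ! l)) * (\<Prod>l = 0..<k. z (sorted_list_of_set J ! l)))"
      by (simp add: prod_uminus prod.distrib)
    also have "(\<Prod>l = 0..<k. z (sorted_list_of_set I ! l)) = (\<Prod>e\<in>I. z e)"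
      using fin by (intro prod.reindex_bij_betw bij_betw_nth) (auto simp: k_def)
    also have "(\<Prod>l = 0..<k. z (sorted_list_of_set J ! l)) = (\<Prod>e\<in>J. z e)"
      using fin by (intro prod.reindex_bij_betw bij_betw_nth) (auto simp: k_def cJ)
    also have "(\<Prod>e\<in>I. z e) * (\<Prod>e\<in>J. z e) = Z"
      unfolding Z_def J_def using prod.subset_diff[OF I T, of z] by (simp add: mult.commute)
    finally show ?thesis
      by (simp add: k_def even_const_mult even_const.hom_power even_const.hom_uminus mult_ac)
  qed
  have "(\<Prod>e\<in>T. y (Pos e 0) + y (Pos e 1)) = (\<Sum>I\<in>halves T. (- 1) ^ card I * (\<Prod>e\<in>I. y (Pos e 0) * y (Pos e 1)))"
  proof (rule prod_sums_eq_sum_prods)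
    show "x = 0" if "k > 0" "of_nat k * x = 0" for k and x :: "(position, 'r) evenalg"
      using of_nat_mult_evenalg_eq_0[OF torsion[OF that(1)] that(2)] .
    have "(\<Sum>e\<in>T. y (Pos e 0) + y (Pos e 1)) = (\<Sum>(e, i)\<in>T \<times> {0, 1}. y (Pos e i))"
      by (simp add: sum.cartesian_product[symmetric])
    also have "\<dots> = (\<Sum>h\<in>H. y h)"
      unfolding H_def half_edges_def by (subst sum.reindex) (auto simp: inj_on_def case_prod_unfold)
    also have "\<dots> = 0"
      unfolding y_def by (rule sum_contraction) (use torsion[of 2] in \<open>auto simp: \<beta>_def sym\<close>)
    finally show "(\<Sum>e\<in>T. y (Pos e 0) + y (Pos e 1)) = 0" .
  qed (use T in \<open>auto simp: y_def contraction_square\<close>)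
  also have "\<dots> = even_const (\<Sum>I\<in>halves T. minor I) * Z"
    unfolding even_const.hom_sum sum_distrib_right
  proof (rule sum.cong)
    fix I assume I: "I \<in> halves T"
    have "(- 1) ^ card I * (even_const ((- 1) ^ card I * minor I) * Z)
        = ((- 1) ^ card I * (- 1) ^ card I) * (even_const (minor I) * Z)"
      by (simp only: even_const_mult even_const.hom_power even_const.hom_uminus even_const_1 mult_ac)
    then show "(- 1) ^ card I * (\<Prod>e\<in>I. y (Pos e 0) * y (Pos e 1)) = even_const (minor I) * Z"
      unfolding half[OF I] by simp
  qed simp
  finally have eq: "even_const (orient_det b s t T) * Z = even_const (\<Sum>I\<in>halves T. minor I) * Z"
    unfolding lhs .
  define L where "L = sorted_list_of_set T"
  have L: "sorted_wrt (<) L" "set L = T" "distinct L" using T by (auto simp: L_def)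
  define G where "G = concat (map (\<lambda>e. [Pos e 0, Pos e 1]) L)"
  have lt: "Pos a i < Pos b j \<longleftrightarrow> a < b \<or> a = b \<and> i < j" for a b i j
    by (auto simp: less_position_def)
  have "sorted_wrt (<) G"
    unfolding G_def using L(1) by (induction L) (auto simp: lt)
  then have "prod_list (map ext_gen G) = (ext_monom (set G) :: (position, 'r) extalg)"
    by (rule prod_list_ext_gen)
  moreover have "prod_list (map ext_gen G) = prod_list (map (\<lambda>e. ext_gen (Pos e 0) * (ext_gen (Pos e 1) :: (position, 'r) extalg)) L)"
    unfolding G_def by (induction L) (auto simp: mult.assoc)
  moreover have "form_of Z = prod_list (map (\<lambda>e. ext_gen (Pos e 0) * ext_gen (Pos e 1)) L)"
    unfolding Z_def L(2)[symmetric] prod.distinct_set_conv_list[OF L(3)] form_of_prod_list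
    by (simp add: z_def form_of_wedge comp_def)
  ultimately have "form_of Z = ext_monom (set G)" by simp
  then have "ext_coeff (form_of (even_const c * Z)) (set G) = c" for c
    by (simp add: times_evenalg.rep_eq even_const.rep_eq ext_monom.rep_eq)
  from arg_cong[OF eq, of "\<lambda>x. ext_coeff (form_of x) (set G)", unfolded this] show ?thesis
    by (simp only: minor_def)
qed

section \<open>Gram determinants of one-forms\<close>

text \<open>
  After expansion, moving the second forms back into the order of the rows gives the sign of the
  permutation once more. The two signs cancel, which leaves permanents of \<open>b\<close>.
\<close>

lemma det_gram_eq_sum_per:
  fixes \<xi> :: "'e \<Rightarrow> 'k \<Rightarrow> ('g :: linorder, 'r :: comm_ring_1) extalg"
  assumes S: "finite S" and K: "finite K"
    and odd: "\<And>r k. r \<in> S \<Longrightarrow> k \<in> K \<Longrightarrow> odd_form (\<xi> r k)"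
  shows "det_on S (\<lambda>r r'. \<Sum>x\<in>K \<times> K. even_const (b (fst x) (snd x)) * wedge (\<xi> r (fst x)) (\<xi> r' (snd x)))
    = (\<Sum>a\<in>PiE S (\<lambda>_. K \<times> K). even_const (per_on S (\<lambda>i j. b (fst (a i)) (snd (a j)))) *
        (\<Prod>r\<in>S. wedge (\<xi> r (fst (a r))) (\<xi> r (snd (a r)))))"
proof -
  let ?A = "PiE S (\<lambda>_. K \<times> K)"
  let ?w = "\<lambda>a. \<Prod>r\<in>S. wedge (\<xi> r (fst (a r))) (\<xi> r (snd (a r)))"
  let ?b = "\<lambda>p a. \<Prod>r\<in>S. even_const (b (fst (a r)) (snd (a (p r))))"
  have key: "of_int (sign p) * (\<Prod>r\<in>S. \<Sum>x\<in>K \<times> K. even_const (b (fst x) (snd x)) * wedge (\<xi> r (fst x)) (\<xi> (p r) (snd x)))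
      = (\<Sum>a\<in>?A. ?b p a * ?w a)" if p: "p permutes S" for p
  proof -
    have pS: "p r \<in> S \<longleftrightarrow> r \<in> S" for r using permutes_in_image[OF p] .
    let ?p' = "inv_into UNIV p"
    have p': "?p' permutes S" using p by (rule permutes_inv)
    have p'S: "?p' r \<in> S \<longleftrightarrow> r \<in> S" for r using permutes_in_image[OF p'] .
    have "(\<Prod>r\<in>S. \<Sum>x\<in>K \<times> K. even_const (b (fst x) (snd x)) * wedge (\<xi> r (fst x)) (\<xi> (p r) (snd x)))
        = (\<Sum>a\<in>?A. \<Prod>r\<in>S. even_const (b (fst (a r)) (snd (a r))) * wedge (\<xi> r (fst (a r))) (\<xi> (p r) (snd (a r))))"
      using S K by (intro prod_sum_PiE) auto
    also have "\<dots> = (\<Sum>a\<in>?A. \<Prod>r\<in>S. even_const (b (fst (a r)) (snd (a (p r)))) * wedge (\<xi> r (fst (a r))) (\<xi> (p r) (snd (a (p r)))))"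
    proof (rule sum.reindex_bij_witness[where
          i = "\<lambda>a. \<lambda>r\<in>S. (fst (a r), snd (a (p r)))" and j = "\<lambda>a. \<lambda>r\<in>S. (fst (a r), snd (a (?p' r)))"])
      fix a assume a: "a \<in> ?A"
      then have aK: "a r \<in> K \<times> K" if "r \<in> S" for r using that by auto
      have ext: "a r = undefined" if "r \<notin> S" for r using a that by (auto simp: PiE_def extensional_def)
      show "(\<lambda>r\<in>S. (fst ((\<lambda>r\<in>S. (fst (a r), snd (a (?p' r)))) r), snd ((\<lambda>r\<in>S. (fst (a r), snd (a (?p' r)))) (p r)))) = a"
        using pS ext permutes_inverses[OF p] by (auto simp: fun_eq_iff restrict_def)
      show "(\<lambda>r\<in>S. (fst ((\<lambda>r\<in>S. (fst (a r), snd (a (p r)))) r), snd ((\<lambda>r\<in>S. (fst (a r), snd (a (p r)))) (?p' r)))) = a"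
        using p'S ext permutes_inverses[OF p] by (auto simp: fun_eq_iff restrict_def)
      show "(\<lambda>r\<in>S. (fst (a r), snd (a (?p' r)))) \<in> ?A"
        using aK p'S by (auto simp: mem_Times_iff)
      show "(\<lambda>r\<in>S. (fst (a r), snd (a (p r)))) \<in> ?A"
        using aK pS by (auto simp: mem_Times_iff)
      show "(\<Prod>r\<in>S. even_const (b (fst ((\<lambda>r\<in>S. (fst (a r), snd (a (?p' r)))) r)) (snd ((\<lambda>r\<in>S. (fst (a r), snd (a (?p' r)))) (p r))))
          * wedge (\<xi> r (fst ((\<lambda>r\<in>S. (fst (a r), snd (a (?p' r)))) r))) (\<xi> (p r) (snd ((\<lambda>r\<in>S. (fst (a r), snd (a (?p' r)))) (p r)))))
        = (\<Prod>r\<in>S. even_const (b (fst (a r)) (snd (a r))) * wedge (\<xi> r (fst (a r))) (\<xi> (p r) (snd (a r))))"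
        using pS permutes_inverses[OF p] by (intro prod.cong refl) simp
    qed
    also have "\<dots> = (\<Sum>a\<in>?A. ?b p a * (of_int (sign p) * ?w a))"
    proof (intro sum.cong refl)
      fix a assume a: "a \<in> ?A"
      then have aK: "a r \<in> K \<times> K" if "r \<in> S" for r using that by auto
      have "(\<Prod>r\<in>S. wedge (\<xi> r (fst (a r))) (\<xi> (p r) (snd (a (p r))))) = of_int (sign p) * ?w a"
        using aK odd
        by (intro prod_wedge_permute[OF S p, where c = "\<lambda>r. \<xi> r (snd (a r))"]) (auto simp: mem_Times_iff)
      then show "(\<Prod>r\<in>S. even_const (b (fst (a r)) (snd (a (p r)))) * wedge (\<xi> r (fst (a r))) (\<xi> (p r) (snd (a (p r)))))
          = ?b p a * (of_int (sign p) * ?w a)"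
        by (simp add: prod.distrib)
    qed
    also have "of_int (sign p) * \<dots> = (\<Sum>a\<in>?A. (of_int (sign p) * of_int (sign p)) * (?b p a * ?w a))"
      unfolding sum_distrib_left by (intro sum.cong refl) (simp only: mult_ac)
    also have "\<dots> = (\<Sum>a\<in>?A. ?b p a * ?w a)"
      by (simp flip: of_int_mult)
    finally show ?thesis .
  qed
  have "det_on S (\<lambda>r r'. \<Sum>x\<in>K \<times> K. even_const (b (fst x) (snd x)) * wedge (\<xi> r (fst x)) (\<xi> r' (snd x)))
      = (\<Sum>p | p permutes S. \<Sum>a\<in>?A. ?b p a * ?w a)"
    unfolding det_on_def using key by (intro sum.cong) auto
  also have "\<dots> = (\<Sum>a\<in>?A. \<Sum>p | p permutes S. ?b p a * ?w a)" by (rule sum.swap)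
  also have "\<dots> = (\<Sum>a\<in>?A. even_const (per_on S (\<lambda>i j. b (fst (a i)) (snd (a j)))) * ?w a)"
    by (simp add: per_on_def even_const.hom_sum even_const.hom_prod sum_distrib_right)
  finally show ?thesis .
qed

lemma per_on_permute:
  assumes p: "p permutes S"
  shows "per_on S (\<lambda>i j. c (p i) (p j)) = per_on S c"
proof -
  let ?p' = "inv_into UNIV p"
  have p': "?p' permutes S" using p by (rule permutes_inv)
  show ?thesis
    unfolding per_on_def
  proof (rule sum.reindex_bij_witness[where i = "\<lambda>q. ?p' \<circ> q \<circ> p" and j = "\<lambda>q. p \<circ> q \<circ> ?p'"])
    fix q assume "q \<in> {q. q permutes S}"
    then have q: "q permutes S" by simp
    show "?p' \<circ> (p \<circ> q \<circ> ?p') \<circ> p = q" "p \<circ> (?p' \<circ> q \<circ> p) \<circ> ?p' = q"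
      using permutes_inverses[OF p] by (auto simp: fun_eq_iff)
    show "p \<circ> q \<circ> ?p' \<in> {q. q permutes S}" "?p' \<circ> q \<circ> p \<in> {q. q permutes S}"
      using p p' q by (auto intro!: permutes_compose)
    show "(\<Prod>i\<in>S. c i ((p \<circ> q \<circ> ?p') i)) = (\<Prod>i\<in>S. c (p i) (p (q i)))"
      by (subst prod.permute[OF p]) (simp add: comp_def permutes_inverses[OF p])
  qed
qed

text \<open>
  The sum depends on the set of edges and not on their numbering.
\<close>

lemma orient_per_permute:
  assumes S: "finite S" and p: "p permutes S"
  shows "orient_per b (s \<circ> p) (t \<circ> p) S = orient_per b s t S"
  unfolding orient_per_def
proof (rule sum.reindex_bij_witness[where i = "\<lambda>O'. p -` O'" and j = "\<lambda>O'. p ` O'"])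
  have inj: "inj p" and surj: "surj p" by (rule permutes_inj[OF p], rule permutes_surj[OF p])
  fix O' assume O': "O' \<in> Pow S"
  show "p -` p ` O' = O'" using inj by (rule inj_vimage_image_eq)
  show "p ` (p -` O') = O'" using surj by (rule surj_image_vimage_eq)
  show "p ` O' \<in> Pow S" using O' permutes_image[OF p] by auto
  show "p -` O' \<in> Pow S"
  proof
    show "p -` O' \<subseteq> S" using O' permutes_in_image[OF p] by auto
  qed
  have f: "flipped s t (p ` O') (p i) = flipped (s \<circ> p) (t \<circ> p) O' i"
    "flipped t s (p ` O') (p i) = flipped (t \<circ> p) (s \<circ> p) O' i" for i
    using inj_image_mem_iff[OF inj, of i O'] by (simp_all add: flipped_def)
  have "per_on S (\<lambda>e f. b (flipped s t (p ` O') e) (flipped t s (p ` O') f))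
      = per_on S (\<lambda>e f. b (flipped (s \<circ> p) (t \<circ> p) O' e) (flipped (t \<circ> p) (s \<circ> p) O' f))"
    by (subst per_on_permute[OF p, symmetric]) (simp only: f)
  moreover have "card (p ` O') = card O'"
    using inj by (intro card_image) (auto intro: inj_on_subset)
  ultimately show "(- 1) ^ card (p ` O') * per_on S (\<lambda>e f. b (flipped s t (p ` O') e) (flipped t s (p ` O') f))
      = (- 1) ^ card O' * per_on S (\<lambda>e f. b (flipped (s \<circ> p) (t \<circ> p) O' e) (flipped (t \<circ> p) (s \<circ> p) O' f))"
    by simp
qed

lemma wedge_add_left: "odd_form a \<Longrightarrow> odd_form b \<Longrightarrow> odd_form c \<Longrightarrow> wedge (a + b) c = wedge a c + wedge b c"
  by (rule form_of_eqI) (simp add: form_of_wedge plus_evenalg.rep_eq odd_form_add distrib_right)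

lemma wedge_add_right: "odd_form a \<Longrightarrow> odd_form b \<Longrightarrow> odd_form c \<Longrightarrow> wedge c (a + b) = wedge c a + wedge c b"
  by (rule form_of_eqI) (simp add: form_of_wedge plus_evenalg.rep_eq odd_form_add distrib_left)

lemma wedge_0 [simp]: "wedge 0 c = 0" "wedge c 0 = 0"
  by (rule form_of_eqI, simp add: wedge_def even_part.rep_eq zero_evenalg.rep_eq)+

lemma wedge_sum_right:
  "(\<And>i. i \<in> I \<Longrightarrow> odd_form (f i)) \<Longrightarrow> odd_form c \<Longrightarrow> wedge c (\<Sum>i\<in>I. f i) = (\<Sum>i\<in>I. wedge c (f i))"
  by (induction I rule: infinite_finite_induct) (simp_all add: wedge_add_right odd_form_sum)

lemma wedge_minus_right: "odd_form a \<Longrightarrow> odd_form c \<Longrightarrow> wedge c (- a) = - wedge c a"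
  by (rule form_of_eqI) (simp add: form_of_wedge uminus_evenalg.rep_eq odd_form_uminus)

text \<open>
  One edge from \<open>x\<close> to \<open>y\<close> with form \<open>\<phi>\<close>, in the row of the vertex \<open>z\<close>: the ends at positions \<open>k\<close> and \<open>l\<close>
  are the two ends of the edge, and reversing it changes the sign.
\<close>

lemma wedge_edge_identity:
  assumes "odd_form \<theta>" "odd_form \<phi>"
  shows "wedge (if k = z then \<theta> else 0) ((if x = z \<and> y = l then \<phi> else 0) + (if y = z \<and> x = l then \<phi> else 0))
      - wedge (if l = z then \<theta> else 0) ((if x = z \<and> y = k then \<phi> else 0) + (if y = z \<and> x = k then \<phi> else 0))
    = (if (k, l) = (x, y) then wedge \<theta> ((if x = z then \<phi> else 0) - (if y = z then \<phi> else 0)) else 0)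
      + (if (k, l) = (y, x) then - wedge \<theta> ((if x = z then \<phi> else 0) - (if y = z then \<phi> else 0)) else 0)"
proof -
  have m: "wedge \<theta> (- \<phi>) = - wedge \<theta> \<phi>" using assms by (intro wedge_minus_right)
  consider (1) "x = z" "y = z" | (2) "x = z" "y \<noteq> z" | (3) "x \<noteq> z" "y = z" | (4) "x \<noteq> z" "y \<noteq> z"
    by blast
  then show ?thesis
  proof cases
    case 1
    then show ?thesis by (cases "k = z"; cases "l = z") simp_all
  next
    case 2
    then show ?thesis by (cases "k = z"; cases "l = z") simp_all
  next
    case 3
    then show ?thesis by (cases "k = z"; cases "l = z") (simp_all add: m)
  next
    case 4
    then show ?thesis
      by (simp only: simp_thms if_False add_0 diff_self wedge_0 minus_zero if_cancel)
  qed
qed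

text \<open>
  The deltas force \<open>a\<close> to be \<open>pt\<close> composed with a choice function \<open>\<alpha>\<close>, so the sum over \<open>a\<close>
  becomes a sum over \<open>\<alpha>\<close>.
\<close>

lemma sum_PiE_times_prod_delta:
  fixes P :: "('i \<Rightarrow> 'x) \<Rightarrow> 'a :: comm_ring_1"
  assumes S: "finite S" and A: "finite A" and Y: "finite Y" and pt: "\<And>y. y \<in> Y \<Longrightarrow> pt y \<in> A"
  shows "(\<Sum>a\<in>PiE S (\<lambda>_. A). P a * (\<Prod>r\<in>S. \<Sum>y\<in>Y. if a r = pt y then V r y else 0))
    = (\<Sum>\<alpha>\<in>PiE S (\<lambda>_. Y). P (restrict (pt \<circ> \<alpha>) S) * (\<Prod>r\<in>S. V r (\<alpha> r)))"
proof -
  let ?A = "PiE S (\<lambda>_. A)" and ?Y = "PiE S (\<lambda>_. Y)"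
  have "P a * (\<Prod>r\<in>S. \<Sum>y\<in>Y. if a r = pt y then V r y else 0)
      = (\<Sum>\<alpha>\<in>?Y. if a = restrict (pt \<circ> \<alpha>) S then P a * (\<Prod>r\<in>S. V r (\<alpha> r)) else 0)"
    if a: "a \<in> ?A" for a
  proof -
    have "(\<Prod>r\<in>S. \<Sum>y\<in>Y. if a r = pt y then V r y else 0)
        = (\<Sum>\<alpha>\<in>?Y. \<Prod>r\<in>S. if a r = pt (\<alpha> r) then V r (\<alpha> r) else 0)"
      using S Y by (intro prod_sum_PiE) auto
    also have "\<dots> = (\<Sum>\<alpha>\<in>?Y. if a = restrict (pt \<circ> \<alpha>) S then (\<Prod>r\<in>S. V r (\<alpha> r)) else 0)"
    proof (intro sum.cong refl)
      fix \<alpha>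
      show "(\<Prod>r\<in>S. if a r = pt (\<alpha> r) then V r (\<alpha> r) else 0)
          = (if a = restrict (pt \<circ> \<alpha>) S then (\<Prod>r\<in>S. V r (\<alpha> r)) else 0)"
      proof (cases "\<forall>r\<in>S. a r = pt (\<alpha> r)")
        case True
        then have "a = restrict (pt \<circ> \<alpha>) S"
          using a by (auto simp: PiE_def extensional_def restrict_def fun_eq_iff)
        moreover have "(\<Prod>r\<in>S. if a r = pt (\<alpha> r) then V r (\<alpha> r) else 0) = (\<Prod>r\<in>S. V r (\<alpha> r))"
          using True by (intro prod.cong) auto
        ultimately show ?thesis by (simp only: if_True simp_thms)
      next
        case False
        then obtain r where r: "r \<in> S" "a r \<noteq> pt (\<alpha> r)" by auto
        then have "a \<noteq> restrict (pt \<circ> \<alpha>) S" by auto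
        moreover have "(\<Prod>r\<in>S. if a r = pt (\<alpha> r) then V r (\<alpha> r) else 0) = 0"
          using S r by (intro prod_zero bexI[of _ r]) auto
        ultimately show ?thesis by (simp only: if_False simp_thms)
      qed
    qed
    finally show ?thesis
      by (simp only: sum_distrib_left if_distrib[of "(*) _"] mult_zero_right)
  qed
  then have "(\<Sum>a\<in>?A. P a * (\<Prod>r\<in>S. \<Sum>y\<in>Y. if a r = pt y then V r y else 0))
      = (\<Sum>a\<in>?A. \<Sum>\<alpha>\<in>?Y. if a = restrict (pt \<circ> \<alpha>) S then P a * (\<Prod>r\<in>S. V r (\<alpha> r)) else 0)"
    by (intro sum.cong) simp_all
  also have "\<dots> = (\<Sum>\<alpha>\<in>?Y. \<Sum>a\<in>?A. if a = restrict (pt \<circ> \<alpha>) S then P a * (\<Prod>r\<in>S. V r (\<alpha> r)) else 0)"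
    by (rule sum.swap)
  also have "\<dots> = (\<Sum>\<alpha>\<in>?Y. P (restrict (pt \<circ> \<alpha>) S) * (\<Prod>r\<in>S. V r (\<alpha> r)))"
  proof (intro sum.cong refl)
    fix \<alpha> assume \<alpha>: "\<alpha> \<in> ?Y"
    have "restrict (pt \<circ> \<alpha>) S \<in> ?A" using pt PiE_mem[OF \<alpha>] by simp
    moreover have "finite ?A" using S A by (intro finite_PiE) auto
    ultimately show "(\<Sum>a\<in>?A. if a = restrict (pt \<circ> \<alpha>) S then P a * (\<Prod>r\<in>S. V r (\<alpha> r)) else 0)
        = P (restrict (pt \<circ> \<alpha>) S) * (\<Prod>r\<in>S. V r (\<alpha> r))"
      by (simp only: sum.delta if_True)
  qed
  finally show ?thesis .
qed

text \<open>
  The row of the vertex \<open>\<rho> r\<close> is \<open>\<xi> r\<close>; it contains \<open>\<theta> r\<close> on the diagonal and the form of each edge at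
  \<open>\<rho> r\<close> in the column of the other end. Every row is used twice. As there are at most \<open>card S\<close> edge
  forms, each \<open>\<theta> r\<close> has to occur exactly once, together with one edge at \<open>\<rho> r\<close>, and the two orders of
  these factors amount to the two orientations of the edge, with opposite signs. A choice of edges that
  repeats an edge contributes zero; every other choice numbers all edges and gives the same sum of
  permanents over all orientations, which therefore factors out.
\<close>

lemma det_edge_forms:
  fixes \<theta> \<phi> :: "'e \<Rightarrow> ('g :: linorder, 'r :: comm_ring_1) extalg" and s t \<rho> :: "'e \<Rightarrow> 'k"
  assumes S: "finite S" and K: "finite K"
    and st: "\<And>e. e \<in> S \<Longrightarrow> s e \<in> K" "\<And>e. e \<in> S \<Longrightarrow> t e \<in> K"
    and odd: "\<And>r. r \<in> S \<Longrightarrow> odd_form (\<theta> r)" "\<And>e. e \<in> S \<Longrightarrow> odd_form (\<phi> e)"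
    and sq: "\<And>r. r \<in> S \<Longrightarrow> \<theta> r * \<theta> r = 0" "\<And>e. e \<in> S \<Longrightarrow> \<phi> e * \<phi> e = 0"
    and F: "finite F" "card F \<le> card S" "\<And>e. e \<in> S \<Longrightarrow> order_ge F 1 (\<phi> e)"
    and \<xi>: "\<And>r k. r \<in> S \<Longrightarrow> k \<in> K \<Longrightarrow> \<xi> r k = (if k = \<rho> r then \<theta> r else 0) +
      (\<Sum>e\<in>S. (if s e = \<rho> r \<and> t e = k then \<phi> e else 0) + (if t e = \<rho> r \<and> s e = k then \<phi> e else 0))"
  shows "det_on S (\<lambda>r r'. \<Sum>x\<in>K \<times> K. even_const (b (fst x) (snd x)) * wedge (\<xi> r (fst x)) (\<xi> r' (snd x)))
    = even_const (orient_per b s t S) * (\<Prod>r\<in>S. wedge (\<theta> r)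
        (\<Sum>e\<in>S. (if s e = \<rho> r then \<phi> e else 0) - (if t e = \<rho> r then \<phi> e else 0)))"
proof -
  let ?A = "PiE S (\<lambda>_. K \<times> K)"
  define d where "d = (\<lambda>r k e. (if s e = \<rho> r \<and> t e = k then \<phi> e else 0) + (if t e = \<rho> r \<and> s e = k then \<phi> e else 0))"
  define \<Phi> where "\<Phi> = (\<lambda>r k. \<Sum>e\<in>S. d r k e)"
  define \<gamma> where "\<gamma> = (\<lambda>r e. (if s e = \<rho> r then \<phi> e else 0) - (if t e = \<rho> r then \<phi> e else 0))"
  \<comment> \<open>
    The factors \<open>\<theta> r\<close> and \<open>\<phi> e\<close>, with the sign of the end \<open>\<rho> r\<close> of \<open>e\<close>; an oriented edge is a pair \<open>y\<close> of an
    edge and the choice whether to reverse it, with ends \<open>pt y\<close> and contribution \<open>V r y\<close>.\<close>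
  define W where "W = (\<lambda>r e. wedge (\<theta> r) (\<gamma> r e))"
  define pt where "pt = (\<lambda>x. if snd x then (t (fst x), s (fst x)) else (s (fst x), t (fst x)))"
  define V where "V = (\<lambda>r y. if snd y then - W r (fst y) else W r (fst y))"
  define u where "u = (\<lambda>r x. \<Sum>y\<in>S \<times> UNIV. if x = pt y then V r y else 0)"
  define P where "P = (\<lambda>a. per_on S (\<lambda>i j. b (fst (a i)) (snd (a j))))"
  have odd_d: "odd_form (d r k e)" if "e \<in> S" for r k e
    using odd(2)[OF that] by (simp add: d_def odd_form_add)
  have odd_\<Phi>: "odd_form (\<Phi> r k)" for r k
    unfolding \<Phi>_def using odd_d by (rule odd_form_sum)
  have odd_\<gamma>: "odd_form (\<gamma> r e)" if "e \<in> S" for r e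
    using odd(2)[OF that] by (simp add: \<gamma>_def odd_form_diff odd_form_uminus)
  have ord_\<Phi>: "order_ge F 1 (\<Phi> r k)" for r k
    unfolding \<Phi>_def d_def using F(3) by (intro order_ge_sum order_ge_add) auto
  have split: "wedge (\<xi> r (fst x)) (\<xi> r (snd x)) = u r x + wedge (\<Phi> r (fst x)) (\<Phi> r (snd x))"
    if r: "r \<in> S" and x: "x \<in> K \<times> K" for r x
  proof -
    obtain k l where kl: "x = (k, l)" "k \<in> K" "l \<in> K" using x by auto
    define a where "a = (\<lambda>k. if k = \<rho> r then \<theta> r else 0)"
    have odd_a: "odd_form (a k)" for k using odd(1)[OF r] by (simp add: a_def)
    have aa: "wedge (a k) (a l) = 0"
      by (rule form_of_eqI) (use odd_a sq(1)[OF r] in \<open>simp add: form_of_wedge zero_evenalg.rep_eq\<close>, simp add: a_def)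
    have "wedge (\<xi> r k) (\<xi> r l) = wedge (a k + \<Phi> r k) (a l + \<Phi> r l)"
      using \<xi>[OF r kl(2)] \<xi>[OF r kl(3)] by (simp add: a_def \<Phi>_def d_def)
    also have "\<dots> = wedge (a k) (\<Phi> r l) + wedge (\<Phi> r k) (a l) + wedge (\<Phi> r k) (\<Phi> r l)"
      using odd_a odd_\<Phi> by (simp add: wedge_add_left wedge_add_right odd_form_add aa)
    also have "wedge (\<Phi> r k) (a l) = - wedge (a l) (\<Phi> r k)"
      by (rule wedge_flip[OF odd_a odd_\<Phi>])
    also have "wedge (a k) (\<Phi> r l) + - wedge (a l) (\<Phi> r k)
        = (\<Sum>e\<in>S. wedge (a k) (d r l e) - wedge (a l) (d r k e))"
      unfolding \<Phi>_def using odd_a odd_d by (simp add: wedge_sum_right sum_subtractf)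
    also have "\<dots> = (\<Sum>e\<in>S. (if (k, l) = (s e, t e) then W r e else 0) + (if (k, l) = (t e, s e) then - W r e else 0))"
    proof (rule sum.cong)
      fix e assume e: "e \<in> S"
      show "wedge (a k) (d r l e) - wedge (a l) (d r k e)
          = (if (k, l) = (s e, t e) then W r e else 0) + (if (k, l) = (t e, s e) then - W r e else 0)"
        unfolding a_def d_def W_def \<gamma>_def by (rule wedge_edge_identity[OF odd(1)[OF r] odd(2)[OF e]])
    qed simp
    also have "\<dots> = u r (k, l)"
      unfolding u_def V_def pt_def sum.cartesian_product' UNIV_bool by (intro sum.cong refl) (simp cong: if_cong)
    finally show ?thesis by (simp add: kl)
  qed
  have "det_on S (\<lambda>r r'. \<Sum>x\<in>K \<times> K. even_const (b (fst x) (snd x)) * wedge (\<xi> r (fst x)) (\<xi> r' (snd x)))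
      = (\<Sum>a\<in>?A. even_const (P a) * (\<Prod>r\<in>S. wedge (\<xi> r (fst (a r))) (\<xi> r (snd (a r)))))"
    unfolding P_def
  proof (rule det_gram_eq_sum_per[OF S K])
    fix r k assume "r \<in> S" "k \<in> K"
    then show "odd_form (\<xi> r k)"
      using \<xi> odd(1) odd_\<Phi>[of r k] unfolding \<Phi>_def d_def by (simp add: odd_form_add)
  qed
  also have "\<dots> = (\<Sum>a\<in>?A. even_const (P a) * (\<Prod>r\<in>S. u r (a r)))"
  proof (intro sum.cong refl arg_cong2[of _ _ _ _ "(*)"])
    fix a assume "a \<in> ?A"
    then have aK: "a r \<in> K \<times> K" if "r \<in> S" for r using that by auto
    have "(\<Prod>r\<in>S. wedge (\<xi> r (fst (a r))) (\<xi> r (snd (a r))))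
        = (\<Prod>r\<in>S. u r (a r) + wedge (\<Phi> r (fst (a r))) (\<Phi> r (snd (a r))))"
      using split aK by (intro prod.cong refl) blast
    also have "\<dots> = (\<Prod>r\<in>S. u r (a r))"
    proof (rule prod_perturb[OF S _ _ F(1,2)])
      fix r assume r: "r \<in> S"
      have oW: "order_ge F 1 (form_of (W r e))" if "e \<in> S" for e
      proof -
        have "order_ge F 1 (\<gamma> r e)"
          unfolding \<gamma>_def using F(3)[OF that] by (intro order_ge_diff) auto
        then have "order_ge F (0 + 1) (form_of (W r e))"
          unfolding W_def by (intro order_ge_wedge odd(1)[OF r] odd_\<gamma>[OF that] order_ge_0)
        then show ?thesis by simp
      qed
      show "order_ge F 1 (form_of (u r (a r)))"
        unfolding u_def form_of_sum
      proof (rule order_ge_sum)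
        fix y assume "y \<in> S \<times> (UNIV :: bool set)"
        then have "order_ge F 1 (form_of (W r (fst y)))" using oW by auto
        then show "order_ge F 1 (form_of (if a r = pt y then V r y else 0))"
          by (simp add: V_def uminus_evenalg.rep_eq zero_evenalg.rep_eq order_ge_uminus)
      qed
      show "order_ge F 2 (form_of (wedge (\<Phi> r (fst (a r))) (\<Phi> r (snd (a r)))))"
        using order_ge_wedge[OF odd_\<Phi> odd_\<Phi> ord_\<Phi> ord_\<Phi>] by (simp only: one_add_one)
    qed
    finally show "(\<Prod>r\<in>S. wedge (\<xi> r (fst (a r))) (\<xi> r (snd (a r)))) = (\<Prod>r\<in>S. u r (a r))" .
  qed
  also have "\<dots> = (\<Sum>\<alpha>\<in>PiE S (\<lambda>_. S \<times> UNIV). even_const (P (restrict (pt \<circ> \<alpha>) S)) * (\<Prod>r\<in>S. V r (\<alpha> r)))"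
    unfolding u_def using S K st by (intro sum_PiE_times_prod_delta) (auto simp: pt_def)
  also have "\<dots> = (\<Sum>(f, O')\<in>PiE S (\<lambda>_. S) \<times> Pow S.
      even_const ((- 1) ^ card O' * per_on S (\<lambda>i j. b (flipped (s \<circ> f) (t \<circ> f) O' i) (flipped (t \<circ> f) (s \<circ> f) O' j)))
        * (\<Prod>r\<in>S. W r (f r)))"
  proof (rule sum.reindex_bij_witness[where
        i = "\<lambda>(f, O'). \<lambda>r\<in>S. (f r, r \<in> O')" and j = "\<lambda>\<alpha>. (\<lambda>r\<in>S. fst (\<alpha> r), {r \<in> S. snd (\<alpha> r)})"])
    fix \<alpha> assume \<alpha>: "\<alpha> \<in> PiE S (\<lambda>_. S \<times> (UNIV :: bool set))"
    then have \<alpha>S: "fst (\<alpha> r) \<in> S" if "r \<in> S" for r using that by (auto simp: PiE_def Pi_def mem_Times_iff)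
    show "(case (\<lambda>r\<in>S. fst (\<alpha> r), {r \<in> S. snd (\<alpha> r)}) of (f, O') \<Rightarrow> \<lambda>r\<in>S. (f r, r \<in> O')) = \<alpha>"
      using \<alpha> by (auto simp: PiE_def extensional_def restrict_def fun_eq_iff)
    show "(\<lambda>r\<in>S. fst (\<alpha> r), {r \<in> S. snd (\<alpha> r)}) \<in> PiE S (\<lambda>_. S) \<times> Pow S"
      using \<alpha>S by auto
    let ?f = "\<lambda>r\<in>S. fst (\<alpha> r)" and ?O = "{r \<in> S. snd (\<alpha> r)}"
    have "P (restrict (pt \<circ> \<alpha>) S) = per_on S (\<lambda>i j. b (flipped (s \<circ> ?f) (t \<circ> ?f) ?O i) (flipped (t \<circ> ?f) (s \<circ> ?f) ?O j))"
      unfolding P_def by (rule per_on_cong) (simp add: pt_def flipped_def)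
    moreover have "(\<Prod>r\<in>S. V r (\<alpha> r))
        = (- 1) ^ card ?O * (\<Prod>r\<in>S. W r (?f r))"
    proof -
      have "(\<Prod>r\<in>S. V r (\<alpha> r))
          = (\<Prod>r\<in>S. (if snd (\<alpha> r) then - 1 else 1) * W r (?f r))"
        by (intro prod.cong) (auto simp: V_def)
      also have "\<dots> = (\<Prod>r\<in>S. if snd (\<alpha> r) then - 1 else 1) * (\<Prod>r\<in>S. W r (?f r))"
        by (rule prod.distrib)
      also have "(\<Prod>r\<in>S. if snd (\<alpha> r) then - 1 else 1) = ((- 1) ^ card ?O :: ('g, 'r) evenalg)"
        using S by (simp add: prod.inter_filter[symmetric])
      finally show ?thesis .
    qed
    ultimately show "(case (\<lambda>r\<in>S. fst (\<alpha> r), {r \<in> S. snd (\<alpha> r)}) of (f, O') \<Rightarrow>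
        even_const ((- 1) ^ card O' * per_on S (\<lambda>i j. b (flipped (s \<circ> f) (t \<circ> f) O' i) (flipped (t \<circ> f) (s \<circ> f) O' j)))
          * (\<Prod>r\<in>S. W r (f r)))
      = even_const (P (restrict (pt \<circ> \<alpha>) S)) * (\<Prod>r\<in>S. V r (\<alpha> r))"
      by (simp only: prod.case even_const_mult even_const.hom_power even_const.hom_uminus even_const_1 mult_ac)
  next
    fix x assume "x \<in> PiE S (\<lambda>_. S) \<times> Pow S"
    then obtain f O' where x: "x = (f, O')" "f \<in> PiE S (\<lambda>_. S)" "O' \<subseteq> S" by auto
    show "(case x of (f, O') \<Rightarrow> \<lambda>r\<in>S. (f r, r \<in> O')) \<in> PiE S (\<lambda>_. S \<times> (UNIV :: bool set))"
      using x by auto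
    have "(\<lambda>r\<in>S. f r) = f" using x(2) by (simp add: PiE_restrict)
    then show "(\<lambda>r\<in>S. fst ((case x of (f, O') \<Rightarrow> \<lambda>r\<in>S. (f r, r \<in> O')) r), {r \<in> S. snd ((case x of (f, O') \<Rightarrow> \<lambda>r\<in>S. (f r, r \<in> O')) r)}) = x"
      using x by (auto simp: restrict_def fun_eq_iff)
  qed
  also have "\<dots> = (\<Sum>f\<in>PiE S (\<lambda>_. S). even_const (orient_per b (s \<circ> f) (t \<circ> f) S) * (\<Prod>r\<in>S. W r (f r)))"
    unfolding sum.cartesian_product[symmetric] orient_per_def
    by (simp only: even_const.hom_sum sum_distrib_right)
  also have "\<dots> = (\<Sum>f\<in>PiE S (\<lambda>_. S). even_const (orient_per b s t S) * (\<Prod>r\<in>S. W r (f r)))"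
  proof (rule sum.cong)
    fix f assume f: "f \<in> PiE S (\<lambda>_. S)"
    show "even_const (orient_per b (s \<circ> f) (t \<circ> f) S) * (\<Prod>r\<in>S. W r (f r)) = even_const (orient_per b s t S) * (\<Prod>r\<in>S. W r (f r))"
    proof (cases "inj_on f S")
      case True
      have p: "perm_restrict S f permutes S"
        by (rule perm_restrict_permutes_inj[OF S f True])
      have "orient_per b (s \<circ> f) (t \<circ> f) S = orient_per b (s \<circ> perm_restrict S f) (t \<circ> perm_restrict S f) S"
        unfolding orient_per_def
        by (intro sum.cong refl arg_cong2[of _ _ _ _ "(*)"] per_on_cong) (simp add: flipped_def perm_restrict_def)
      also have "\<dots> = orient_per b s t S" by (rule orient_per_permute[OF S p])
      finally show ?thesis by simp
    next
      case False
      then obtain r r' where r: "r \<in> S" "r' \<in> S" "r \<noteq> r'" "f r = f r'" by (auto simp: inj_on_def)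
      have e: "f r \<in> S" using f r by auto
      have "\<gamma> r (f r) * \<gamma> r' (f r) = 0" using sq(2)[OF e] by (simp add: \<gamma>_def)
      then have "W r (f r) * W r' (f r') = 0"
        unfolding W_def r(4)[symmetric] using odd(1) odd_\<gamma>[OF e] r by (intro wedge_mult_eq_0) auto
      then have "(\<Prod>r\<in>S. W r (f r)) = 0" by (rule prod_eq_0_if_pair[OF S r(1-3)])
      then show ?thesis by simp
    qed
  qed simp
  also have "\<dots> = even_const (orient_per b s t S) * (\<Prod>r\<in>S. \<Sum>e\<in>S. W r e)"
    using S by (subst prod_sum_PiE) (auto simp: sum_distrib_left)
  also have "(\<Prod>r\<in>S. \<Sum>e\<in>S. W r e) = (\<Prod>r\<in>S. wedge (\<theta> r) (\<Sum>e\<in>S. \<gamma> r e))"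
    unfolding W_def using odd_\<gamma> odd(1) by (intro prod.cong refl) (simp add: wedge_sum_right)
  finally show ?thesis unfolding \<gamma>_def .
qed

section \<open>The trace of the odd power\<close>

lemma mat_trace_add:
  "A \<in> carrier_mat n n \<Longrightarrow> B \<in> carrier_mat n n \<Longrightarrow> mat_trace (A + B) = mat_trace A + mat_trace B"
  by (simp add: mat_trace_def sum.distrib)

lemma index_mult_mat_carrier:
  "A \<in> carrier_mat n n \<Longrightarrow> B \<in> carrier_mat n n \<Longrightarrow> i < n \<Longrightarrow> j < n \<Longrightarrow>
    (A * B) $$ (i, j) = (\<Sum>k<n. A $$ (i, k) * B $$ (k, j))"
  by (simp add: scalar_prod_def lessThan_atLeast0)

lemma mat_trace_mult:
  "A \<in> carrier_mat n n \<Longrightarrow> B \<in> carrier_mat n n \<Longrightarrow>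
    mat_trace (A * B) = (\<Sum>i<n. \<Sum>j<n. A $$ (i, j) * B $$ (j, i))"
  by (simp add: mat_trace_def scalar_prod_def lessThan_atLeast0)

lemma mat_trace_commute:
  assumes "A \<in> carrier_mat n n" "B \<in> carrier_mat n n"
    and "\<And>i j. i < n \<Longrightarrow> j < n \<Longrightarrow> A $$ (i, j) * B $$ (j, i) = B $$ (j, i) * A $$ (i, j)"
  shows "mat_trace (A * B) = mat_trace (B * A)"
  unfolding mat_trace_mult[OF assms(1,2)] mat_trace_mult[OF assms(2,1)]
  by (subst sum.swap) (simp add: assms(3))

lemma mat_trace_anticommute:
  fixes A B :: "'a :: ring_1 mat"
  assumes "A \<in> carrier_mat n n" "B \<in> carrier_mat n n"
    and "\<And>i j. i < n \<Longrightarrow> j < n \<Longrightarrow> A $$ (i, j) * B $$ (j, i) = - (B $$ (j, i) * A $$ (i, j))"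
  shows "mat_trace (A * B) = - mat_trace (B * A)"
  unfolding mat_trace_mult[OF assms(1,2)] mat_trace_mult[OF assms(2,1)] sum_negf[symmetric]
  by (subst sum.swap) (simp add: assms(3))

lemma pow_mat_Suc_left:
  assumes "A \<in> carrier_mat n n"
  shows "A ^\<^sub>m Suc k = A * A ^\<^sub>m k"
proof (induction k)
  case (Suc k)
  have "A ^\<^sub>m Suc (Suc k) = (A * A ^\<^sub>m k) * A" using Suc by simp
  also have "\<dots> = A * (A ^\<^sub>m k * A)" using assms by (intro assoc_mult_mat[of _ n n _ n _ n]) auto
  finally show ?case by simp
qed (use assms in simp)

lemma pow_mat_square:
  assumes "A \<in> carrier_mat n n"
  shows "(A * A) ^\<^sub>m k = A ^\<^sub>m (2 * k)"
proof (induction k)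
  case (Suc k)
  have "(A * A) ^\<^sub>m Suc k = A ^\<^sub>m (2 * k) * (A * A)" using Suc by simp
  also have "\<dots> = A ^\<^sub>m (2 * k) * A * A" using assms by (intro assoc_mult_mat[of _ n n _ n _ n, symmetric]) auto
  finally show ?case by simp
qed (use assms in simp)

lemma pow_mat_add:
  assumes "A \<in> carrier_mat n n"
  shows "A ^\<^sub>m (k + l) = A ^\<^sub>m k * A ^\<^sub>m l"
proof (induction l)
  case (Suc l)
  have "A ^\<^sub>m (k + Suc l) = A ^\<^sub>m k * A ^\<^sub>m l * A" using Suc by simp
  also have "\<dots> = A ^\<^sub>m k * (A ^\<^sub>m l * A)" using assms by (intro assoc_mult_mat[of _ n n _ n _ n]) auto
  finally show ?case by simp
next
  case 0
  show ?case using right_mult_one_mat[OF pow_carrier_mat[OF assms, of k]] assms by simp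
qed

lemma odd_mat_pow:
  fixes Z :: "('g :: linorder, 'r :: comm_ring_1) extalg mat"
  assumes Z: "Z \<in> carrier_mat n n" and odd: "\<And>i j. i < n \<Longrightarrow> j < n \<Longrightarrow> odd_form (Z $$ (i, j))"
    and ij: "i < n" "j < n"
  shows "if even k then even_form ((Z ^\<^sub>m k) $$ (i, j)) else odd_form ((Z ^\<^sub>m k) $$ (i, j))"
  using ij
proof (induction k arbitrary: i j)
  case 0
  then show ?case using Z by auto
next
  case (Suc k)
  have "(Z ^\<^sub>m Suc k) $$ (i, j) = (\<Sum>l<n. (Z ^\<^sub>m k) $$ (i, l) * Z $$ (l, j))"
    using Suc.prems Z by (simp add: scalar_prod_def lessThan_atLeast0)
  then show ?case
    using Suc.IH[OF Suc.prems(1)] odd Suc.prems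
    by (cases "even k") (auto intro!: odd_form_sum even_form_sum intro: odd_form_mult_left even_form_mult_odd)
qed

lemma order_ge_mat_pow:
  fixes Z :: "('g :: linorder, 'r :: comm_ring_1) extalg mat"
  assumes Z: "Z \<in> carrier_mat n n" and ord: "\<And>i j. i < n \<Longrightarrow> j < n \<Longrightarrow> order_ge G 1 (Z $$ (i, j))"
    and ij: "i < n" "j < n"
  shows "order_ge G k ((Z ^\<^sub>m k) $$ (i, j))"
  using ij
proof (induction k arbitrary: i j)
  case (Suc k)
  have "(Z ^\<^sub>m Suc k) $$ (i, j) = (\<Sum>l<n. (Z ^\<^sub>m k) $$ (i, l) * Z $$ (l, j))"
    using Suc.prems Z by (simp add: scalar_prod_def lessThan_atLeast0)
  moreover have "order_ge G (k + 1) ((Z ^\<^sub>m k) $$ (i, l) * Z $$ (l, j))" if "l < n" for l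
    using Suc that ord by (intro order_ge_mult) auto
  ultimately show ?case by (auto intro!: order_ge_sum)
qed simp

lemma gen_mult_gen: "ext_gen g * x * ext_gen g = 0"
proof (rule order_ge_imp_zero[of "{g}" "1 + 1"])
  show "order_ge {g} (1 + 1) (ext_gen g * x * ext_gen g)"
    by (intro order_ge_mult order_ge_mult_right order_ge_gen) simp_all
qed simp_all

interpretation form_of: semiring_hom form_of
  by standard (simp_all add: zero_evenalg.rep_eq one_evenalg.rep_eq plus_evenalg.rep_eq times_evenalg.rep_eq)

text \<open>
  Products with two factors \<open>V\<close> vanish. By cyclicity, each of the \<open>N\<close> positions of a single factor \<open>V\<close>
  contributes the same: the trace of a product of odd matrices is cyclic without a sign if the number of
  factors is odd.
\<close>

lemma mat_trace_pow_add_rank_one: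
  fixes Z V :: "('g :: linorder, 'r :: comm_ring_1) extalg mat"
  assumes Z: "Z \<in> carrier_mat n n" and V: "V \<in> carrier_mat n n"
    and oddZ: "\<And>i j. i < n \<Longrightarrow> j < n \<Longrightarrow> odd_form (Z $$ (i, j))"
    and oddV: "\<And>i j. i < n \<Longrightarrow> j < n \<Longrightarrow> odd_form (V $$ (i, j))"
    and VMV: "\<And>M. M \<in> carrier_mat n n \<Longrightarrow> V * M * V = 0\<^sub>m n n"
    and N: "odd N"
  shows "mat_trace ((Z + V) ^\<^sub>m N) = mat_trace (Z ^\<^sub>m N) + of_nat N * mat_trace (V * Z ^\<^sub>m (N - 1))"
proof -
  \<comment> \<open>\<open>D k\<close> is the part of \<open>(Z + V) ^ k\<close> that is linear in \<open>V\<close>.\<close>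
  define D where "D = rec_nat (0\<^sub>m n n) (\<lambda>k D. D * Z + Z ^\<^sub>m k * V)"
  have D0: "D 0 = 0\<^sub>m n n" and DS: "D (Suc k) = D k * Z + Z ^\<^sub>m k * V" for k by (simp_all add: D_def)
  have D: "D k \<in> carrier_mat n n" for k
    by (induction k) (use Z V in \<open>auto simp: D0 DS\<close>)
  have Zk: "Z ^\<^sub>m k \<in> carrier_mat n n" for k using Z by simp
  have DMV: "D k * M * V = 0\<^sub>m n n" if "M \<in> carrier_mat n n" for k M
    using that
  proof (induction k arbitrary: M)
    case 0
    then show ?case using V by (simp add: D0)
  next
    case (Suc k)
    note M = Suc.prems
    have ZV: "Z ^\<^sub>m k * V \<in> carrier_mat n n" by (rule mult_carrier_mat[OF Zk V])
    have DZ: "D k * Z \<in> carrier_mat n n" by (rule mult_carrier_mat[OF D Z])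
    have "D (Suc k) * M * V = (D k * Z * M + Z ^\<^sub>m k * V * M) * V"
      unfolding DS by (simp add: add_mult_distrib_mat[OF DZ ZV M])
    also have "\<dots> = D k * Z * M * V + Z ^\<^sub>m k * V * M * V"
      using DZ ZV M V by (intro add_mult_distrib_mat[of _ n n _ _ n]) auto
    also have "D k * Z * M * V = D k * (Z * M) * V"
      using D Z M by (simp add: assoc_mult_mat[of _ n n _ n _ n])
    also have "\<dots> = 0\<^sub>m n n" using Z M by (intro Suc.IH) auto
    also have "Z ^\<^sub>m k * V * M * V = Z ^\<^sub>m k * (V * M * V)"
      using Zk V M by (simp add: assoc_mult_mat[of _ n n _ n _ n] mult_carrier_mat[of _ n n _ n])
    also have "\<dots> = 0\<^sub>m n n" unfolding VMV[OF M] by (rule right_mult_zero_mat[OF Zk])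
    finally show ?case by simp
  qed
  have pow: "(Z + V) ^\<^sub>m k = Z ^\<^sub>m k + D k" for k
  proof (induction k)
    case 0
    then show ?case using Z V by (simp add: D0)
  next
    case (Suc k)
    have "D k * V = D k * 1\<^sub>m n * V" using right_mult_one_mat[OF D[of k]] by simp
    also have "\<dots> = 0\<^sub>m n n" by (rule DMV) simp
    finally have DV: "D k * V = 0\<^sub>m n n" .
    have "(Z + V) ^\<^sub>m Suc k = (Z ^\<^sub>m k + D k) * (Z + V)" using Suc by simp
    also have "\<dots> = (Z ^\<^sub>m k + D k) * Z + (Z ^\<^sub>m k + D k) * V"
      using Zk D Z V by (intro mult_add_distrib_mat[of _ n n _ n]) auto
    also have "\<dots> = (Z ^\<^sub>m k * Z + D k * Z) + (Z ^\<^sub>m k * V + D k * V)"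
      using Zk[of k] D[of k] Z V by (simp add: add_mult_distrib_mat[of _ n n _ _ n])
    also have "\<dots> = Z ^\<^sub>m Suc k + D (Suc k)"
      unfolding DV DS using mult_carrier_mat[OF Zk[of k] V] mult_carrier_mat[OF D[of k] Z] mult_carrier_mat[OF Zk[of k] Z]
      by (simp add: assoc_add_mat[of _ n n])
    finally show ?case .
  qed
  define \<tau> where "\<tau> = mat_trace (V * Z ^\<^sub>m (N - 1))"
  have cyc: "mat_trace (Z ^\<^sub>m k * V * Z ^\<^sub>m l) = \<tau>" if "k + l + 1 = N" for k l
  proof -
    have "Z ^\<^sub>m k * V * Z ^\<^sub>m l = Z ^\<^sub>m k * (V * Z ^\<^sub>m l)"
      by (rule assoc_mult_mat[OF Zk V Zk])
    also have "mat_trace \<dots> = mat_trace (V * Z ^\<^sub>m l * Z ^\<^sub>m k)"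
    proof (rule mat_trace_commute[OF Zk mult_carrier_mat[OF V Zk]])
      fix i j assume ij: "i < n" "j < n"
      show "(Z ^\<^sub>m k) $$ (i, j) * (V * Z ^\<^sub>m l) $$ (j, i) = (V * Z ^\<^sub>m l) $$ (j, i) * (Z ^\<^sub>m k) $$ (i, j)"
      proof (cases "even k")
        case True
        then have "even_form ((Z ^\<^sub>m k) $$ (i, j))" using odd_mat_pow[OF Z oddZ ij, of k] by simp
        then show ?thesis by (rule even_form_central)
      next
        case False
        then have l: "odd l" using that N by presburger
        have "(V * Z ^\<^sub>m l) $$ (j, i) = (\<Sum>h<n. V $$ (j, h) * (Z ^\<^sub>m l) $$ (h, i))"
          using ij V Z by (simp add: scalar_prod_def lessThan_atLeast0)
        moreover have "even_form \<dots>"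
          using odd_mat_pow[OF Z oddZ, of _ i l] l oddV ij
          by (intro even_form_sum even_form_mult_odd) auto
        ultimately show ?thesis by (simp add: even_form_central)
      qed
    qed
    also have "V * Z ^\<^sub>m l * Z ^\<^sub>m k = V * (Z ^\<^sub>m l * Z ^\<^sub>m k)"
      by (rule assoc_mult_mat[OF V Zk Zk])
    also have "Z ^\<^sub>m l * Z ^\<^sub>m k = Z ^\<^sub>m (N - 1)"
    proof -
      have "N - 1 = l + k" using that by simp
      then show ?thesis by (simp only: pow_mat_add[OF Z])
    qed
    finally show ?thesis by (simp add: \<tau>_def)
  qed
  have "mat_trace (D k * Z ^\<^sub>m (N - k)) = of_nat k * \<tau>" if "k \<le> N" for k
    using that
  proof (induction k)
    case 0
    have "0\<^sub>m n n * Z ^\<^sub>m N = 0\<^sub>m n n" by (rule left_mult_zero_mat[OF Zk])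
    then show ?case by (simp add: D0 mat_trace_def)
  next
    case (Suc k)
    have "D (Suc k) * Z ^\<^sub>m (N - Suc k) = D k * Z * Z ^\<^sub>m (N - Suc k) + Z ^\<^sub>m k * V * Z ^\<^sub>m (N - Suc k)"
      unfolding DS by (intro add_mult_distrib_mat[of _ n n _ _ n] mult_carrier_mat[of _ n n _ n] D Z Zk V)
    also have "D k * Z * Z ^\<^sub>m (N - Suc k) = D k * (Z * Z ^\<^sub>m (N - Suc k))"
      by (rule assoc_mult_mat[OF D Z Zk])
    also have "Z * Z ^\<^sub>m (N - Suc k) = Z ^\<^sub>m (N - k)"
      using Suc.prems pow_mat_Suc_left[OF Z, of "N - Suc k"] by (simp add: Suc_diff_Suc del: pow_mat.simps)
    finally have "mat_trace (D (Suc k) * Z ^\<^sub>m (N - Suc k))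
        = mat_trace (D k * Z ^\<^sub>m (N - k) + Z ^\<^sub>m k * V * Z ^\<^sub>m (N - Suc k))" by simp
    also have "\<dots> = mat_trace (D k * Z ^\<^sub>m (N - k)) + mat_trace (Z ^\<^sub>m k * V * Z ^\<^sub>m (N - Suc k))"
      by (intro mat_trace_add[of _ n] mult_carrier_mat[of _ n n _ n] D Zk V)
    also have "\<dots> = of_nat k * \<tau> + \<tau>"
      using Suc cyc[of k "N - Suc k"] by simp
    finally show ?case by (simp add: algebra_simps)
  qed
  from this[of N] have "mat_trace (D N) = of_nat N * \<tau>"
    using right_mult_one_mat[OF D[of N]] Z by simp
  then show ?thesis
    unfolding pow by (subst mat_trace_add[OF Zk D]) (simp add: \<tau>_def)
qed

lemma det_eq_det_on: "A \<in> carrier_mat n n \<Longrightarrow> det A = det_on {0..<n} (\<lambda>i j. A $$ (i, j))"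
  by (simp add: det_def' det_on_def)

text \<open>Cramer's rule: the sum is the determinant of \<open>B * A\<close> with the first column of \<open>B\<close> in place of its own.\<close>

lemma sum_col_cofactor_mult:
  fixes A B :: "'a :: comm_ring_1 mat"
  assumes B: "B \<in> carrier_mat n n" and A: "A \<in> carrier_mat n n" and n: "n > 0"
  shows "(\<Sum>i<n. B $$ (i, 0) * cofactor (B * A) i 0) = det B * cofactor A 0 0"
proof -
  have BA: "B * A \<in> carrier_mat n n" using A B by simp
  let ?A0 = "mat n n (\<lambda>(r, c). if c = 0 then (if r = 0 then 1 else 0) else A $$ (r, c))"
  let ?L = "mat n n (\<lambda>(r, c). if c = 0 then B $$ (r, 0) else (B * A) $$ (r, c))"
  have "(\<Sum>i<n. B $$ (i, 0) * cofactor (B * A) i 0) = det ?L"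
    by (rule det_replace_col[OF BA n, symmetric])
  also have "?L = B * ?A0"
  proof (rule eq_matI)
    fix i j assume "i < dim_row (B * ?A0)" "j < dim_col (B * ?A0)"
    then have ij: "i < n" "j < n" using B by auto
    have "(B * ?A0) $$ (i, j) = (\<Sum>k<n. B $$ (i, k) * ?A0 $$ (k, j))"
      using ij by (intro index_mult_mat_carrier[OF B]) auto
    also have "\<dots> = ?L $$ (i, j)"
    proof (cases "j = 0")
      case True
      have "(\<Sum>k<n. B $$ (i, k) * ?A0 $$ (k, j)) = (\<Sum>k<n. if k = 0 then B $$ (i, 0) else 0)"
        using True n by (intro sum.cong) auto
      then show ?thesis using True ij n by simp
    next
      case False
      then show ?thesis using ij index_mult_mat_carrier[OF B A ij] by simp
    qed
    finally show "?L $$ (i, j) = (B * ?A0) $$ (i, j)" ..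
  qed (use B in auto)
  also have "det (B * ?A0) = det B * det ?A0" by (rule det_mult[OF B]) simp
  also have "det ?A0 = (\<Sum>i<n. (if i = 0 then 1 else 0) * cofactor A i 0)"
    by (rule det_replace_col[OF A n])
  also have "\<dots> = (\<Sum>i<n. if i = 0 then cofactor A 0 0 else 0)" by (intro sum.cong) auto
  also have "\<dots> = cofactor A 0 0" using n by simp
  finally show ?thesis .
qed

text \<open>
  Every monomial in the entries of \<open>U\<close> contains one of the fewer than \<open>2 n - 1\<close> generators in \<open>G\<close>, so
  that the additional generator \<open>g\<close> in the corner has to occur, and it occurs once. What remains is
  a row of the power \<open>n - 1\<close> of the even matrix
  \<open>Y = (B U)\<^sup>2 = B (U B U)\<close>, applied to the first column of \<open>B\<close>. The trace of each power of \<open>Y\<close> is zero,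
  as it is the trace of a product of two odd matrices and changes sign when these are exchanged. Hence
  the power is an adjugate, and Cramer's rule splits off \<open>det B\<close>.
\<close>

lemma trace_odd_power:
  fixes B :: "'r :: comm_ring_1 mat" and U :: "('g :: linorder, 'r) extalg mat"
  assumes torsion: "\<And>k (x :: 'r). k > 0 \<Longrightarrow> of_nat k * x = 0 \<Longrightarrow> x = 0"
    and n: "n > 0" and B: "B \<in> carrier_mat n n" and U: "U \<in> carrier_mat n n"
    and odd: "\<And>i j. i < n \<Longrightarrow> j < n \<Longrightarrow> odd_form (U $$ (i, j))"
    and ord: "\<And>i j. i < n \<Longrightarrow> j < n \<Longrightarrow> order_ge G 1 (U $$ (i, j))"
    and G: "finite G" "card G < 2 * n - 1"
  shows "mat_trace ((map_mat ext_const B * (U + mat n n (\<lambda>(i, j). if i = 0 \<and> j = 0 then ext_gen g else 0))) ^\<^sub>m (2 * n - 1))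
    = of_nat (2 * n - 1) * (ext_gen g * form_of (even_const ((- 1) ^ (n - 1) * det B) *
        det_on {0..<n - 1} (\<lambda>r r'. \<Sum>x\<in>{0..<n} \<times> {0..<n}. even_const (B $$ x) *
          wedge (U $$ (Suc r, fst x)) (U $$ (snd x, Suc r')))))"
proof -
  let ?Bc = "map_mat ext_const B :: ('g, 'r) extalg mat"
  let ?E = "mat n n (\<lambda>(i, j). if i = 0 \<and> j = 0 then ext_gen g else 0) :: ('g, 'r) extalg mat"
  define Z where "Z = ?Bc * U"
  define V where "V = ?Bc * ?E"
  have Bc: "?Bc \<in> carrier_mat n n" using B by simp
  have E: "?E \<in> carrier_mat n n" by simp
  have Z: "Z \<in> carrier_mat n n" and V: "V \<in> carrier_mat n n"
    unfolding Z_def V_def using mult_carrier_mat[OF Bc U] mult_carrier_mat[OF Bc E] by auto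
  have Zij: "Z $$ (i, j) = (\<Sum>k<n. ext_const (B $$ (i, k)) * U $$ (k, j))" if "i < n" "j < n" for i j
    using that B U by (simp add: Z_def scalar_prod_def lessThan_atLeast0)
  have Vij: "V $$ (i, j) = (if j = 0 then ext_const (B $$ (i, 0)) * ext_gen g else 0)" if "i < n" "j < n" for i j
  proof -
    have "V $$ (i, j) = (\<Sum>k<n. ext_const (B $$ (i, k)) * (if k = 0 \<and> j = 0 then ext_gen g else 0))"
      using that B by (simp add: V_def scalar_prod_def lessThan_atLeast0)
    also have "\<dots> = (\<Sum>k<n. if k = 0 then (if j = 0 then ext_const (B $$ (i, 0)) * ext_gen g else 0) else 0)"
      by (intro sum.cong) auto
    finally have "V $$ (i, j) = (\<Sum>k<n. if k = 0 then (if j = 0 then ext_const (B $$ (i, 0)) * ext_gen g else 0) else 0)" .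
    then show ?thesis using n by simp
  qed
  have oddZ: "odd_form (Z $$ (i, j))" if "i < n" "j < n" for i j
    unfolding Zij[OF that] using odd that by (intro odd_form_sum odd_form_const_mult) auto
  have oddV: "odd_form (V $$ (i, j))" if "i < n" "j < n" for i j
    unfolding Vij[OF that] by (simp add: odd_form_const_mult)
  have ordZ: "order_ge G 1 (Z $$ (i, j))" if "i < n" "j < n" for i j
    unfolding Zij[OF that] using ord that by (intro order_ge_sum order_ge_mult_left) auto
  have VMV: "V * M * V = 0\<^sub>m n n" if M: "M \<in> carrier_mat n n" for M
  proof (rule eq_matI)
    fix i j assume ij: "i < dim_row (0\<^sub>m n n)" "j < dim_col (0\<^sub>m n n)"
    then have ij': "i < n" "j < n" by auto
    have VM: "(V * M) $$ (i, k) = ext_const (B $$ (i, 0)) * ext_gen g * M $$ (0, k)" if "k < n" for k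
    proof -
      have "(V * M) $$ (i, k) = (\<Sum>l<n. V $$ (i, l) * M $$ (l, k))"
        using that ij' V M by (simp add: scalar_prod_def lessThan_atLeast0)
      also have "\<dots> = (\<Sum>l<n. if l = 0 then ext_const (B $$ (i, 0)) * ext_gen g * M $$ (0, k) else 0)"
        using ij' by (intro sum.cong) (auto simp: Vij)
      finally have "(V * M) $$ (i, k) = (\<Sum>l<n. if l = 0 then ext_const (B $$ (i, 0)) * ext_gen g * M $$ (0, k) else 0)" .
      then show ?thesis using n by simp
    qed
    have "(V * M * V) $$ (i, j) = (\<Sum>k<n. (V * M) $$ (i, k) * V $$ (k, j))"
      by (rule index_mult_mat_carrier[OF mult_carrier_mat[OF V M] V ij'])
    also have "\<dots> = 0"
    proof (rule sum.neutral, rule ballI)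
      fix k assume "k \<in> {..<n}"
      then have k: "k < n" by simp
      have "ext_const (B $$ (i, 0)) * ext_gen g * M $$ (0, k) * (ext_const (B $$ (k, 0)) * ext_gen g)
          = ext_const (B $$ (i, 0)) * (ext_gen g * (M $$ (0, k) * ext_const (B $$ (k, 0))) * ext_gen g)"
        by (simp only: mult.assoc)
      then show "(V * M) $$ (i, k) * V $$ (k, j) = 0"
        unfolding VM[OF k] Vij[OF k ij'(2)] by (simp add: gen_mult_gen)
    qed
    finally show "(V * M * V) $$ (i, j) = 0\<^sub>m n n $$ (i, j)" using ij' by simp
  qed (use V in auto)
  have "?Bc * (U + ?E) = Z + V"
    unfolding Z_def V_def by (rule mult_add_distrib_mat[OF Bc U E])
  then have "mat_trace ((?Bc * (U + ?E)) ^\<^sub>m (2 * n - 1))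
      = mat_trace (Z ^\<^sub>m (2 * n - 1)) + of_nat (2 * n - 1) * mat_trace (V * Z ^\<^sub>m (2 * n - 1 - 1))"
    using mat_trace_pow_add_rank_one[OF Z V oddZ oddV VMV, of "2 * n - 1"] n by simp
  also have "mat_trace (Z ^\<^sub>m (2 * n - 1)) = 0"
    unfolding mat_trace_def
  proof (rule sum.neutral, rule ballI)
    fix i assume "i \<in> {..<dim_row (Z ^\<^sub>m (2 * n - 1))}"
    then have i: "i < n" using Z by simp
    show "(Z ^\<^sub>m (2 * n - 1)) $$ (i, i) = 0"
      by (rule order_ge_imp_zero[OF order_ge_mat_pow[OF Z ordZ i i] G])
  qed
  finally have start: "mat_trace ((?Bc * (U + ?E)) ^\<^sub>m (2 * n - 1))
      = of_nat (2 * n - 1) * mat_trace (V * Z ^\<^sub>m (2 * (n - 1)))"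
    by (simp only: add_0 diff_mult_distrib2 mult_1_right diff_diff_left one_add_one)
  define A :: "('g, 'r) evenalg mat" where "A = mat n n (\<lambda>(i, j). \<Sum>x\<in>{0..<n} \<times> {0..<n}.
      even_const (B $$ x) * wedge (U $$ (i, fst x)) (U $$ (snd x, j)))"
  let ?Be = "map_mat even_const B :: ('g, 'r) evenalg mat"
  define Y where "Y = ?Be * A"
  have A: "A \<in> carrier_mat n n" and Be: "?Be \<in> carrier_mat n n" using B by (auto simp: A_def)
  then have Y: "Y \<in> carrier_mat n n" by (auto simp: Y_def)
  have "map_mat form_of A = U * ?Bc * U"
  proof (rule eq_matI)
    fix i j assume "i < dim_row (U * ?Bc * U)" "j < dim_col (U * ?Bc * U)"
    then have ij: "i < n" "j < n" using U by auto
    have "form_of (A $$ (i, j)) = (\<Sum>x\<in>{0..<n} \<times> {0..<n}.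
        ext_const (B $$ x) * (U $$ (i, fst x) * U $$ (snd x, j)))"
      using ij odd by (auto simp: A_def form_of_sum times_evenalg.rep_eq even_const.rep_eq form_of_wedge intro!: sum.cong)
    also have "\<dots> = (\<Sum>k = 0..<n. \<Sum>l = 0..<n. U $$ (i, k) * ext_const (B $$ (k, l)) * U $$ (l, j))"
      unfolding sum.cartesian_product'
      by (intro sum.cong refl) (simp add: mult.assoc[symmetric] ext_const_commute)
    also have "\<dots> = (\<Sum>l = 0..<n. (\<Sum>k = 0..<n. U $$ (i, k) * ext_const (B $$ (k, l))) * U $$ (l, j))"
      unfolding sum_distrib_right by (rule sum.swap)
    also have "\<dots> = (U * ?Bc * U) $$ (i, j)"
    proof -
      have "(U * ?Bc) $$ (i, l) = (\<Sum>k = 0..<n. U $$ (i, k) * ext_const (B $$ (k, l)))" if "l < n" for l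
        using index_mult_mat_carrier[OF U Bc ij(1) that] that B by (simp add: lessThan_atLeast0)
      then show ?thesis
        unfolding index_mult_mat_carrier[OF mult_carrier_mat[OF U Bc] U ij] lessThan_atLeast0
        by (intro sum.cong) auto
    qed
    finally show "map_mat form_of A $$ (i, j) = (U * ?Bc * U) $$ (i, j)" using ij A by simp
  qed (use A U in auto)
  moreover have "map_mat form_of ?Be = ?Bc"
    by (intro eq_matI) (auto simp: even_const.rep_eq)
  ultimately have "map_mat form_of Y = ?Bc * (U * ?Bc * U)"
    unfolding Y_def form_of.mat_hom_mult[OF Be A] by simp
  also have "\<dots> = ?Bc * (U * (?Bc * U))"
    by (simp only: assoc_mult_mat[OF U Bc U])
  also have "\<dots> = Z * Z"
    unfolding Z_def by (rule assoc_mult_mat[OF Bc U mult_carrier_mat[OF Bc U], symmetric])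
  finally have YZ: "map_mat form_of (Y ^\<^sub>m k) = Z ^\<^sub>m (2 * k)" for k
    by (simp add: form_of.mat_hom_pow[OF Y] pow_mat_square[OF Z])
  have Yk: "form_of ((Y ^\<^sub>m k) $$ (i, j)) = (Z ^\<^sub>m (2 * k)) $$ (i, j)" if "i < n" "j < n" for i j k
    using that Y by (simp flip: YZ)
  have torsion': "x = 0" if "k > 0" "of_nat k * x = 0" for k and x :: "('g, 'r) evenalg"
    using of_nat_mult_evenalg_eq_0[OF torsion[OF that(1)] that(2)] .
  have trY: "mat_trace (Y ^\<^sub>m k) = 0" if k: "k > 0" for k
  proof (rule torsion'[of 2])
    have "form_of (mat_trace (Y ^\<^sub>m k)) = mat_trace (Z ^\<^sub>m (2 * k))"
      using Y Z Yk by (simp add: mat_trace_def form_of_sum)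
    also have "2 * k = Suc (2 * k - 1)" using k by simp
    also have "Z ^\<^sub>m Suc (2 * k - 1) = Z * Z ^\<^sub>m (2 * k - 1)" by (rule pow_mat_Suc_left[OF Z])
    also have "mat_trace \<dots> = - mat_trace (Z ^\<^sub>m (2 * k - 1) * Z)"
    proof (rule mat_trace_anticommute[OF Z pow_carrier_mat[OF Z]])
      fix i j assume "i < n" "j < n"
      then show "Z $$ (i, j) * (Z ^\<^sub>m (2 * k - 1)) $$ (j, i) = - ((Z ^\<^sub>m (2 * k - 1)) $$ (j, i) * Z $$ (i, j))"
        using odd_mat_pow[OF Z oddZ, of j i "2 * k - 1"] oddZ k by (intro odd_form_anticommute) auto
    qed
    also have "Z ^\<^sub>m (2 * k - 1) * Z = Z ^\<^sub>m (2 * k)" using k by (metis Suc_pred' nat_0_less_mult_iff pow_mat.simps(2) zero_less_numeral)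
    also have "mat_trace \<dots> = form_of (mat_trace (Y ^\<^sub>m k))"
      using Y Z Yk by (simp add: mat_trace_def form_of_sum)
    finally have "form_of (mat_trace (Y ^\<^sub>m k)) + form_of (mat_trace (Y ^\<^sub>m k)) = 0"
      by (rule eq_neg_iff_add_eq_0[THEN iffD1])
    then have "mat_trace (Y ^\<^sub>m k) + mat_trace (Y ^\<^sub>m k) = 0"
      by (intro form_of_eqI) (simp only: plus_evenalg.rep_eq zero_evenalg.rep_eq)
    then show "of_nat 2 * mat_trace (Y ^\<^sub>m k) = 0" unfolding of_nat_numeral mult_2 .
  qed simp
  have adj: "(Y ^\<^sub>m (n - 1)) $$ (0, i) = (- 1) ^ (n - 1) * cofactor Y i 0" if "i < n" for i
    by (rule adj_mat_eq_power[OF Y n torsion' trY n that])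
  have "mat_trace (V * Z ^\<^sub>m (2 * (n - 1))) = (\<Sum>i<n. \<Sum>j<n. V $$ (i, j) * (Z ^\<^sub>m (2 * (n - 1))) $$ (j, i))"
    by (rule mat_trace_mult[OF V pow_carrier_mat[OF Z]])
  also have "\<dots> = (\<Sum>i<n. \<Sum>j<n. if j = 0 then ext_gen g * form_of (even_const (B $$ (i, 0)) * ((- 1) ^ (n - 1) * cofactor Y i 0)) else 0)"
  proof (intro sum.cong refl)
    fix i j assume ij: "i \<in> {..<n}" "j \<in> {..<n}"
    show "V $$ (i, j) * (Z ^\<^sub>m (2 * (n - 1))) $$ (j, i)
        = (if j = 0 then ext_gen g * form_of (even_const (B $$ (i, 0)) * ((- 1) ^ (n - 1) * cofactor Y i 0)) else 0)"
    proof (cases "j = 0")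
      case True
      have "ext_const (B $$ (i, 0)) * ext_gen g * x = ext_gen g * (ext_const (B $$ (i, 0)) * x)" for x :: "('g, 'r) extalg"
        by (simp only: ext_const_commute[of _ "ext_gen g"] mult.assoc)
      then show ?thesis
        using ij True Yk[of 0 i "n - 1"] adj[of i]
        by (simp add: Vij times_evenalg.rep_eq even_const.rep_eq)
    qed (use ij in \<open>simp add: Vij\<close>)
  qed
  also have "\<dots> = ext_gen g * form_of (\<Sum>i<n. even_const (B $$ (i, 0)) * ((- 1) ^ (n - 1) * cofactor Y i 0))"
    using n by (simp add: form_of_sum sum_distrib_left)
  also have "(\<Sum>i<n. even_const (B $$ (i, 0)) * ((- 1) ^ (n - 1) * cofactor Y i 0))
      = (- 1) ^ (n - 1) * (\<Sum>i<n. even_const (B $$ (i, 0)) * cofactor Y i 0)"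
    by (simp add: sum_distrib_left mult_ac)
  also have "(\<Sum>i<n. even_const (B $$ (i, 0)) * cofactor Y i 0) = even_const (det B) * cofactor A 0 0"
    using sum_col_cofactor_mult[OF Be A n] B n by (simp add: Y_def even_const.hom_det)
  also have "cofactor A 0 0 = det (mat_delete A 0 0)" by (simp add: cofactor_def)
  also have "\<dots> = det_on {0..<n - 1} (\<lambda>i j. mat_delete A 0 0 $$ (i, j))"
    by (rule det_eq_det_on) (use A in \<open>simp add: mat_delete_def\<close>)
  also have "\<dots> = det_on {0..<n - 1} (\<lambda>r r'. \<Sum>x\<in>{0..<n} \<times> {0..<n}. even_const (B $$ x) *
          wedge (U $$ (Suc r, fst x)) (U $$ (snd x, Suc r')))"
    by (rule det_on_cong) (simp add: mat_delete_def A_def)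
  finally show ?thesis
    unfolding start by (simp add: even_const_mult even_const.hom_power even_const.hom_uminus mult.assoc)
qed

section \<open>The form of a type as a product of row and column sums\<close>

lemma odd_form_mult_prod_list:
  fixes x :: "('g :: linorder, 'r :: comm_ring_1) extalg"
  assumes "odd_form x" "\<And>y. y \<in> set ys \<Longrightarrow> odd_form y"
  shows "x * prod_list ys = (- 1) ^ length ys * (prod_list ys * x)"
  using assms(2)
proof (induction ys)
  case (Cons y ys)
  have "x * (y * prod_list ys) = - (y * (x * prod_list ys))"
    using odd_form_anticommute[OF assms(1), of y] Cons.prems by (simp flip: mult.assoc)
  also have "\<dots> = - (y * ((- 1) ^ length ys * (prod_list ys * x)))" using Cons by simp
  also have "\<dots> = - ((- 1) ^ length ys * (y * (prod_list ys * x)))"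
    by (cases "even (length ys)") simp_all
  finally show ?case by (simp add: mult.assoc)
qed simp

text \<open>
  After a factor \<open>g\<close>, all further multiples of \<open>g\<close> can be dropped.
\<close>

lemma gen_mult_prod_list_add:
  "ext_gen g * q * prod_list (map (\<lambda>c. f c + l c * ext_gen g) cs) = ext_gen g * q * prod_list (map f cs)"
proof (induction cs arbitrary: q)
  case (Cons c cs)
  have "ext_gen g * q * (f c + l c * ext_gen g) = ext_gen g * (q * f c) + ext_gen g * (q * l c) * ext_gen g"
    by (simp only: distrib_left mult.assoc)
  also have "\<dots> = ext_gen g * (q * f c)" by (simp only: gen_mult_gen add_0_right)
  finally show ?case using Cons[of "q * f c"] by (simp flip: mult.assoc)
qed simp

text \<open>
  Laplace expansion along the first column: once \<open>w r\<close> is taken from the first factor, it may be deleted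
  from all others, which leaves the matrix without row \<open>r\<close>; moving \<open>w r\<close> to its place gives the sign.
\<close>

lemma prod_list_linear_eq_det:
  fixes w :: "nat \<Rightarrow> 'g :: linorder"
  assumes "A \<in> carrier_mat N N"
  shows "prod_list (map (\<lambda>c. \<Sum>r<N. of_int (A $$ (r, c)) * ext_gen (w r)) [0..<N])
    = of_int (det A) * (prod_list (map (\<lambda>r. ext_gen (w r)) [0..<N]) :: ('g, 'r :: comm_ring_1) extalg)"
  using assms
proof (induction N arbitrary: A w)
  case 0
  then show ?case by simp
next
  case (Suc N)
  note A = Suc.prems
  let ?g = "\<lambda>r. ext_gen (w r) :: ('g, 'r) extalg"
  let ?C = "\<lambda>c. \<Sum>r<Suc N. of_int (A $$ (r, c)) * ?g r"
  let ?P = "prod_list (map ?C (map Suc [0..<N]))"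
  let ?all = "prod_list (map ?g [0..<Suc N])"
  have row: "?g r * ?P = of_int (cofactor A r 0) * ?all" if r: "r < Suc N" for r
  proof -
    define u where "u = (\<lambda>i. if i < r then i else Suc i)"
    have bij: "bij_betw u {..<N} ({..<Suc N} - {r})"
    proof (rule bij_betw_byWitness[where f' = "\<lambda>i. if i < r then i else i - 1"])
      show "u ` {..<N} \<subseteq> {..<Suc N} - {r}" by (auto simp: u_def)
      show "(\<lambda>i. if i < r then i else i - 1) ` ({..<Suc N} - {r}) \<subseteq> {..<N}" using r by auto
    qed (use r in \<open>auto simp: u_def\<close>)
    have C: "?C (Suc c) = (\<Sum>i<N. of_int (mat_delete A r 0 $$ (i, c)) * ?g (u i)) + of_int (A $$ (r, Suc c)) * ?g r"
      if c: "c < N" for c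
    proof -
      have "?C (Suc c) = of_int (A $$ (r, Suc c)) * ?g r + (\<Sum>i\<in>{..<Suc N} - {r}. of_int (A $$ (i, Suc c)) * ?g i)"
        using r by (intro sum.remove) auto
      also have "(\<Sum>i\<in>{..<Suc N} - {r}. of_int (A $$ (i, Suc c)) * ?g i) = (\<Sum>i<N. of_int (A $$ (u i, Suc c)) * ?g (u i))"
        using bij by (rule sum.reindex_bij_betw[symmetric])
      also have "\<dots> = (\<Sum>i<N. of_int (mat_delete A r 0 $$ (i, c)) * ?g (u i))"
        using A c by (intro sum.cong refl) (simp add: mat_delete_def u_def)
      finally show ?thesis by (simp add: add.commute)
    qed
    have "?P = prod_list (map (\<lambda>c. (\<Sum>i<N. of_int (mat_delete A r 0 $$ (i, c)) * ?g (u i)) + of_int (A $$ (r, Suc c)) * ?g r) [0..<N])"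
      unfolding map_map
      by (intro arg_cong[of _ _ prod_list] map_cong refl) (simp only: comp_apply set_upt atLeastLessThan_iff C)
    then have "?g r * ?P = ?g r * prod_list (map (\<lambda>c. \<Sum>i<N. of_int (mat_delete A r 0 $$ (i, c)) * ?g (u i)) [0..<N])"
      using gen_mult_prod_list_add[of "w r" 1 "\<lambda>c. \<Sum>i<N. of_int (mat_delete A r 0 $$ (i, c)) * ?g (u i)"
          "\<lambda>c. of_int (A $$ (r, Suc c))" "[0..<N]"] by simp
    also have "\<dots> = ?g r * (of_int (det (mat_delete A r 0)) * prod_list (map (\<lambda>i. ?g (u i)) [0..<N]))"
      using Suc.IH[of "mat_delete A r 0" "\<lambda>i. w (u i)"] A by (simp add: mat_delete_def)
    also have "\<dots> = of_int (det (mat_delete A r 0)) * (?g r * prod_list (map (\<lambda>i. ?g (u i)) [0..<N]))"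
      by (simp only: mult.assoc[symmetric] mult_of_int_commute[of _ "?g r"])
    also have "map (\<lambda>i. ?g (u i)) [0..<N] = map ?g [0..<r] @ map ?g [Suc r..<Suc N]"
    proof -
      have "[0..<N] = [0..<r] @ [r..<N]" using r by (metis le_add_diff_inverse less_Suc_eq_le upt_add_eq_append zero_le)
      moreover have "map (\<lambda>i. ?g (u i)) [0..<r] = map ?g [0..<r]" by (simp add: u_def)
      moreover have "map (\<lambda>i. ?g (u i)) [r..<N] = map ?g (map Suc [r..<N])" by (simp add: u_def)
      ultimately show ?thesis by (simp only: map_append map_Suc_upt)
    qed
    also have "?g r * prod_list (map ?g [0..<r] @ map ?g [Suc r..<Suc N])
        = (- 1) ^ r * (prod_list (map ?g [0..<r]) * ?g r * prod_list (map ?g [Suc r..<Suc N]))"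
    proof -
      have "?g r * prod_list (map ?g [0..<r]) = (- 1) ^ r * (prod_list (map ?g [0..<r]) * ?g r)"
        using odd_form_mult_prod_list[of "?g r" "map ?g [0..<r]"] by fastforce
      then show ?thesis by (simp only: prod_list.append mult.assoc[symmetric])
    qed
    also have "prod_list (map ?g [0..<r]) * ?g r * prod_list (map ?g [Suc r..<Suc N]) = ?all"
    proof -
      have "[0..<Suc N] = [0..<r] @ r # [Suc r..<Suc N]"
        using r by (metis le_add_diff_inverse less_imp_le upt_add_eq_append upt_conv_Cons zero_le)
      then show ?thesis by (simp only: map_append list.map prod_list.append prod_list.Cons mult.assoc)
    qed
    finally show ?thesis by (simp add: cofactor_def mult.assoc[symmetric]) (simp only: mult_of_int_commute)
  qed
  have "prod_list (map ?C [0..<Suc N]) = ?C 0 * ?P"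
    by (simp only: upt_conv_Cons[OF zero_less_Suc] map_Suc_upt list.map prod_list.Cons)
  also have "\<dots> = (\<Sum>r<Suc N. of_int (A $$ (r, 0)) * (?g r * ?P))"
    by (simp only: sum_distrib_right mult.assoc)
  also have "\<dots> = (\<Sum>r<Suc N. of_int (A $$ (r, 0) * cofactor A r 0) * ?all)"
    using row by (intro sum.cong refl) (simp add: mult.assoc del: upt_Suc)
  also have "\<dots> = of_int (det A) * ?all"
    unfolding laplace_expansion_column[OF A zero_less_Suc] by (simp only: sum_distrib_right of_int_sum)
  finally show ?case .
qed

text \<open>
  The second factors pass the first ones of all later wedges.
\<close>

lemma form_of_prod_wedge:
  fixes a b :: "nat \<Rightarrow> ('g :: linorder, 'r :: comm_ring_1) extalg"
  assumes "\<And>i. i < N \<Longrightarrow> odd_form (a i)" "\<And>i. i < N \<Longrightarrow> odd_form (b i)"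
  shows "form_of (\<Prod>i = 0..<N. wedge (a i) (b i))
    = (- 1) ^ (N choose 2) * (prod_list (map a [0..<N]) * prod_list (map b [0..<N]))"
  using assms
proof (induction N)
  case 0
  then show ?case by (simp add: one_evenalg.rep_eq binomial_eq_0)
next
  case (Suc N)
  let ?a = "prod_list (map a [0..<N])" and ?b = "prod_list (map b [0..<N])"
  have "?b * a N = (- 1) ^ N * (a N * ?b)"
  proof -
    have "a N * ?b = (- 1) ^ N * (?b * a N)"
      using odd_form_mult_prod_list[of "a N" "map b [0..<N]"] Suc.prems by fastforce
    then show ?thesis by (cases "even N") simp_all
  qed
  then have "?a * ?b * (a N * b N) = (- 1) ^ N * (?a * a N * (?b * b N))"
  proof -
    assume *: "?b * a N = (- 1) ^ N * (a N * ?b)"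
    have "?a * ?b * (a N * b N) = ?a * (?b * a N) * b N" by (simp only: mult.assoc)
    also have "\<dots> = (- 1) ^ N * (?a * a N * (?b * b N))"
      unfolding * by (cases "even N") (simp_all add: mult.assoc)
    finally show ?thesis .
  qed
  moreover have "(Suc N choose 2) = (N choose 2) + N" by (simp add: numeral_2_eq_2)
  ultimately show ?case
    using Suc by (simp add: times_evenalg.rep_eq form_of_wedge power_add mult.assoc)
qed

text \<open>
  Positive integers are invertible in the coefficient ring.
\<close>

lemma sym_poly_torsion_free:
  fixes x :: sym_poly
  assumes "k > 0" "of_nat k * x = 0"
  shows "x = 0"
proof -
  have "Poly_Mapping.single 0 (1 / of_nat k) * of_nat k = (1 :: sym_poly)"
    using assms(1) by (simp flip: single_of_nat add: mult_single)
  then have "x = Poly_Mapping.single 0 (1 / of_nat k) * (of_nat k * x)"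
    by (simp flip: mult.assoc)
  then show ?thesis using assms(2) by simp
qed

lemma sym_form_square: "odd_form x \<Longrightarrow> x * x = 0" for x :: sym_forms
  using odd_form_square[of x] sym_poly_torsion_free[of 2] by auto

lemma mult_prod_list_eq_0:
  fixes x :: sym_forms
  assumes "odd_form x" "\<And>y. y \<in> set ys \<Longrightarrow> odd_form y" "x \<in> set ys"
  shows "x * prod_list ys = 0"
proof -
  obtain us vs where ys: "ys = us @ x # vs" using assms(3) by (metis split_list)
  have "x * prod_list ys = x * prod_list us * x * prod_list vs" by (simp add: ys mult.assoc)
  also have "x * prod_list us * x = (- 1) ^ length us * (prod_list us * (x * x))"
    using odd_form_mult_prod_list[OF assms(1), of us] assms(2) ys by (simp add: mult.assoc)
  finally show ?thesis by (simp add: sym_form_square[OF assms(1)])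
qed

text \<open>
  If the forms \<open>f 0, \<dots>, f M\<close> add up to zero, then omitting \<open>f k\<close> instead of \<open>f 0\<close> in their
  product only changes the sign: replace \<open>f 0\<close> by minus the sum of the others.
\<close>

lemma prod_list_omit:
  fixes f :: "nat \<Rightarrow> sym_forms"
  assumes odd: "\<And>c. odd_form (f c)" and sum: "(\<Sum>c<Suc M. f c) = 0" and k: "k < Suc M"
  shows "prod_list (map (\<lambda>c. f (if c < k then c else Suc c)) [0..<M])
    = (- 1) ^ k * prod_list (map f [1..<Suc M])"
proof (cases k)
  case 0
  have "map (\<lambda>c. f (Suc c)) [0..<M] = map f [1..<Suc M]"
    by (simp only: One_nat_def map_Suc_upt[symmetric] map_map comp_def)
  then show ?thesis by (simp only: 0 not_less_zero if_False power_0 mult_1)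
next
  case (Suc j)
  have jM: "j < M" using k Suc by simp
  let ?l = "map f [1..<Suc j]" and ?r = "map f [Suc k..<Suc M]"
  have split: "[0..<M] = 0 # [1..<Suc j] @ [Suc j..<M]"
    using jM by (metis One_nat_def Suc_leI le_add_diff_inverse less_imp_le_nat upt_add_eq_append
        upt_conv_Cons zero_less_Suc le_SucI less_le_trans Suc_le_mono le0)
  have m1: "map (\<lambda>c. f (if c < k then c else Suc c)) [1..<Suc j] = ?l" using Suc by simp
  have m2: "map (\<lambda>c. f (if c < k then c else Suc c)) [Suc j..<M] = ?r"
  proof -
    have "map (\<lambda>c. f (if c < k then c else Suc c)) [Suc j..<M] = map f (map Suc [Suc j..<M])"
      using Suc by simp
    then show ?thesis using Suc by (simp only: map_Suc_upt)
  qed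
  have "prod_list (map (\<lambda>c. f (if c < k then c else Suc c)) [0..<M]) = f 0 * prod_list (?l @ ?r)"
    by (simp only: split list.map map_append m1 m2 prod_list.Cons) (simp add: Suc del: upt_Suc)
  also have "f 0 = - (\<Sum>c\<in>{1..M}. f c)"
  proof -
    have "(\<Sum>c<Suc M. f c) = f 0 + (\<Sum>c\<in>{1..M}. f c)"
    proof -
      have "{..<Suc M} = insert 0 {1..M}" by auto
      then show ?thesis by simp
    qed
    then show ?thesis using sum by (simp add: eq_neg_iff_add_eq_0)
  qed
  also have "(- (\<Sum>c\<in>{1..M}. f c)) * prod_list (?l @ ?r) = - (\<Sum>c\<in>{1..M}. f c * prod_list (?l @ ?r))"
    by (simp add: sum_distrib_right)
  also have "(\<Sum>c\<in>{1..M}. f c * prod_list (?l @ ?r)) = (\<Sum>c\<in>{1..M}. if c = k then f k * prod_list (?l @ ?r) else 0)"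
  proof (rule sum.cong)
    fix c assume c: "c \<in> {1..M}"
    show "f c * prod_list (?l @ ?r) = (if c = k then f k * prod_list (?l @ ?r) else 0)"
    proof (cases "c = k")
      case False
      then have "c \<in> set ([1..<Suc j] @ [Suc k..<Suc M])" using c Suc by (auto simp del: upt_Suc)
      then have "f c \<in> set (?l @ ?r)" by (simp only: map_append[symmetric] set_map) (rule imageI)
      then have "f c * prod_list (?l @ ?r) = 0" by (intro mult_prod_list_eq_0) (auto simp: odd)
      then show ?thesis using False by simp
    qed simp
  qed simp
  also have "\<dots> = f k * prod_list (?l @ ?r)" using k Suc by simp
  also have "\<dots> = (- 1) ^ j * (prod_list ?l * f k * prod_list ?r)"
  proof -
    have "f k * prod_list ?l = (- 1) ^ length ?l * (prod_list ?l * f k)"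
      using odd by (intro odd_form_mult_prod_list) auto
    then show ?thesis by (simp only: prod_list.append mult.assoc[symmetric] length_map length_upt diff_Suc_Suc diff_zero One_nat_def)
  qed
  also have "prod_list ?l * f k * prod_list ?r = prod_list (map f [1..<Suc M])"
  proof -
    have "[1..<Suc M] = [1..<Suc j] @ k # [Suc k..<Suc M]"
      using k Suc by (metis One_nat_def Suc_leI less_Suc_eq_le less_imp_le_nat upt_add_eq_append
          le_add_diff_inverse upt_conv_Cons zero_less_Suc)
    then show ?thesis by (simp only: map_append list.map prod_list.append prod_list.Cons mult.assoc)
  qed
  finally show ?thesis using Suc by simp
qed

definition edge_form :: "nat \<times> nat \<Rightarrow> sym_forms" where
  "edge_form p = omega (fst p) (snd p)"

lemma odd_form_edge_form [simp]: "odd_form (edge_form p)"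
  by (simp add: edge_form_def omega_def)

lemma eta_form_eq: "eta_form vs = prod_list (map (\<lambda>r. edge_form (vs ! r)) [0..<length vs])"
proof -
  have "map (\<lambda>(i, j). omega i j) vs = map (\<lambda>r. edge_form (vs ! r)) [0..<length vs]"
    by (rule nth_equalityI) (auto simp: edge_form_def case_prod_unfold)
  then show ?thesis by (simp add: eta_form_def)
qed

definition row_form :: "(nat \<times> nat) set \<Rightarrow> nat \<Rightarrow> sym_forms" where
  "row_form \<nu> i = (\<Sum>p\<in>\<nu>. if fst p = i then edge_form p else 0)"

definition col_form :: "(nat \<times> nat) set \<Rightarrow> nat \<Rightarrow> sym_forms" where
  "col_form \<nu> j = (\<Sum>p\<in>\<nu>. if snd p = j then edge_form p else 0)"

lemma odd_form_row_form [simp]: "odd_form (row_form \<nu> i)"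
  and odd_form_col_form [simp]: "odd_form (col_form \<nu> j)"
  unfolding row_form_def col_form_def by (auto intro!: odd_form_sum)

text \<open>
  The factor \<open>det M \<cdot> \<eta>\<close> is the product of the columns of \<open>M\<close>, read as linear combinations of the
  generators. The columns of the incidence matrix of \<open>\<nu>\<close> are the negatives of the row sums and the column
  sums of the forms in \<open>\<nu>\<close>. This description no longer refers to the ordering \<open>vs\<close>, and as the columns
  add up to zero, the omitted column does not matter either.
\<close>

lemma omega_form_eq_prod_list:
  assumes vs: "distinct vs" "set vs \<subseteq> {0..<n} \<times> {0..<n}" and len: "Suc (length vs) = 2 * n"
    and k: "k < 2 * n"
  shows "omega_form n vs k = (- 1) ^ (n choose 2) *
    prod_list (map (\<lambda>c. if c < n then - row_form (set vs) c else col_form (set vs) (c - n)) [1..<2 * n])"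
proof -
  let ?N = "length vs"
  let ?f = "\<lambda>c. if c < n then - row_form (set vs) c else col_form (set vs) (c - n)"
  let ?A = "delete_col (type_mat n vs) k"
  have A: "?A \<in> carrier_mat ?N ?N" using len by (auto simp: delete_col_def type_mat_def)
  have sum_vs: "(\<Sum>r<?N. F (vs ! r)) = (\<Sum>p\<in>set vs. F p)" for F :: "nat \<times> nat \<Rightarrow> sym_forms"
    using vs(1) by (intro sum.reindex_bij_betw bij_betw_nth) auto
  have lt: "fst p < n" "snd p < n" if "p \<in> set vs" for p using that vs(2) by auto
  have col: "(\<Sum>r<?N. of_int (type_mat n vs $$ (r, c)) * edge_form (vs ! r)) = ?f c" if c: "c < 2 * n" for c
  proof -
    have "(\<Sum>r<?N. of_int (type_mat n vs $$ (r, c)) * edge_form (vs ! r))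
        = (\<Sum>r<?N. of_int (if c = fst (vs ! r) then - 1 else if c = n + snd (vs ! r) then 1 else 0) * edge_form (vs ! r))"
      using c by (intro sum.cong) (auto simp: type_mat_def)
    also have "\<dots> = (\<Sum>p\<in>set vs. of_int (if c = fst p then - 1 else if c = n + snd p then 1 else 0) * edge_form p)"
      by (rule sum_vs)
    also have "\<dots> = ?f c"
    proof (cases "c < n")
      case True
      then show ?thesis
        by (auto simp: row_form_def sum_negf[symmetric] intro!: sum.cong)
    next
      case False
      have "of_int (if c = fst p then - 1 else if c = n + snd p then 1 else 0) * edge_form p
          = (if snd p = c - n then edge_form p else 0)" if "p \<in> set vs" for p
      proof -
        have "c \<noteq> fst p" "c = n + snd p \<longleftrightarrow> snd p = c - n" using lt[OF that] False by auto
        then show ?thesis by simp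
      qed
      then show ?thesis using False by (simp add: col_form_def)
    qed
    finally show ?thesis .
  qed
  have "of_int (det ?A) * eta_form vs
      = prod_list (map (\<lambda>c. \<Sum>r<?N. of_int (?A $$ (r, c)) * ext_gen (Pos (fst (vs ! r)) (snd (vs ! r)))) [0..<?N])"
    unfolding prod_list_linear_eq_det[OF A] eta_form_eq edge_form_def omega_def ..
  also have "map (\<lambda>c. \<Sum>r<?N. of_int (?A $$ (r, c)) * ext_gen (Pos (fst (vs ! r)) (snd (vs ! r)))) [0..<?N]
      = map (\<lambda>c. ?f (if c < k then c else Suc c)) [0..<?N]"
  proof (rule map_cong[OF refl])
    fix c assume "c \<in> set [0..<?N]"
    then have c: "c < ?N" by simp
    then have c': "(if c < k then c else Suc c) < 2 * n" using len by auto
    have "(\<Sum>r<?N. of_int (?A $$ (r, c)) * ext_gen (Pos (fst (vs ! r)) (snd (vs ! r))))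
        = (\<Sum>r<?N. of_int (type_mat n vs $$ (r, if c < k then c else Suc c)) * edge_form (vs ! r))"
      using c len by (intro sum.cong refl) (auto simp: delete_col_def type_mat_def edge_form_def omega_def)
    also have "\<dots> = ?f (if c < k then c else Suc c)" by (rule col[OF c'])
    finally show "(\<Sum>r<?N. of_int (?A $$ (r, c)) * ext_gen (Pos (fst (vs ! r)) (snd (vs ! r))))
        = ?f (if c < k then c else Suc c)" .
  qed
  also have "prod_list \<dots> = (- 1) ^ k * prod_list (map ?f [1..<Suc ?N])"
  proof (rule prod_list_omit)
    show "odd_form (?f c)" for c by (simp add: odd_form_uminus)
    have "(\<Sum>c<n. row_form (set vs) c) = (\<Sum>p\<in>set vs. edge_form p)"
      unfolding row_form_def by (subst sum.swap) (use lt in \<open>simp add: sum.delta\<close>)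
    moreover have "(\<Sum>c<n. col_form (set vs) c) = (\<Sum>p\<in>set vs. edge_form p)"
      unfolding col_form_def by (subst sum.swap) (use lt in \<open>simp add: sum.delta\<close>)
    moreover have "(\<Sum>c<n + l. h c) = (\<Sum>c<n. h c) + (\<Sum>c<l. h (n + c))" for h :: "nat \<Rightarrow> sym_forms" and l
      by (induction l) (simp_all add: add.assoc)
    from this[of ?f n] have "(\<Sum>c<n + n. ?f c) = (\<Sum>c<n. ?f c) + (\<Sum>c<n. ?f (n + c))" .
    ultimately show "(\<Sum>c<Suc ?N. ?f c) = 0"
      unfolding len by (simp add: mult_2 sum_negf)
    show "k < Suc ?N" using k len by simp
  qed
  finally have "of_int (det ?A) * eta_form vs = (- 1) ^ k * prod_list (map ?f [1..<2 * n])"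
    unfolding len .
  then have "omega_form n vs k = (- 1) ^ (n choose 2) * ((- 1) ^ k * ((- 1) ^ k * prod_list (map ?f [1..<2 * n])))"
    by (simp add: omega_form_def power_add mult.assoc)
  then show ?thesis by (cases "even k") simp_all
qed

lemma prod_list_add_annihilated:
  fixes x y :: "nat \<Rightarrow> sym_forms"
  assumes "\<And>r. r \<in> set rs \<Longrightarrow> odd_form (x r)" "\<And>r. r \<in> set rs \<Longrightarrow> odd_form (y r)"
    and "\<And>r. r \<in> set rs \<Longrightarrow> y r * Q = 0"
  shows "prod_list (map (\<lambda>r. x r + y r) rs) * Q = prod_list (map x rs) * Q"
  using assms
proof (induction rs)
  case (Cons r rs)
  let ?P = "prod_list (map x rs)"
  have "y r * ?P = (- 1) ^ length (map x rs) * (?P * y r)"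
    by (rule odd_form_mult_prod_list) (use Cons.prems in auto)
  then have "y r * ?P * Q = (- 1) ^ length rs * (?P * (y r * Q))" by (simp add: mult.assoc)
  also have "\<dots> = 0" using Cons.prems by simp
  finally have "y r * (?P * Q) = 0" by (simp only: mult.assoc)
  moreover have "prod_list (map (\<lambda>r. x r + y r) rs) * Q = ?P * Q" using Cons by simp
  ultimately show ?case by (simp add: mult.assoc distrib_right)
qed simp

lemma prod_list_add_order:
  fixes q :: "('g :: linorder, 'r :: comm_ring_1) extalg"
  assumes "order_ge F m q" "finite F" "card F \<le> m" "\<And>j. j \<in> set js \<Longrightarrow> order_ge F 1 (y j)"
  shows "q * prod_list (map (\<lambda>j. x j + y j) js) = q * prod_list (map x js)"
  using assms(1,4)
proof (induction js arbitrary: q)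
  case (Cons j js)
  have "order_ge F (m + 1) (q * y j)" using Cons.prems by (intro order_ge_mult) auto
  then have "q * y j = 0" using assms(2,3) by (intro order_ge_imp_zero) auto
  then have "q * (x j + y j) = q * x j" by (simp add: distrib_left)
  moreover have "q * x j * prod_list (map (\<lambda>j. x j + y j) js) = q * x j * prod_list (map x js)"
    using Cons.prems by (intro Cons.IH order_ge_mult_right) auto
  ultimately show ?case by (simp flip: mult.assoc)
qed simp

lemma order_ge_prod_list:
  fixes xs :: "('g :: linorder, 'r :: comm_ring_1) extalg list"
  shows "(\<And>x. x \<in> set xs \<Longrightarrow> order_ge F 1 x) \<Longrightarrow> order_ge F (length xs) (prod_list xs)"
proof (induction xs)
  case (Cons x xs)
  then have "order_ge F (1 + length xs) (x * prod_list xs)" by (intro order_ge_mult) auto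
  then show ?case by simp
qed simp

lemma length_off_diagonal:
  assumes \<nu>: "upper_triangular_type n \<nu>" and es: "distinct es" "set es = \<nu> - diag_pos n"
  shows "length es = n - 1"
proof -
  have type: "\<nu> \<subseteq> {0..<n} \<times> {0..<n}" "card \<nu> + 1 = 2 * n" "diag_pos n \<subseteq> \<nu>"
    using \<nu> by (auto simp: upper_triangular_type_def type_of_rank_def)
  have fin: "finite \<nu>" using type(1) by (rule finite_subset) simp
  have "diag_pos n = (\<lambda>i. (i, i)) ` {0..<n}" by (auto simp: diag_pos_def)
  then have "card (diag_pos n) = n" by (simp add: card_image inj_on_def)
  moreover have "card (\<nu> - diag_pos n) = card \<nu> - card (diag_pos n)"
    using type(3) fin by (intro card_Diff_subset) (auto intro: finite_subset)
  ultimately show ?thesis using distinct_card[OF es(1)] es(2) type(2) by simp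
qed

text \<open>
  The coboundary of the vertex \<open>i\<close> in the graph with edges \<open>es\<close>: the forms of the edges at \<open>i\<close>, with
  opposite signs for the outgoing and the incoming ones.
\<close>

definition incidence_form :: "(nat \<times> nat) list \<Rightarrow> nat \<Rightarrow> sym_forms" where
  "incidence_form es i = (\<Sum>e = 0..<length es. (if fst (es ! e) = i then edge_form (es ! e) else 0)
     - (if snd (es ! e) = i then edge_form (es ! e) else 0))"

text \<open>
  Row sums and column sums at a vertex have the same diagonal term and differ by its incidence form.
  Row sums may be changed by multiples of the column sums, which also occur in the product. The
  resulting \<open>n - 1\<close> incidence forms exhaust the off-diagonal generators, so that only the diagonal terms
  of the column sums remain.
\<close>

lemma omega_form_upper_triangular:
  assumes \<nu>: "upper_triangular_type n \<nu>" and n: "odd n"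
    and vs: "distinct vs" "set vs = \<nu>" and es: "distinct es" "set es = \<nu> - diag_pos n"
    and k: "k < 2 * n"
  shows "omega_form n vs k = omega 0 0 * form_of (\<Prod>r = 0..<n - 1. wedge (omega (Suc r) (Suc r))
    (incidence_form es (Suc r)))"
proof -
  obtain m where m: "n = Suc m" using n by (cases n) auto
  have "even m" using n m by simp
  have type: "\<nu> \<subseteq> {0..<n} \<times> {0..<n}" "card \<nu> + 1 = 2 * n" "diag_pos n \<subseteq> \<nu>"
    using \<nu> by (auto simp: upper_triangular_type_def type_of_rank_def)
  have fin: "finite \<nu>" using type(1) by (rule finite_subset) simp
  have diag: "diag_pos n = (\<lambda>i. (i, i)) ` {0..<n}" by (auto simp: diag_pos_def)
  have "length es = m" using length_off_diagonal[OF \<nu> es] m by simp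
  define \<theta> where "\<theta> = (\<lambda>i. omega i i)"
  define \<phi> where "\<phi> = (\<lambda>e. edge_form (es ! e))"
  define \<psi> where "\<psi> = (\<lambda>r. \<Sum>e = 0..<m. (if fst (es ! e) = Suc r then \<phi> e else 0) - (if snd (es ! e) = Suc r then \<phi> e else 0))"
  define \<delta> where "\<delta> = (\<lambda>j. \<Sum>e = 0..<m. if snd (es ! e) = j then \<phi> e else 0)"
  define F where "F = (\<lambda>e. Pos (fst (es ! e)) (snd (es ! e))) ` {0..<m}"
  have F: "finite F" "card F \<le> m" using card_image_le[of "{0..<m}"] by (auto simp: F_def)
  have odd: "odd_form (\<theta> i)" "odd_form (\<phi> e)" for i e by (simp_all add: \<theta>_def \<phi>_def omega_def)
  have odd_\<psi>: "odd_form (\<psi> r)" for r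
    unfolding \<psi>_def using odd by (intro odd_form_sum odd_form_diff) auto
  have ord_\<phi>: "order_ge F 1 (\<phi> e)" if "e < m" for e
    unfolding \<phi>_def edge_form_def omega_def using that by (intro order_ge_gen) (auto simp: F_def)
  have ord_\<psi>: "order_ge F 1 (\<psi> r)" for r
    unfolding \<psi>_def using ord_\<phi> by (intro order_ge_sum order_ge_diff) auto
  have ord_\<delta>: "order_ge F 1 (\<delta> j)" for j
    unfolding \<delta>_def using ord_\<phi> by (intro order_ge_sum) auto
  have split: "(\<Sum>p\<in>\<nu>. f p) = (\<Sum>i<n. f (i, i)) + (\<Sum>e = 0..<m. f (es ! e))" for f :: "nat \<times> nat \<Rightarrow> sym_forms"
  proof -
    have "(\<Sum>p\<in>\<nu>. f p) = (\<Sum>p\<in>\<nu> - diag_pos n. f p) + (\<Sum>p\<in>diag_pos n. f p)"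
      using type(3) fin by (rule sum.subset_diff)
    also have "(\<Sum>p\<in>\<nu> - diag_pos n. f p) = (\<Sum>e = 0..<m. f (es ! e))"
      using es \<open>length es = m\<close> by (intro sum.reindex_bij_betw[symmetric] bij_betw_nth) auto
    also have "(\<Sum>p\<in>diag_pos n. f p) = (\<Sum>i<n. f (i, i))"
      unfolding diag by (subst sum.reindex) (auto simp: inj_on_def lessThan_atLeast0)
    finally show ?thesis by (simp add: add.commute)
  qed
  have col: "col_form \<nu> j = \<theta> j + \<delta> j" if "j < n" for j
    unfolding col_form_def split \<theta>_def \<delta>_def \<phi>_def using that by (simp add: edge_form_def sum.delta)
  have row: "row_form \<nu> i = \<theta> i + (\<Sum>e = 0..<m. if fst (es ! e) = i then \<phi> e else 0)" if "i < n" for i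
    unfolding row_form_def split \<theta>_def \<phi>_def using that by (simp add: edge_form_def sum.delta)
  \<comment> \<open>The diagonal term cancels in the difference of the row sum and the column sum.\<close>
  have rc: "- row_form \<nu> (Suc r) = - \<psi> r + - col_form \<nu> (Suc r)" if "r < m" for r
    using row[of "Suc r"] col[of "Suc r"] that m by (simp add: \<psi>_def \<delta>_def sum_subtractf)
  let ?Q = "prod_list (map (col_form \<nu>) [0..<n])"
  let ?\<Psi> = "prod_list (map (\<lambda>r. - \<psi> r) [0..<m])"
  let ?\<Theta> = "prod_list (map (\<lambda>r. \<theta> (Suc r)) [0..<m])"
  have columns: "map (\<lambda>c. if c < n then - row_form \<nu> c else col_form \<nu> (c - n)) [1..<2 * n]
      = map (\<lambda>r. - row_form \<nu> (Suc r)) [0..<m] @ map (col_form \<nu>) [0..<n]"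
  proof -
    have "[1..<2 * n] = [1..<n] @ [n..<2 * n]"
      using m upt_add_eq_append[of 1 n n] by (simp add: mult_2 del: upt_Suc)
    moreover have "[1..<n] = map Suc [0..<m]" by (simp only: m One_nat_def map_Suc_upt)
    moreover have "[n..<2 * n] = map (\<lambda>j. j + n) [0..<n]"
      using map_add_upt[of n n] by (simp add: mult_2)
    ultimately show ?thesis using m by (simp del: upt_Suc)
  qed
  have "set vs \<subseteq> {0..<n} \<times> {0..<n}" "Suc (length vs) = 2 * n"
    using vs type distinct_card[OF vs(1)] by auto
  then have "omega_form n vs k = (- 1) ^ (n choose 2) * (prod_list (map (\<lambda>r. - row_form \<nu> (Suc r)) [0..<m]) * ?Q)"
    using omega_form_eq_prod_list[OF vs(1) _ _ k] by (simp only: vs(2) columns prod_list.append)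
  also have "prod_list (map (\<lambda>r. - row_form \<nu> (Suc r)) [0..<m]) * ?Q
      = prod_list (map (\<lambda>r. - \<psi> r + - col_form \<nu> (Suc r)) [0..<m]) * ?Q"
    using rc by (intro arg_cong2[of _ _ _ _ "(*)"] arg_cong[of _ _ prod_list] map_cong) auto
  also have "\<dots> = ?\<Psi> * ?Q"
  proof (rule prod_list_add_annihilated)
    fix r assume "r \<in> set [0..<m]"
    then have "Suc r < n" using m by simp
    then have "col_form \<nu> (Suc r) \<in> set (map (col_form \<nu>) [0..<n])"
      by (simp only: set_map) (rule imageI, simp)
    then have "col_form \<nu> (Suc r) * ?Q = 0" by (intro mult_prod_list_eq_0) auto
    then show "- col_form \<nu> (Suc r) * ?Q = 0" by simp
  qed (simp_all add: odd_form_uminus odd_\<psi>)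
  also have "?Q = prod_list (map (\<lambda>j. \<theta> j + \<delta> j) [0..<n])"
    using col by (intro arg_cong[of _ _ prod_list] map_cong) auto
  also have "?\<Psi> * \<dots> = ?\<Psi> * prod_list (map \<theta> [0..<n])"
  proof (rule prod_list_add_order[OF _ F ord_\<delta>])
    have "order_ge F (length (map (\<lambda>r. - \<psi> r) [0..<m])) ?\<Psi>"
      using ord_\<psi> by (intro order_ge_prod_list) (auto intro: order_ge_uminus)
    then show "order_ge F m ?\<Psi>" by simp
  qed
  also have "prod_list (map \<theta> [0..<n]) = \<theta> 0 * ?\<Theta>"
    by (simp only: m upt_conv_Cons[OF zero_less_Suc] map_Suc_upt[symmetric] list.map map_map comp_def prod_list.Cons)
  also have "?\<Psi> * (\<theta> 0 * ?\<Theta>) = \<theta> 0 * (?\<Psi> * ?\<Theta>)"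
  proof -
    have "\<theta> 0 * ?\<Psi> = (- 1) ^ length (map (\<lambda>r. - \<psi> r) [0..<m]) * (?\<Psi> * \<theta> 0)"
      by (rule odd_form_mult_prod_list) (auto simp: odd odd_form_uminus odd_\<psi>)
    then have "\<theta> 0 * ?\<Psi> = ?\<Psi> * \<theta> 0" using \<open>even m\<close> by simp
    then show ?thesis by (simp flip: mult.assoc)
  qed
  finally have "omega_form n vs k = (- 1) ^ (n choose 2) * (\<theta> 0 * (?\<Psi> * ?\<Theta>))" .
  moreover have "form_of (\<Prod>r = 0..<m. wedge (- \<psi> r) (\<theta> (Suc r))) = (- 1) ^ (m choose 2) * (?\<Psi> * ?\<Theta>)"
    by (rule form_of_prod_wedge) (simp_all add: odd odd_form_uminus odd_\<psi>)
  moreover have "wedge (- \<psi> r) (\<theta> (Suc r)) = wedge (\<theta> (Suc r)) (\<psi> r)" for r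
    by (subst wedge_flip[of "\<theta> (Suc r)" "- \<psi> r"]) (simp_all add: odd odd_form_uminus odd_\<psi> wedge_minus_right)
  moreover have "(n choose 2) = (m choose 2) + m" by (simp add: m numeral_2_eq_2)
  ultimately have "omega_form n vs k = \<theta> 0 * form_of (\<Prod>r = 0..<m. wedge (\<theta> (Suc r)) (\<psi> r))"
    using \<open>even m\<close> by (cases "even (m choose 2)") (simp_all add: power_add)
  then show ?thesis
    unfolding \<theta>_def \<psi>_def \<phi>_def m incidence_form_def \<open>length es = m\<close> by (simp only: diff_Suc_1)
qed

section \<open>Orientation sums for the generic symmetric matrix\<close>

lemma nth_concat_pairs:
  "j < 2 * length L \<Longrightarrow> concat (map (\<lambda>i. [f i, g i]) L) ! j = (if even j then f else g) (L ! (j div 2))"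
proof (induction L arbitrary: j)
  case (Cons x L)
  consider "j = 0" | "j = 1" | k where "j = Suc (Suc k)" by (metis One_nat_def not0_implies_Suc)
  then show ?case
  proof cases
    case 3
    then show ?thesis using Cons by simp
  qed simp_all
qed simp

lemma length_sub_list: "length (sub_list es I) = 2 * card I"
proof -
  have "length (concat (map (\<lambda>i. [fst (es ! i), snd (es ! i)]) L)) = 2 * length L" for L
    by (induction L) simp_all
  then show ?thesis by (simp add: sub_list_def)
qed

lemma sub_list_nth:
  "i < 2 * card I \<Longrightarrow> sub_list es I ! i = half_end (\<lambda>e. fst (es ! e)) (\<lambda>e. snd (es ! e)) I i"
  unfolding sub_list_def half_end_def by (subst nth_concat_pairs) auto

text \<open>
  By Muir's identity, the sums of permanents are inverse to the sums of determinants over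
  orientations, up to the sign \<open>(- 1) ^ card T\<close>. The latter are sums of minors over halves, and these are
  absent unless \<open>card T\<close> is even.
\<close>

lemma orient_per_eq_Sigma_poly:
  assumes es: "set es \<subseteq> {..<n} \<times> {..<n}"
  shows "orient_per bvar (\<lambda>e. fst (es ! e)) (\<lambda>e. snd (es ! e)) {0..<length es} = Sigma_poly (generic_sym n) es"
  unfolding Sigma_poly_eq_Sigma_on
proof (rule Sigma_on_unique[where q = "orient_per bvar (\<lambda>e. fst (es ! e)) (\<lambda>e. snd (es ! e))"
      and g = "\<lambda>T. (- 1) ^ card T * orient_det bvar (\<lambda>e. fst (es ! e)) (\<lambda>e. snd (es ! e)) T"])
  fix T assume T: "T \<subseteq> {0..<length es}"
  let ?s = "\<lambda>e. fst (es ! e)" and ?t = "\<lambda>e. snd (es ! e)"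
  have finT: "finite T" using T by (rule finite_subset) simp
  have minor: "det_on {0..<2 * card I} (\<lambda>i j. bvar (half_end ?s ?t I i) (half_end ?s ?t (T - I) j))
      = pair_minor (generic_sym n) es {I, T - I}" if I: "I \<in> halves T" for I
  proof -
    have sub: "I \<subseteq> {0..<length es}" "T - I \<subseteq> {0..<length es}" and card: "card (T - I) = card I"
      using I T by (auto simp: halves_def)
    let ?M = "sub_mat (generic_sym n) (sub_list es I) (sub_list es (T - I))"
    have "pair_minor (generic_sym n) es {I, T - I} = det ?M"
      by (rule pair_minor_eq[OF _ es sub]) (simp add: generic_sym_def bvar_commute)
    also have "\<dots> = det_on {0..<2 * card I} (\<lambda>i j. ?M $$ (i, j))"
      by (rule det_eq_det_on) (simp add: sub_mat_def length_sub_list card)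
    also have "\<dots> = det_on {0..<2 * card I} (\<lambda>i j. bvar (half_end ?s ?t I i) (half_end ?s ?t (T - I) j))"
    proof (rule det_on_cong)
      fix i j assume ij: "i \<in> {0..<2 * card I}" "j \<in> {0..<2 * card I}"
      then have "sub_list es I ! i \<in> set (sub_list es I)" "sub_list es (T - I) ! j \<in> set (sub_list es (T - I))"
        by (auto simp: length_sub_list card)
      then have "sub_list es I ! i < n" "sub_list es (T - I) ! j < n"
        using set_sub_list[OF sub(1) es] set_sub_list[OF sub(2) es] by auto
      then show "?M $$ (i, j) = bvar (half_end ?s ?t I i) (half_end ?s ?t (T - I) j)"
        using ij by (simp add: sub_mat_def generic_sym_def length_sub_list card sub_list_nth)
    qed
    finally show ?thesis by simp
  qed
  have orient_det: "orient_det bvar ?s ?t T = (\<Sum>I\<in>halves T. pair_minor (generic_sym n) es {I, T - I})"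
    using orient_det_eq_sum_minors[of bvar T ?s ?t] sym_poly_torsion_free bvar_commute finT minor
    by (metis (no_types, lifting) sum.cong)
  show "(- 1) ^ card T * orient_det bvar ?s ?t T = (\<Sum>I\<in>halves T. pair_minor (generic_sym n) es {I, T - I})"
  proof (cases "halves T = {}")
    case True
    then show ?thesis by (simp add: orient_det)
  next
    case False
    then obtain I where I: "I \<subseteq> T" "card I = card (T - I)" by (auto simp: halves_def)
    then have "card T = card I + card I"
      using finT by (metis card_Diff_subset card_mono finite_subset le_add_diff_inverse)
    then show ?thesis by (simp add: orient_det)
  qed
qed (simp_all add: orient_det_per_convolution)

lemma orient_per_odd_eq_0:
  assumes "odd (card S)" "finite S"
  shows "orient_per bvar s t S = 0"
proof (rule sym_poly_torsion_free[of 2])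
  have "orient_per bvar s t S = - orient_per bvar s t S"
    using orient_per_reverse[OF assms(2), of bvar s t] bvar_commute assms(1) by simp
  then have "orient_per bvar s t S + orient_per bvar s t S = 0" by (rule eq_neg_iff_add_eq_0[THEN iffD1])
  then show "of_nat 2 * orient_per bvar s t S = 0" unfolding of_nat_numeral mult_2 .
qed simp

section \<open>The trace for upper-triangular types\<close>

text \<open>
  Row and column \<open>0\<close> are singled out: \<open>\<omega>\<close> at \<open>(0, 0)\<close> is the additional generator in the reduction of
  the odd power to a determinant, which leaves the rows \<open>Suc r\<close> for \<open>r < n - 1\<close>. There are as many of them
  as there are off-diagonal positions, so that rows and edges share the index set.
\<close>

lemma trace_upper_triangular:
  assumes \<nu>: "upper_triangular_type n \<nu>" and es: "distinct es" "set es = \<nu> - diag_pos n"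
  shows "mat_trace ((map_mat ext_const (generic_sym n) * Upsilon n \<nu>) ^\<^sub>m (2 * n - 1))
    = of_nat (2 * n - 1) * (omega 0 0 * form_of (
        even_const ((- 1) ^ (n - 1) * det (generic_sym n) *
          orient_per bvar (\<lambda>e. fst (es ! e)) (\<lambda>e. snd (es ! e)) {0..<n - 1}) *
        (\<Prod>r = 0..<n - 1. wedge (omega (Suc r) (Suc r))
          (incidence_form es (Suc r)))))"
proof -
  let ?s = "\<lambda>e. fst (es ! e)" and ?t = "\<lambda>e. snd (es ! e)"
  have type: "\<nu> \<subseteq> {0..<n} \<times> {0..<n}" "card \<nu> + 1 = 2 * n" "diag_pos n \<subseteq> \<nu>"
    and up: "\<nu> \<subseteq> {(i, j). i \<le> j \<and> j < n}"
    using \<nu> by (auto simp: upper_triangular_type_def type_of_rank_def)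
  have fin: "finite \<nu>" using type(1) by (rule finite_subset) simp
  have n: "n > 0" using type(2) by simp
  have dd: "(i, i) \<in> \<nu>" if "i < n" for i using type(3) that by (auto simp: diag_pos_def)
  have len: "length es = n - 1" by (rule length_off_diagonal[OF \<nu> es])
  define G where "G = (\<lambda>p. Pos (fst p) (snd p)) ` (\<nu> - {(0, 0)})"
  define U where "U = mat n n (\<lambda>(i, j). if i = 0 \<and> j = 0 then 0 else Upsilon n \<nu> $$ (i, j))"
  have U: "U \<in> carrier_mat n n" by (simp add: U_def)
  have Uij: "U $$ (i, j) = (if i = 0 \<and> j = 0 then 0 else if (i, j) \<in> \<nu> then omega i j
      else if (j, i) \<in> \<nu> then omega j i else 0)" if "i < n" "j < n" for i j
    using that by (simp add: U_def Upsilon_def)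
  have UE: "Upsilon n \<nu> = U + mat n n (\<lambda>(i, j). if i = 0 \<and> j = 0 then ext_gen (Pos 0 0) else 0)"
    using dd[OF n] by (intro eq_matI) (auto simp: U_def Upsilon_def omega_def)
  have oddU: "odd_form (U $$ (i, j))" if "i < n" "j < n" for i j
    unfolding Uij[OF that] by (simp add: omega_def)
  have ordU: "order_ge G 1 (U $$ (i, j))" if "i < n" "j < n" for i j
  proof -
    have g: "order_ge G 1 (omega i j)" if "(i, j) \<in> \<nu>" "(i, j) \<noteq> (0, 0)" for i j
      unfolding omega_def G_def using that by (intro order_ge_gen) force
    show ?thesis unfolding Uij[OF that] using g by auto
  qed
  have G: "finite G" "card G < 2 * n - 1"
  proof -
    show "finite G" using fin by (simp add: G_def)
    have "card G \<le> card (\<nu> - {(0, 0)})" unfolding G_def using fin by (intro card_image_le) auto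
    also have "\<dots> < card \<nu>" using fin dd[OF n] by (intro card_Diff1_less) auto
    finally show "card G < 2 * n - 1" using type(2) by simp
  qed
  have B: "generic_sym n \<in> carrier_mat n n" by (simp add: generic_sym_def)
  define S where "S = {0..<n - 1}"
  define K where "K = {0..<n}"
  have esn: "?s e < ?t e" "?s e < n" "?t e < n" if "e \<in> S" for e
  proof -
    have "es ! e \<in> set es" using that len by (simp add: S_def)
    then have "es ! e \<in> \<nu>" "es ! e \<notin> diag_pos n" using es(2) by auto
    then have "?s e \<le> ?t e" "?t e < n" "?s e \<noteq> ?t e"
      using up by (auto simp: diag_pos_def prod_eq_iff) 
    then show "?s e < ?t e" "?s e < n" "?t e < n" by auto
  qed
  have sum_es: "(\<Sum>e\<in>S. f (es ! e)) = (\<Sum>p\<in>\<nu> - diag_pos n. f p)" for f :: "nat \<times> nat \<Rightarrow> sym_forms"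
    unfolding S_def using es len by (intro sum.reindex_bij_betw bij_betw_nth) auto
  have pick: "(\<Sum>e\<in>S. if fst (es ! e) = a \<and> snd (es ! e) = c then edge_form (es ! e) else 0)
      = (if (a, c) \<in> \<nu> - diag_pos n then omega a c else 0)" for a c
  proof -
    have "(\<Sum>e\<in>S. if fst (es ! e) = a \<and> snd (es ! e) = c then edge_form (es ! e) else 0)
        = (\<Sum>p\<in>\<nu> - diag_pos n. if fst p = a \<and> snd p = c then edge_form p else 0)"
      by (rule sum_es)
    also have "\<dots> = (\<Sum>p\<in>\<nu> - diag_pos n. if p = (a, c) then omega a c else 0)"
      by (intro sum.cong) (auto simp: edge_form_def prod_eq_iff)
    also have "\<dots> = (if (a, c) \<in> \<nu> - diag_pos n then omega a c else 0)"
      using fin by (intro sum.delta) simp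
    finally show ?thesis .
  qed
  define F where "F = (\<lambda>e. Pos (?s e) (?t e)) ` S"
  have F: "finite F" "card F \<le> card S" using card_image_le[of S] by (auto simp: F_def S_def)
  have gram: "det_on S (\<lambda>r r'. \<Sum>x\<in>K \<times> K. even_const (bvar (fst x) (snd x)) *
        wedge (U $$ (Suc r, fst x)) (U $$ (Suc r', snd x)))
      = even_const (orient_per bvar ?s ?t S) * (\<Prod>r\<in>S. wedge (omega (Suc r) (Suc r))
          (\<Sum>e\<in>S. (if ?s e = Suc r then edge_form (es ! e) else 0) - (if ?t e = Suc r then edge_form (es ! e) else 0)))"
  proof (rule det_edge_forms[of S K ?s ?t "\<lambda>r. omega (Suc r) (Suc r)" "\<lambda>e. edge_form (es ! e)" F
        "\<lambda>r k. U $$ (Suc r, k)" Suc bvar])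
    show "order_ge F 1 (edge_form (es ! e))" if "e \<in> S" for e
      unfolding edge_form_def omega_def using that by (intro order_ge_gen) (auto simp: F_def)
    show "U $$ (Suc r, k) = (if k = Suc r then omega (Suc r) (Suc r) else 0) +
        (\<Sum>e\<in>S. (if ?s e = Suc r \<and> ?t e = k then edge_form (es ! e) else 0)
          + (if ?t e = Suc r \<and> ?s e = k then edge_form (es ! e) else 0))"
      if r: "r \<in> S" and k: "k \<in> K" for r k
    proof -
      have lt: "Suc r < n" "k < n" using r k by (auto simp: S_def K_def)
      have "(\<Sum>e\<in>S. (if ?s e = Suc r \<and> ?t e = k then edge_form (es ! e) else 0)
          + (if ?t e = Suc r \<and> ?s e = k then edge_form (es ! e) else 0))
        = (if (Suc r, k) \<in> \<nu> - diag_pos n then omega (Suc r) k else 0)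
          + (if (k, Suc r) \<in> \<nu> - diag_pos n then omega k (Suc r) else 0)"
        by (simp only: sum.distrib pick conj_commute[of "?t _ = Suc r"])
      moreover have "(Suc r, k) \<in> diag_pos n \<longleftrightarrow> k = Suc r" "(k, Suc r) \<in> diag_pos n \<longleftrightarrow> k = Suc r"
        using lt by (auto simp: diag_pos_def)
      moreover have "k = Suc r" if "(Suc r, k) \<in> \<nu>" "(k, Suc r) \<in> \<nu>"
        using that up by (auto intro: le_antisym)
      ultimately show ?thesis
        unfolding Uij[OF lt] using dd[OF lt(1)] by (cases "k = Suc r") auto
    qed
  qed (use F esn in \<open>auto simp: S_def K_def omega_def sym_form_square\<close>)
  have "mat_trace ((map_mat ext_const (generic_sym n) * Upsilon n \<nu>) ^\<^sub>m (2 * n - 1))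
      = of_nat (2 * n - 1) * (ext_gen (Pos 0 0) * form_of (even_const ((- 1) ^ (n - 1) * det (generic_sym n)) *
        det_on {0..<n - 1} (\<lambda>r r'. \<Sum>x\<in>{0..<n} \<times> {0..<n}. even_const (generic_sym n $$ x) *
          wedge (U $$ (Suc r, fst x)) (U $$ (snd x, Suc r')))))"
    unfolding UE by (rule trace_odd_power[OF sym_poly_torsion_free n B U oddU ordU G])
  also have "det_on {0..<n - 1} (\<lambda>r r'. \<Sum>x\<in>{0..<n} \<times> {0..<n}. even_const (generic_sym n $$ x) *
          wedge (U $$ (Suc r, fst x)) (U $$ (snd x, Suc r')))
      = det_on S (\<lambda>r r'. \<Sum>x\<in>K \<times> K. even_const (bvar (fst x) (snd x)) *
        wedge (U $$ (Suc r, fst x)) (U $$ (Suc r', snd x)))"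
    unfolding S_def K_def
  proof (intro det_on_cong sum.cong refl)
    fix r r' x assume r: "r \<in> {0..<n - 1}" "r' \<in> {0..<n - 1}" and x: "x \<in> {0..<n} \<times> {0..<n}"
    have "i = j" if "(i, j) \<in> \<nu>" "(j, i) \<in> \<nu>" for i j
      using that up by (auto intro: le_antisym)
    from this[of "snd x" "Suc r'"] have "U $$ (snd x, Suc r') = U $$ (Suc r', snd x)"
      using r x by (auto simp: Uij)
    then show "even_const (generic_sym n $$ x) * wedge (U $$ (Suc r, fst x)) (U $$ (snd x, Suc r'))
        = even_const (bvar (fst x) (snd x)) * wedge (U $$ (Suc r, fst x)) (U $$ (Suc r', snd x))"
      using x by (auto simp: generic_sym_def)
  qed
  finally show ?thesis
    unfolding gram by (simp only: S_def even_const_mult mult.assoc omega_def incidence_form_def len)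
qed

theorem theorem44:
  fixes n :: nat and \<nu> :: "(nat \<times> nat) set"
  assumes "upper_triangular_type n \<nu>"
  shows "(odd n \<longrightarrow>
      (\<forall>vs es k. distinct vs \<and> set vs = \<nu> \<and> distinct es \<and> set es = \<nu> - diag_pos n \<and> k < 2 * n \<longrightarrow>
        mat_trace ((map_mat ext_const (generic_sym n) * Upsilon n \<nu>) ^\<^sub>m (2 * n - 1)) =
          of_nat (2 * n - 1) * ext_const (det (generic_sym n) * Sigma_poly (generic_sym n) es)
            * omega_form n vs k)) \<and>
    (even n \<longrightarrow>
      mat_trace ((map_mat ext_const (generic_sym n) * Upsilon n \<nu>) ^\<^sub>m (2 * n - 1)) = 0)"
proof (intro conjI impI allI)
  fix vs es k
  assume n: "odd n" and *: "distinct vs \<and> set vs = \<nu> \<and> distinct es \<and> set es = \<nu> - diag_pos n \<and> k < 2 * n"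
  then have vs: "distinct vs" "set vs = \<nu>" and es: "distinct es" "set es = \<nu> - diag_pos n" and k: "k < 2 * n"
    by auto
  have type: "\<nu> \<subseteq> {0..<n} \<times> {0..<n}" "card \<nu> + 1 = 2 * n" "diag_pos n \<subseteq> \<nu>"
    using assms by (auto simp: upper_triangular_type_def type_of_rank_def)
  have len: "length es = n - 1" by (rule length_off_diagonal[OF assms es])
  have "set es \<subseteq> {..<n} \<times> {..<n}" using es(2) type(1) by auto
  then have \<Sigma>: "orient_per bvar (\<lambda>e. fst (es ! e)) (\<lambda>e. snd (es ! e)) {0..<n - 1} = Sigma_poly (generic_sym n) es"
    using orient_per_eq_Sigma_poly[of es n] len by simp
  have sgn: "(- 1 :: sym_poly) ^ (n - 1) = 1" using n by simp
  show "mat_trace ((map_mat ext_const (generic_sym n) * Upsilon n \<nu>) ^\<^sub>m (2 * n - 1)) =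
      of_nat (2 * n - 1) * ext_const (det (generic_sym n) * Sigma_poly (generic_sym n) es) * omega_form n vs k"
    unfolding trace_upper_triangular[OF assms es] omega_form_upper_triangular[OF assms n vs es k] \<Sigma> sgn
      times_evenalg.rep_eq even_const.rep_eq mult_1_left mult.assoc
    by (simp only: mult.assoc[symmetric] ext_const_commute[of _ "omega 0 0"])
next
  assume n: "even n"
  have type: "\<nu> \<subseteq> {0..<n} \<times> {0..<n}" "card \<nu> + 1 = 2 * n"
    using assms by (auto simp: upper_triangular_type_def type_of_rank_def)
  have "finite \<nu>" using type(1) by (rule finite_subset) simp
  then obtain es where es: "distinct es" "set es = \<nu> - diag_pos n"
    using finite_distinct_list[of "\<nu> - diag_pos n"] by auto
  have "odd (n - 1)" using n type(2) by (cases n) auto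
  then have "orient_per bvar (\<lambda>e. fst (es ! e)) (\<lambda>e. snd (es ! e)) {0..<n - 1} = 0"
    by (intro orient_per_odd_eq_0) simp_all
  then show "mat_trace ((map_mat ext_const (generic_sym n) * Upsilon n \<nu>) ^\<^sub>m (2 * n - 1)) = 0"
    unfolding trace_upper_triangular[OF assms es] by (simp add: zero_evenalg.rep_eq)
qed

end
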